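(* Let $g\ge 2$ and let $G=\langle c_1,\dots,c_{2g}\mid c_1c_2\cdots c_{2g}c_1^{-1}c_2^{-1}\cdots c_{2g}^{-1}\rangle$, with generating set $\{c_1,\dots,c_{2g}\}$. Then the conjugator length function $\mathrm{CL}:\mathbb N\to\mathbb N$ of $G$ satisfies, for every $n\in\mathbb N$, $$n-1\le \mathrm{CL}(2n)=\mathrm{CL}(2n+1)\le n+8g-1 .$$
   Context: $G$ is the fundamental group of the closed orientable surface of genus $g$. For $u\in G$, $|u|$ denotes the word length of $u$ with respect to the generating set $\{c_1,\dots,c_{2g}\}$, i.e. the least $n$ such that $u$ is a product of $n$ elements of $\{c_1^{\pm1},\dots,c_{2g}^{\pm1}\}$. For conjugate elements $u,v\in G$, put $\mathrm{CL}(u,v)=\min\{|w| : w\in G,\ u=w^{-1}vw\}$. The conjugator length function is defined by letting $\mathrm{CL}(n)$ be the least integer $N$ such that $\mathrm{CL}(u,v)\le N$ for all conjugate $u,v\in G$ with $|u|+|v|\le n$. *)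

theory Defs
  imports "HOL-Algebra.Group"
begin

text \<open>A letter is a generator tagged with a sign: \<open>(x, True)\<close> stands for \<open>x\<close> and
  \<open>(x, False)\<close> for its formal inverse.\<close>

type_synonym 'a word = "('a \<times> bool) list"

definition letter_inv :: "'a \<times> bool \<Rightarrow> 'a \<times> bool" where
  "letter_inv a = (fst a, \<not> snd a)"

definition words :: "'a set \<Rightarrow> 'a word set" where
  "words X = lists (X \<times> UNIV)"

text \<open>Two words represent the same element of \<open>\<langle>X | R\<rangle>\<close> iff one is obtained from the other by
  finitely many insertions and deletions of pairs \<open>a a\<^sup>-\<^sup>1\<close> and of relators.\<close>

inductive pres_eq :: "'a set \<Rightarrow> 'a word set \<Rightarrow> 'a word \<Rightarrow> 'a word \<Rightarrow> bool"
  for X :: "'a set" and R :: "'a word set" where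
  refl: "w \<in> words X \<Longrightarrow> pres_eq X R w w"
| sym: "pres_eq X R v w \<Longrightarrow> pres_eq X R w v"
| trans: "pres_eq X R u v \<Longrightarrow> pres_eq X R v w \<Longrightarrow> pres_eq X R u w"
| cancel: "v \<in> words X \<Longrightarrow> w \<in> words X \<Longrightarrow> a \<in> X \<times> UNIV
    \<Longrightarrow> pres_eq X R (v @ [a, letter_inv a] @ w) (v @ w)"
| relator: "v \<in> words X \<Longrightarrow> w \<in> words X \<Longrightarrow> r \<in> R \<Longrightarrow> r \<in> words X
    \<Longrightarrow> pres_eq X R (v @ r @ w) (v @ w)"

definition pres_class :: "'a set \<Rightarrow> 'a word set \<Rightarrow> 'a word \<Rightarrow> 'a word set" where
  "pres_class X R w = {v. pres_eq X R w v}"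

definition presented_group :: "'a set \<Rightarrow> 'a word set \<Rightarrow> 'a word set monoid" where
  "presented_group X R =
    \<lparr>carrier = pres_class X R ` words X,
     mult = (\<lambda>A B. {w. \<exists>a\<in>A. \<exists>b\<in>B. pres_eq X R (a @ b) w}),
     one = pres_class X R []\<rparr>"

definition surface_relator :: "nat \<Rightarrow> nat word" where
  "surface_relator g =
    map (\<lambda>i. (i, True)) [1..<2 * g + 1] @ map (\<lambda>i. (i, False)) [1..<2 * g + 1]"

definition surface_group :: "nat \<Rightarrow> nat word set monoid" where
  "surface_group g = presented_group {1..2 * g} {surface_relator g}"

definition surface_gens :: "nat \<Rightarrow> nat word set set" where
  "surface_gens g = (\<lambda>i. pres_class {1..2 * g} {surface_relator g} [(i, True)]) ` {1..2 * g}"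

definition word_length :: "('b, 'm) monoid_scheme \<Rightarrow> 'b set \<Rightarrow> 'b \<Rightarrow> nat" where
  "word_length G S u = (LEAST n. \<exists>xs. length xs = n \<and> set xs \<subseteq> S \<union> (\<lambda>s. inv\<^bsub>G\<^esub> s) ` S
      \<and> u = foldr (\<lambda>x y. x \<otimes>\<^bsub>G\<^esub> y) xs \<one>\<^bsub>G\<^esub>)"

definition conjugate :: "('b, 'm) monoid_scheme \<Rightarrow> 'b \<Rightarrow> 'b \<Rightarrow> bool" where
  "conjugate G u v \<longleftrightarrow> u \<in> carrier G \<and> v \<in> carrier G
      \<and> (\<exists>w\<in>carrier G. u = inv\<^bsub>G\<^esub> w \<otimes>\<^bsub>G\<^esub> v \<otimes>\<^bsub>G\<^esub> w)"

definition conjugator_length :: "('b, 'm) monoid_scheme \<Rightarrow> 'b set \<Rightarrow> 'b \<Rightarrow> 'b \<Rightarrow> nat" where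
  "conjugator_length G S u v = (LEAST k. \<exists>w\<in>carrier G.
      u = inv\<^bsub>G\<^esub> w \<otimes>\<^bsub>G\<^esub> v \<otimes>\<^bsub>G\<^esub> w \<and> word_length G S w = k)"

definition conjugator_length_fun :: "('b, 'm) monoid_scheme \<Rightarrow> 'b set \<Rightarrow> nat \<Rightarrow> nat" where
  "conjugator_length_fun G S n = (LEAST N. \<forall>u v. conjugate G u v
      \<and> word_length G S u + word_length G S v \<le> n \<longrightarrow> conjugator_length G S u v \<le> N)"

definition surface_CL :: "nat \<Rightarrow> nat \<Rightarrow> nat" where
  "surface_CL g = conjugator_length_fun (surface_group g) (surface_gens g)"

text \<open>Well-definedness: the presented group is a group in the sense of \<open>HOL-Algebra\<close>, the minima
  above range over nonempty sets when \<open>S\<close> is a finite generating set, and \<open>surface_gens\<close> is one.\<close>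

lemma letter_inv_in [simp]: "letter_inv a \<in> X \<times> UNIV \<longleftrightarrow> a \<in> X \<times> UNIV"
  by (cases a) (simp add: letter_inv_def)

lemma letter_inv_letter_inv [simp]: "letter_inv (letter_inv a) = a"
  by (simp add: letter_inv_def)

lemma words_append [simp]: "v @ w \<in> words X \<longleftrightarrow> v \<in> words X \<and> w \<in> words X"
  by (auto simp: words_def)

lemma words_Nil [simp]: "[] \<in> words X"
  by (simp add: words_def)

lemma words_Cons [simp]: "a # w \<in> words X \<longleftrightarrow> a \<in> X \<times> UNIV \<and> w \<in> words X"
  by (simp add: words_def)

lemma pres_eq_words: "pres_eq X R v w \<Longrightarrow> v \<in> words X \<and> w \<in> words X"
  by (induction rule: pres_eq.induct) simp_all

lemma pres_eq_append_both:
  assumes "pres_eq X R v w" "p \<in> words X" "q \<in> words X"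
  shows "pres_eq X R (p @ v @ q) (p @ w @ q)"
  using assms
proof (induction rule: pres_eq.induct)
  case (cancel v w a)
  then show ?case using pres_eq.cancel[of "p @ v" X "w @ q" a R] by simp
next
  case (relator v w r)
  then show ?case using pres_eq.relator[of "p @ v" X "w @ q" r R] by simp
qed (auto intro: pres_eq.intros)

lemma pres_eq_append:
  assumes "pres_eq X R v v'" "pres_eq X R w w'"
  shows "pres_eq X R (v @ w) (v' @ w')"
  using pres_eq_append_both[OF assms(1), of "[]" w] pres_eq_append_both[OF assms(2), of v' "[]"]
    pres_eq_words[OF assms(1)] pres_eq_words[OF assms(2)] by (auto intro: pres_eq.trans)

lemma pres_class_eq_iff:
  assumes "v \<in> words X" "w \<in> words X"
  shows "pres_class X R v = pres_class X R w \<longleftrightarrow> pres_eq X R v w"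
  using assms unfolding pres_class_def by (blast intro: pres_eq.intros)

lemma pres_mult:
  assumes "v \<in> words X" "w \<in> words X"
  shows "pres_class X R v \<otimes>\<^bsub>presented_group X R\<^esub> pres_class X R w = pres_class X R (v @ w)"
  using assms unfolding presented_group_def pres_class_def
  by (auto intro: pres_eq.refl pres_eq.trans pres_eq_append)

lemma words_inv: "w \<in> words X \<Longrightarrow> rev (map letter_inv w) \<in> words X"
  by (induction w) simp_all

lemma pres_eq_inv: "w \<in> words X \<Longrightarrow> pres_eq X R (rev (map letter_inv w) @ w) []"
proof (induction w)
  case Nil
  then show ?case by (simp add: pres_eq.refl)
next
  case (Cons a w)
  then have "a \<in> X \<times> UNIV" and w: "w \<in> words X" by simp_all
  then have "pres_eq X R (rev (map letter_inv w) @ [letter_inv a, letter_inv (letter_inv a)] @ w)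
      (rev (map letter_inv w) @ w)"
    by (intro pres_eq.cancel) (simp_all add: words_inv)
  then show ?case
    using Cons.IH[OF w] by (auto intro: pres_eq.trans)
qed

lemma group_presented_group: "group (presented_group X R)"
proof (rule groupI)
  have carr: "carrier (presented_group X R) = pres_class X R ` words X"
    and one: "\<one>\<^bsub>presented_group X R\<^esub> = pres_class X R []"
    by (simp_all add: presented_group_def)
  show "x \<otimes>\<^bsub>presented_group X R\<^esub> y \<in> carrier (presented_group X R)"
    if "x \<in> carrier (presented_group X R)" "y \<in> carrier (presented_group X R)" for x y
    using that by (auto simp: carr pres_mult)
  show "\<one>\<^bsub>presented_group X R\<^esub> \<in> carrier (presented_group X R)"
    by (simp add: carr one)
  show "x \<otimes>\<^bsub>presented_group X R\<^esub> y \<otimes>\<^bsub>presented_group X R\<^esub> z =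
      x \<otimes>\<^bsub>presented_group X R\<^esub> (y \<otimes>\<^bsub>presented_group X R\<^esub> z)"
    if "x \<in> carrier (presented_group X R)" "y \<in> carrier (presented_group X R)"
      "z \<in> carrier (presented_group X R)" for x y z
    using that by (auto simp: carr pres_mult)
  show "\<one>\<^bsub>presented_group X R\<^esub> \<otimes>\<^bsub>presented_group X R\<^esub> x = x"
    if "x \<in> carrier (presented_group X R)" for x
    using that by (auto simp: carr one pres_mult)
  show "\<exists>y\<in>carrier (presented_group X R). y \<otimes>\<^bsub>presented_group X R\<^esub> x = \<one>\<^bsub>presented_group X R\<^esub>"
    if x: "x \<in> carrier (presented_group X R)" for x
  proof -
    obtain w where w: "x = pres_class X R w" "w \<in> words X" using x carr by auto
    show ?thesis
      using w pres_eq_inv[OF w(2), of R] words_inv[OF w(2)]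
      by (intro bexI[of _ "pres_class X R (rev (map letter_inv w))"])
        (auto simp: carr one pres_mult pres_class_eq_iff)
  qed
qed

lemma group_surface_group: "group (surface_group g)"
  by (simp add: surface_group_def group_presented_group)

lemma surface_gens_generate:
  assumes "u \<in> carrier (surface_group g)"
  shows "\<exists>xs. set xs \<subseteq> surface_gens g \<union> (\<lambda>s. inv\<^bsub>surface_group g\<^esub> s) ` surface_gens g
    \<and> u = foldr (\<lambda>x y. x \<otimes>\<^bsub>surface_group g\<^esub> y) xs \<one>\<^bsub>surface_group g\<^esub>"
proof -
  let ?X = "{1..2 * g}" and ?R = "{surface_relator g}"
  let ?G = "surface_group g"
  interpret group ?G by (rule group_surface_group)
  have letter: "pres_class ?X ?R [a] \<in> surface_gens g \<union> (\<lambda>s. inv\<^bsub>?G\<^esub> s) ` surface_gens g"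
    if "a \<in> ?X \<times> UNIV" for a
  proof (cases "snd a")
    case True
    then show ?thesis using that by (auto simp: surface_gens_def)
  next
    case False
    then have a: "a = (fst a, False)" "fst a \<in> ?X" using that by (auto simp: prod_eq_iff)
    have "pres_eq ?X ?R ([] @ [a, letter_inv a] @ []) ([] @ [])"
      using that by (intro pres_eq.cancel) auto
    moreover have "letter_inv a = (fst a, True)"
      using False by (simp add: letter_inv_def)
    ultimately have eq: "pres_eq ?X ?R [a, (fst a, True)] []"
      by simp
    have wd: "[a] \<in> words ?X" "[(fst a, True)] \<in> words ?X" "[a, (fst a, True)] \<in> words ?X"
      using that a(2) by simp_all
    have "pres_class ?X ?R [a] \<otimes>\<^bsub>?G\<^esub> pres_class ?X ?R [(fst a, True)]
        = pres_class ?X ?R [a, (fst a, True)]"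
      unfolding surface_group_def using pres_mult[OF wd(1,2)] by simp
    also have "\<dots> = pres_class ?X ?R []"
      using eq wd(3) by (subst pres_class_eq_iff) simp_all
    also have "\<dots> = \<one>\<^bsub>?G\<^esub>"
      by (simp add: surface_group_def presented_group_def)
    finally have "pres_class ?X ?R [a] \<otimes>\<^bsub>?G\<^esub> pres_class ?X ?R [(fst a, True)] = \<one>\<^bsub>?G\<^esub>" .
    moreover have "pres_class ?X ?R [a] \<in> carrier ?G" "pres_class ?X ?R [(fst a, True)] \<in> carrier ?G"
      using wd by (auto simp: surface_group_def presented_group_def)
    ultimately have "inv\<^bsub>?G\<^esub> (pres_class ?X ?R [(fst a, True)]) = pres_class ?X ?R [a]"
      by (metis inv_equality)
    then show ?thesis using a(2) unfolding surface_gens_def by blast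
  qed
  have "set (map (\<lambda>a. pres_class ?X ?R [a]) w)
      \<subseteq> surface_gens g \<union> (\<lambda>s. inv\<^bsub>?G\<^esub> s) ` surface_gens g
    \<and> pres_class ?X ?R w
      = foldr (\<lambda>x y. x \<otimes>\<^bsub>?G\<^esub> y) (map (\<lambda>a. pres_class ?X ?R [a]) w) \<one>\<^bsub>?G\<^esub>"
    if "w \<in> words ?X" for w
    using that
  proof (induction w)
    case Nil
    then show ?case by (simp add: surface_group_def presented_group_def)
  next
    case (Cons a w)
    then have "a \<in> ?X \<times> UNIV" and w: "w \<in> words ?X" by auto
    have "pres_class ?X ?R (a # w) = pres_class ?X ?R [a] \<otimes>\<^bsub>?G\<^esub> pres_class ?X ?R w"
      using Cons.prems by (simp add: surface_group_def pres_mult)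
    with Cons.IH[OF w] letter[OF \<open>a \<in> ?X \<times> UNIV\<close>] show ?case
      by simp
  qed
  moreover obtain w where "w \<in> words ?X" "u = pres_class ?X ?R w"
    using assms by (auto simp: surface_group_def presented_group_def)
  ultimately show ?thesis by metis
qed

lemma conjugator_length_fun_exists:
  assumes "finite S"
    and gen: "\<And>u. u \<in> carrier G \<Longrightarrow> \<exists>xs. set xs \<subseteq> S \<union> (\<lambda>s. inv\<^bsub>G\<^esub> s) ` S
      \<and> u = foldr (\<lambda>x y. x \<otimes>\<^bsub>G\<^esub> y) xs \<one>\<^bsub>G\<^esub>"
  shows "\<exists>N. \<forall>u v. conjugate G u v \<and> word_length G S u + word_length G S v \<le> n
    \<longrightarrow> conjugator_length G S u v \<le> N"
proof -
  let ?T = "S \<union> (\<lambda>s. inv\<^bsub>G\<^esub> s) ` S"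
  let ?L = "{xs. set xs \<subseteq> ?T \<and> length xs \<le> n}"
  let ?B = "(\<lambda>xs. foldr (\<lambda>x y. x \<otimes>\<^bsub>G\<^esub> y) xs \<one>\<^bsub>G\<^esub>) ` ?L"
  have fin: "finite ?B"
    using assms(1) by (intro finite_imageI finite_lists_length_le) auto
  have inB: "u \<in> ?B" if u: "u \<in> carrier G" "word_length G S u \<le> n" for u
  proof -
    have "\<exists>k xs. length xs = k \<and> set xs \<subseteq> ?T \<and> u = foldr (\<lambda>x y. x \<otimes>\<^bsub>G\<^esub> y) xs \<one>\<^bsub>G\<^esub>"
      using gen[OF u(1)] by blast
    from LeastI_ex[OF this] have "\<exists>xs. length xs = word_length G S u \<and> set xs \<subseteq> ?T
        \<and> u = foldr (\<lambda>x y. x \<otimes>\<^bsub>G\<^esub> y) xs \<one>\<^bsub>G\<^esub>"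
      unfolding word_length_def .
    with u(2) show ?thesis by auto
  qed
  let ?C = "(\<lambda>(u, v). conjugator_length G S u v) ` (?B \<times> ?B)"
  have finC: "finite ?C" using fin by blast
  show ?thesis
  proof (intro exI[of _ "Max ?C"] allI impI)
    fix u v assume uv: "conjugate G u v \<and> word_length G S u + word_length G S v \<le> n"
    then have "u \<in> ?B" "v \<in> ?B" using inB[of u] inB[of v] unfolding conjugate_def by auto
    then have "conjugator_length G S u v \<in> ?C" by (intro image_eqI[of _ _ "(u, v)"]) simp_all
    with finC show "conjugator_length G S u v \<le> Max ?C" by (rule Max_ge)
  qed
qed

lemma finite_surface_gens: "finite (surface_gens g)"
  by (simp add: surface_gens_def)

end

theory Submission imports Defs Complex_Main begin

text \<open>
  In the Cayley 2-complex of \<open>G\<close> the relator cells are \<open>4g\<close>-gons in which the two edges labelled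
  \<open>c\<^sub>i\<close> are opposite. Joining the midpoints of opposite edges yields walls, each crossing edges of
  a single type \<open>i\<close>; the wall of the edge from \<open>p\<close> to \<open>q = p c\<^sub>i\<close> is the coset \<open>q\<langle>a\<^sub>i\<rangle>\<close>, where
  \<open>a\<^sub>i = c\<^sub>i\<^sub>+\<^sub>1 \<dots> c\<^sub>2\<^sub>g c\<^sub>1\<^sup>-\<^sup>1 \<dots> c\<^sub>i\<^sub>-\<^sub>1\<^sup>-\<^sup>1\<close>. Signed crossings with a fixed wall vanish around every relator,
  so each wall separates the group into two half-spaces, walls of the same type do not cross, and
  the word metric counts the walls separating two elements.

  For \<open>v \<noteq> 1\<close>, nestedness sorts the walls \<open>h\<close> into three classes: \<open>v\<close> stabilises \<open>h\<close>, or \<open>v\<close> makes a side of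
  \<open>h\<close> disjoint from its image (peripheral walls), or \<open>v\<close> strictly shrinks a side of \<open>h\<close> (axial walls).
  A peripheral wall separating \<open>x\<close> and \<open>y\<close> accounts for two walls separating \<open>x\<close> and \<open>v x\<close>, or \<open>y\<close> and \<open>v y\<close>.
  Axial walls with \<open>x\<close> ahead of \<open>y\<close> cross those with \<open>y\<close> ahead of \<open>x\<close>; since two walls of one type and
  two of another never form a grid, one of these two families has at most \<open>2g\<close> members. Replacing
  \<open>y\<close> by a suitable \<open>v\<^sup>n y\<close> balances the families, and the distance from \<open>x\<close> to \<open>v\<^sup>n y\<close> is at most half of
  \<open>|x\<^sup>-\<^sup>1 v x| + |y\<^sup>-\<^sup>1 v y|\<close>, up to \<open>6g\<close>. Taking \<open>x = 1\<close> and \<open>y\<close> a conjugator gives the upper bound.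

  The lower bound is witnessed by \<open>c\<^sub>1\<close> and \<open>c\<^sub>2\<^sup>-\<^sup>k c\<^sub>1 c\<^sub>2\<^sup>k\<close>: in an affine action of \<open>G\<close> on the line a conjugator
  must scale by \<open>2\<^sup>k\<close>, while every generator scales by at most \<open>2\<close>.
\<close>

section \<open>Formal inverses of words\<close>

definition word_inv :: "'a word \<Rightarrow> 'a word" where
  "word_inv w = rev (map letter_inv w)"

lemma word_inv_simps [simp]:
  "word_inv [] = []" "word_inv (v @ w) = word_inv w @ word_inv v"
  "word_inv (word_inv w) = w" "length (word_inv w) = length w"
  "set (word_inv w) = letter_inv ` set w"
  by (simp_all add: word_inv_def rev_map o_def)

lemma fst_letter_inv [simp]: "fst (letter_inv x) = fst x"
  and snd_letter_inv [simp]: "snd (letter_inv x) \<longleftrightarrow> \<not> snd x"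
  by (simp_all add: letter_inv_def)

lemma word_inv_in_words [simp]: "word_inv w \<in> words X \<longleftrightarrow> w \<in> words X"
  unfolding word_inv_def by (induction w) auto

lemma words_iff: "w \<in> words X \<longleftrightarrow> (\<forall>x\<in>set w. fst x \<in> X)"
  by (induction w) auto

section \<open>Walks in the Cayley graph\<close>

locale surface =
  fixes g :: nat
  assumes genus: "2 \<le> g"
begin

definition X :: "nat set" where "X = {1..2 * g}"
abbreviation "relr \<equiv> surface_relator g"
abbreviation "G \<equiv> surface_group g"
abbreviation "V \<equiv> carrier G"
definition cls :: "nat word \<Rightarrow> nat word set" where "cls = pres_class X {relr}"
abbreviation "eqv \<equiv> pres_eq X {relr}"

sublocale group "surface_group g"
  by (rule group_surface_group)

text \<open>Letters outside \<open>X\<close> are sent to the identity, so that every word walks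
  inside the group.\<close>

definition gen :: "nat \<times> bool \<Rightarrow> nat word set" where
  "gen x = (if fst x \<in> X then cls [x] else \<one>\<^bsub>G\<^esub>)"

definition walk :: "nat word set \<Rightarrow> nat word \<Rightarrow> nat word set" (infixl "\<bullet>" 70) where
  "p \<bullet> w = foldl (\<lambda>p x. p \<otimes>\<^bsub>G\<^esub> gen x) p w"

lemma V_eq: "V = cls ` words X" and one_eq: "\<one>\<^bsub>G\<^esub> = cls []"
  by (simp_all add: surface_group_def presented_group_def cls_def X_def)

lemma cls_mult: "v \<in> words X \<Longrightarrow> w \<in> words X \<Longrightarrow> cls v \<otimes>\<^bsub>G\<^esub> cls w = cls (v @ w)"
  unfolding surface_group_def cls_def X_def by (rule pres_mult)

lemma cls_eq: "v \<in> words X \<Longrightarrow> w \<in> words X \<Longrightarrow> cls v = cls w \<longleftrightarrow> eqv v w"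
  unfolding cls_def by (rule pres_class_eq_iff)

lemma gen_closed [simp]: "gen x \<in> V"
  by (cases x) (auto simp: gen_def V_eq one_eq)

lemma walk_Nil [simp]: "p \<bullet> [] = p"
  by (simp add: walk_def)

lemma walk_append: "p \<bullet> (v @ w) = p \<bullet> v \<bullet> w"
  by (simp add: walk_def)

lemma walk_Cons: "p \<bullet> (x # w) = p \<bullet> [x] \<bullet> w"
  by (simp add: walk_def)

lemma walk_closed [simp]: "p \<in> V \<Longrightarrow> p \<bullet> w \<in> V"
  by (induction w arbitrary: p) (simp_all add: walk_def)

text \<open>Words act on the right and the group on the left, so translating a path keeps its
  labels; this is what makes walls equivariant.\<close>

lemma walk_mult: "v \<in> V \<Longrightarrow> p \<in> V \<Longrightarrow> (v \<otimes>\<^bsub>G\<^esub> p) \<bullet> w = v \<otimes>\<^bsub>G\<^esub> (p \<bullet> w)"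
  by (induction w rule: rev_induct) (simp_all add: walk_append walk_def[of _ "[_]"] m_assoc)

lemma walk_one: "p \<in> V \<Longrightarrow> p \<bullet> w = p \<otimes>\<^bsub>G\<^esub> (\<one>\<^bsub>G\<^esub> \<bullet> w)"
  using walk_mult[of p "\<one>\<^bsub>G\<^esub>" w] by simp

lemma walk_cls: "v \<in> words X \<Longrightarrow> w \<in> words X \<Longrightarrow> cls v \<bullet> w = cls (v @ w)"
proof (induction w arbitrary: v)
  case (Cons x w)
  then have "cls v \<bullet> [x] = cls (v @ [x])"
    by (cases x) (auto simp: walk_def gen_def cls_mult)
  with Cons show ?case
    by (subst walk_Cons) simp
qed simp

lemma walk_letter_inv: "p \<in> V \<Longrightarrow> p \<bullet> [x] \<bullet> [letter_inv x] = p"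
proof (cases "fst x \<in> X")
  case True
  assume "p \<in> V"
  then obtain v where v: "p = cls v" "v \<in> words X" by (auto simp: V_eq)
  have "eqv (v @ [x, letter_inv x] @ []) (v @ [])"
    using v True by (intro pres_eq.cancel) (cases x; simp)+
  moreover have x: "x \<in> X \<times> UNIV" using True by (cases x) simp
  ultimately show ?thesis
    using v by (simp add: walk_cls cls_eq)
qed (simp add: walk_def gen_def)

lemma walk_word_inv [simp]: "p \<in> V \<Longrightarrow> p \<bullet> w \<bullet> word_inv w = p"
proof (induction w arbitrary: p)
  case (Cons x w)
  have "word_inv (x # w) = word_inv w @ [letter_inv x]" by (simp add: word_inv_def)
  with Cons show ?case
    by (simp add: walk_Cons[of p x w] walk_append walk_letter_inv)
qed simp

lemma walk_eq_iff: "p \<in> V \<Longrightarrow> v \<in> words X \<Longrightarrow> w \<in> words X \<Longrightarrow> p \<bullet> v = p \<bullet> w \<longleftrightarrow> eqv v w"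
proof -
  assume p: "p \<in> V" and v: "v \<in> words X" and w: "w \<in> words X"
  have c: "\<one>\<^bsub>G\<^esub> \<bullet> v = cls v" "\<one>\<^bsub>G\<^esub> \<bullet> w = cls w"
    using walk_cls[of "[]" v] walk_cls[of "[]" w] v w by (simp_all add: one_eq)
  have "cls v \<in> V" "cls w \<in> V" using v w by (auto simp: V_eq)
  then have "p \<bullet> v = p \<bullet> w \<longleftrightarrow> cls v = cls w"
    unfolding walk_one[OF p, of v] walk_one[OF p, of w] c by (simp add: p)
  then show ?thesis using cls_eq v w by simp
qed

lemma walk_ex: "p \<in> V \<Longrightarrow> q \<in> V \<Longrightarrow> \<exists>w\<in>words X. q = p \<bullet> w"
proof -
  assume pq: "p \<in> V" "q \<in> V"
  then have "inv\<^bsub>G\<^esub> p \<otimes>\<^bsub>G\<^esub> q \<in> cls ` words X" unfolding V_eq[symmetric] by simp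
  then obtain w where w: "w \<in> words X" "inv\<^bsub>G\<^esub> p \<otimes>\<^bsub>G\<^esub> q = cls w" by blast
  have "\<one>\<^bsub>G\<^esub> \<bullet> w = cls w" using walk_cls[of "[]" w] w by (simp add: one_eq)
  then have "p \<bullet> w = p \<otimes>\<^bsub>G\<^esub> (inv\<^bsub>G\<^esub> p \<otimes>\<^bsub>G\<^esub> q)" using pq w walk_one[of p w] by simp
  also have "\<dots> = q" using pq m_assoc[of p "inv\<^bsub>G\<^esub> p" q] by simp
  finally have "p \<bullet> w = q" .
  with w show ?thesis by auto
qed

lemma surface_relator_words [simp]: "relr \<in> words X"
  by (auto simp: words_iff surface_relator_def X_def)

lemma walk_relator: "p \<in> V \<Longrightarrow> p \<bullet> relr = p"
proof -
  assume p: "p \<in> V"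
  have "eqv ([] @ relr @ []) ([] @ [])"
    by (rule pres_eq.relator) auto
  with p show ?thesis using walk_eq_iff[of p relr "[]"] by simp
qed

section \<open>The two sides of a relator cell\<close>

definition right_word :: "nat \<Rightarrow> nat word" where
  "right_word i = map (\<lambda>j. (j, True)) [Suc i..<2 * g + 1] @ map (\<lambda>j. (j, False)) [1..<i]"

text \<open>Around a relator cell, \<open>right_word i\<close> leads from the head of an edge of
  type \<open>i\<close> to the head of the opposite edge. Between the tails the letters occur in
  reversed order but are not inverted, hence \<open>rev\<close> without
  \<open>letter_inv\<close>.\<close>

definition side_word :: "nat \<Rightarrow> bool \<Rightarrow> nat word" where
  "side_word i e = (if e then right_word i else rev (right_word i))"

lemma set_side_word: "set (side_word i e) = {Suc i..2 * g} \<times> {True} \<union> {1..<i} \<times> {False}"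
  by (auto simp: side_word_def right_word_def)

lemma side_word_words [simp]: "i \<in> X \<Longrightarrow> side_word i e \<in> words X"
  by (auto simp: words_iff set_side_word X_def)

lemma relator_split:
  assumes "i \<in> X"
  shows "relr = map (\<lambda>j. (j, True)) [1..<i] @ [(i, True)] @ right_word i @ [(i, False)]
    @ map (\<lambda>j. (j, False)) [Suc i..<2 * g + 1]"
proof -
  have "[1..<2 * g + 1] = [1..<i] @ i # [Suc i..<2 * g + 1]"
    using assms[unfolded X_def] upt_add_eq_append[of 1 i "2 * g + 1 - i"] by (simp add: upt_conv_Cons)
  then show ?thesis
    by (simp add: surface_relator_def right_word_def)
qed

lemma flip_right: "p \<in> V \<Longrightarrow> i \<in> X \<Longrightarrow>
    p \<bullet> [(i, True)] \<bullet> side_word i True = p \<bullet> side_word i False \<bullet> [(i, True)]"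
proof -
  assume p: "p \<in> V" and i: "i \<in> X"
  let ?f = "map (\<lambda>j. (j, True)) [1..<i]" and ?h = "map (\<lambda>j. (j, False)) [Suc i..<2 * g + 1]"
  have rw: "word_inv ?f @ word_inv ?h = side_word i False"
    "word_inv (word_inv ?f) = ?f" 
    by (simp_all add: word_inv_def side_word_def right_word_def rev_map o_def letter_inv_def)
  \<comment> \<open>\<open>q\<close> is the vertex of the cell from which its boundary reads
    \<open>relr\<close>; \<open>p\<close> is the tail of the first edge of type
    \<open>i\<close>.\<close>
  define q where "q = p \<bullet> word_inv ?f"
  have q: "q \<in> V" "q \<bullet> ?f = p"
    using p walk_word_inv[of p "word_inv ?f"] by (simp_all add: q_def)
  have "q = q \<bullet> relr" using q(1) by (simp add: walk_relator)
  also have "\<dots> = p \<bullet> [(i, True)] \<bullet> right_word i \<bullet> [(i, False)] \<bullet> ?h"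
    by (subst relator_split[OF i]) (simp only: walk_append q(2))
  finally have "q \<bullet> word_inv ?h = p \<bullet> [(i, True)] \<bullet> right_word i \<bullet> [(i, False)]"
    using p by simp
  moreover have "q \<bullet> word_inv ?h = p \<bullet> side_word i False"
    unfolding q_def rw(1)[symmetric] by (simp add: walk_append)
  ultimately have "p \<bullet> side_word i False \<bullet> [(i, True)]
      = p \<bullet> [(i, True)] \<bullet> right_word i \<bullet> [(i, False)] \<bullet> [letter_inv (i, False)]"
    by (simp add: letter_inv_def)
  then show ?thesis
    using p by (simp add: walk_letter_inv side_word_def)
qed

lemma flip: "p \<in> V \<Longrightarrow> i \<in> X \<Longrightarrow>
    p \<bullet> [(i, e)] \<bullet> side_word i e = p \<bullet> side_word i (\<not> e) \<bullet> [(i, e)]"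
proof (cases e)
  case False
  assume p: "p \<in> V" and i: "i \<in> X"
  have li: "letter_inv (i, False) = (i, True)" "letter_inv (i, True) = (i, False)"
    by (simp_all add: letter_inv_def)
  \<comment> \<open>The negative letter at \<open>p\<close> is the positive edge that starts at
    \<open>?q\<close>, to which \<open>flip_right\<close> applies.\<close>
  let ?q = "p \<bullet> [(i, False)]"
  have "?q \<bullet> [(i, True)] \<bullet> side_word i True = ?q \<bullet> side_word i False \<bullet> [(i, True)]"
    using p i by (intro flip_right) auto
  moreover have "?q \<bullet> [(i, True)] = p" using p walk_letter_inv[of p "(i, False)"] li by simp
  ultimately have "p \<bullet> side_word i True \<bullet> [(i, False)] = ?q \<bullet> side_word i False \<bullet> [(i, True)] \<bullet> [letter_inv (i, True)]"
    by (simp add: li)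
  then show ?thesis using False p by (simp add: walk_letter_inv)
qed (simp add: flip_right)

section \<open>Walls\<close>

abbreviation side_elt :: "nat \<Rightarrow> nat word set" where
  "side_elt i \<equiv> \<one>\<^bsub>G\<^esub> \<bullet> side_word i True"

definition coset :: "nat \<Rightarrow> nat word set \<Rightarrow> nat word set set" where
  "coset i q = {q \<otimes>\<^bsub>G\<^esub> side_elt i [^]\<^bsub>G\<^esub> m |m :: int. True}"

text \<open>A wall is recorded by its type and the set of heads of its edges. A positive letter ends
  at such a head, a negative one starts there.\<close>

definition wall_of :: "nat word set \<Rightarrow> nat \<times> bool \<Rightarrow> nat \<times> nat word set set" where
  "wall_of p x = (fst x, coset (fst x) (if snd x then p \<bullet> [x] else p))"

definition walls :: "(nat \<times> nat word set set) set" where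
  "walls = {(i, coset i q) |i q. i \<in> X \<and> q \<in> V}"

text \<open>The letter \<open>(fst h, \<not> e)\<close> leads from side \<open>e\<close> to the
  other side: \<open>e = True\<close> gives the heads of the edges of \<open>h\<close>,
  \<open>e = False\<close> their tails.\<close>

definition border :: "nat \<times> nat word set set \<Rightarrow> bool \<Rightarrow> nat word set set" where
  "border h e = {p \<in> V. wall_of p (fst h, \<not> e) = h}"

fun crossings :: "nat \<times> nat word set set \<Rightarrow> nat word set \<Rightarrow> nat word \<Rightarrow> int" where
  "crossings h p [] = 0"
| "crossings h p (x # w)
    = (if wall_of p x = h then if snd x then 1 else - 1 else 0) + crossings h (p \<bullet> [x]) w"

text \<open>The positive side of \<open>h\<close>. Independence of the path and of the starting head
  is shown in \<open>walk_in_halfspace\<close>.\<close>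

definition halfspace :: "nat \<times> nat word set set \<Rightarrow> nat word set set" where
  "halfspace h = {p \<in> V. \<exists>q\<in>border h True. \<exists>w\<in>words X. p = q \<bullet> w \<and> crossings h q w = 0}"

definition word_pow :: "nat word \<Rightarrow> int \<Rightarrow> nat word" where
  "word_pow w m = concat (replicate (nat \<bar>m\<bar>) (if 0 \<le> m then w else word_inv w))"

section \<open>Cosets, powers of words and borders\<close>

lemma coset_eq: "q \<in> V \<Longrightarrow> q' \<in> V \<Longrightarrow> coset i q' = coset i q \<longleftrightarrow> (\<exists>m::int. q' = q \<otimes>\<^bsub>G\<^esub> side_elt i [^]\<^bsub>G\<^esub> m)"
proof
  assume q: "q \<in> V" "q' \<in> V" and eq: "coset i q' = coset i q"
  have "q' = q' \<otimes>\<^bsub>G\<^esub> side_elt i [^]\<^bsub>G\<^esub> (0::int)" using q by simp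
  then have "q' \<in> coset i q'" unfolding coset_def by blast
  then show "\<exists>m::int. q' = q \<otimes>\<^bsub>G\<^esub> side_elt i [^]\<^bsub>G\<^esub> m" unfolding eq by (auto simp: coset_def)
next
  assume q: "q \<in> V" "q' \<in> V" and "\<exists>m::int. q' = q \<otimes>\<^bsub>G\<^esub> side_elt i [^]\<^bsub>G\<^esub> m"
  then obtain m :: int where m: "q' = q \<otimes>\<^bsub>G\<^esub> side_elt i [^]\<^bsub>G\<^esub> m" by auto
  have 1: "q' \<otimes>\<^bsub>G\<^esub> side_elt i [^]\<^bsub>G\<^esub> n = q \<otimes>\<^bsub>G\<^esub> side_elt i [^]\<^bsub>G\<^esub> (m + n)" for n :: int
    using q by (simp add: m m_assoc int_pow_mult)
  have 2: "q \<otimes>\<^bsub>G\<^esub> side_elt i [^]\<^bsub>G\<^esub> n = q' \<otimes>\<^bsub>G\<^esub> side_elt i [^]\<^bsub>G\<^esub> (n - m)" for n :: int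
    unfolding 1 by simp
  show "coset i q' = coset i q"
    unfolding coset_def using 1 2 by blast
qed

lemma walk_concat_replicate:
  "p \<in> V \<Longrightarrow> p \<bullet> concat (replicate n w) = p \<otimes>\<^bsub>G\<^esub> (\<one>\<^bsub>G\<^esub> \<bullet> w) [^]\<^bsub>G\<^esub> n"
proof (induction n arbitrary: p)
  case (Suc n)
  have "p \<bullet> concat (replicate (Suc n) w) = (p \<otimes>\<^bsub>G\<^esub> (\<one>\<^bsub>G\<^esub> \<bullet> w)) \<otimes>\<^bsub>G\<^esub> (\<one>\<^bsub>G\<^esub> \<bullet> w) [^]\<^bsub>G\<^esub> n"
    using Suc by (simp add: walk_append walk_one[of p w])
  also have "\<dots> = p \<otimes>\<^bsub>G\<^esub> (\<one>\<^bsub>G\<^esub> \<bullet> w) [^]\<^bsub>G\<^esub> Suc n"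
    using Suc.prems by (simp only: nat_pow_Suc2 m_assoc walk_closed one_closed nat_pow_closed)
  finally show ?case .
qed simp

lemma one_walk_word_inv: "\<one>\<^bsub>G\<^esub> \<bullet> word_inv w = inv\<^bsub>G\<^esub> (\<one>\<^bsub>G\<^esub> \<bullet> w)"
proof -
  have "(\<one>\<^bsub>G\<^esub> \<bullet> w) \<bullet> word_inv w = \<one>\<^bsub>G\<^esub>" by simp
  then have "(\<one>\<^bsub>G\<^esub> \<bullet> w) \<otimes>\<^bsub>G\<^esub> (\<one>\<^bsub>G\<^esub> \<bullet> word_inv w) = \<one>\<^bsub>G\<^esub>"
    using walk_one[of "\<one>\<^bsub>G\<^esub> \<bullet> w" "word_inv w"] by simp
  then show ?thesis
    using inv_equality[of "\<one>\<^bsub>G\<^esub> \<bullet> word_inv w" "\<one>\<^bsub>G\<^esub> \<bullet> w"] inv_comm by (metis one_closed walk_closed inv_equality)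
qed

lemma walk_word_pow: "p \<in> V \<Longrightarrow> p \<bullet> word_pow w m = p \<otimes>\<^bsub>G\<^esub> (\<one>\<^bsub>G\<^esub> \<bullet> w) [^]\<^bsub>G\<^esub> m"
proof (cases "0 \<le> m")
  case True
  assume "p \<in> V"
  with True show ?thesis
    unfolding word_pow_def using int_pow_int[of G "\<one>\<^bsub>G\<^esub> \<bullet> w" "nat m"] by (simp add: walk_concat_replicate)
next
  case False
  assume p: "p \<in> V"
  define n where "n = nat (- m)"
  have m: "m = - int n" "\<bar>m\<bar> = int n" using False by (simp_all add: n_def)
  have "(\<one>\<^bsub>G\<^esub> \<bullet> word_inv w) [^]\<^bsub>G\<^esub> n = inv\<^bsub>G\<^esub> ((\<one>\<^bsub>G\<^esub> \<bullet> w) [^]\<^bsub>G\<^esub> n)"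
    unfolding one_walk_word_inv by (rule nat_pow_inv) simp
  also have "\<dots> = (\<one>\<^bsub>G\<^esub> \<bullet> w) [^]\<^bsub>G\<^esub> m"
    unfolding m(1) by (rule int_pow_neg_int[symmetric]) simp
  finally show ?thesis
    unfolding word_pow_def using False p by (simp add: walk_concat_replicate m(2))
qed

lemma word_pow_0 [simp]: "word_pow w 0 = []"
  and word_pow_1 [simp]: "word_pow w 1 = w"
  by (simp_all add: word_pow_def)

lemma walk_word_pow_add:
  "p \<in> V \<Longrightarrow> p \<bullet> word_pow w (m + n) = p \<bullet> word_pow w m \<bullet> word_pow w n"
  by (simp add: walk_word_pow int_pow_mult m_assoc)

lemma word_pow_words [simp]: "w \<in> words X \<Longrightarrow> word_pow w m \<in> words X"
  by (auto simp: words_iff word_pow_def)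

lemma length_word_pow: "length (word_pow w m) = nat \<bar>m\<bar> * length w"
  by (simp add: word_pow_def length_concat sum_list_replicate)

lemma walk_conj_concat_replicate:
  assumes "\<And>p. p \<in> V \<Longrightarrow> p \<bullet> [x] \<bullet> w = p \<bullet> w' \<bullet> [x]"
  shows "p \<in> V \<Longrightarrow> p \<bullet> [x] \<bullet> concat (replicate n w) = p \<bullet> concat (replicate n w') \<bullet> [x]"
  using assms by (induction n arbitrary: p) (simp_all add: walk_append)

text \<open>An edge is pushed through consecutive cells along its wall, which turns a path on one
  side of the wall into the parallel path on the other.\<close>

lemma walk_flip_word_pow:
  assumes p: "p \<in> V" and i: "i \<in> X"
  shows "p \<bullet> [(i, e)] \<bullet> word_pow (side_word i e) m = p \<bullet> word_pow (side_word i (\<not> e)) m \<bullet> [(i, e)]"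
proof -
  have *: "q \<bullet> [(i, e)] \<bullet> word_inv (side_word i e) = q \<bullet> word_inv (side_word i (\<not> e)) \<bullet> [(i, e)]"
    if q: "q \<in> V" for q
  proof -
    let ?q = "q \<bullet> word_inv (side_word i (\<not> e))"
    have "?q \<bullet> [(i, e)] \<bullet> side_word i e = ?q \<bullet> side_word i (\<not> e) \<bullet> [(i, e)]"
      using q i by (intro flip) auto
    also have "\<dots> = q \<bullet> [(i, e)]"
      using q walk_word_inv[of q "word_inv (side_word i (\<not> e))"] by simp
    finally show ?thesis
      using q walk_word_inv[of "?q \<bullet> [(i, e)]" "side_word i e"] by simp
  qed
  show ?thesis
    unfolding word_pow_def using p i flip *
    by (auto intro!: walk_conj_concat_replicate)
qed

lemma border_right: "border h True = {p \<in> V. coset (fst h) p = snd h}"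
  by (auto simp: border_def wall_of_def prod_eq_iff)

lemma border_left: "border h False = {p \<in> V. p \<bullet> [(fst h, True)] \<in> border h True}"
  by (auto simp: border_def wall_of_def prod_eq_iff)

lemma border_flip: "p \<in> border h (\<not> e) \<Longrightarrow> p \<bullet> [(fst h, e)] \<in> border h e"
proof (cases e)
  case False
  assume "p \<in> border h (\<not> e)"
  with False have p: "p \<in> border h True" by simp
  then have "p \<in> V" by (simp add: border_def)
  then have "p \<bullet> [(fst h, False)] \<bullet> [(fst h, True)] = p"
    using walk_letter_inv[of p "(fst h, False)"] by (simp add: letter_inv_def)
  with p False \<open>p \<in> V\<close> show ?thesis by (simp add: border_left)
qed (simp add: border_left)

lemma wall_of_walls [simp]: "p \<in> V \<Longrightarrow> fst x \<in> X \<Longrightarrow> wall_of p x \<in> walls"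
  by (auto simp: wall_of_def walls_def)

lemma fst_wall [simp]: "h \<in> walls \<Longrightarrow> fst h \<in> X"
  by (auto simp: walls_def)

lemma fst_wall_of [simp]: "fst (wall_of p x) = fst x"
  by (simp add: wall_of_def)

lemma border_closed: "p \<in> border h e \<Longrightarrow> p \<in> V"
  by (simp add: border_def)

lemma border_nonempty: "h \<in> walls \<Longrightarrow> \<exists>p. p \<in> border h e"
proof -
  assume "h \<in> walls"
  then obtain i q where "h = (i, coset i q)" "q \<in> V" by (auto simp: walls_def)
  then have "q \<in> border h True" by (simp add: border_right)
  then show ?thesis using border_flip[of q h False] by (cases e) auto
qed

text \<open>The heads of the edges of \<open>h\<close> form a coset of a cyclic group, hence a line
  traced by \<open>side_word\<close>; walking back over the edges carries this description to the
  tails.\<close>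

lemma border_iff:
  assumes "h \<in> walls" "p \<in> border h e"
  shows "q \<in> border h e \<longleftrightarrow> (\<exists>m. q = p \<bullet> word_pow (side_word (fst h) e) m)"
proof -
  have R: "q \<in> border h True \<longleftrightarrow> (\<exists>m. q = p \<bullet> word_pow (side_word (fst h) True) m)"
    if p: "p \<in> border h True" for p q
  proof -
    have pV: "p \<in> V" and c: "coset (fst h) p = snd h" using p by (simp_all add: border_right)
    have "q \<in> border h True \<longleftrightarrow> q \<in> V \<and> coset (fst h) q = coset (fst h) p"
      unfolding border_right c by blast
    also have "\<dots> \<longleftrightarrow> q \<in> V \<and> (\<exists>m. q = p \<bullet> word_pow (side_word (fst h) True) m)"
      using coset_eq[OF pV, of q "fst h"] unfolding walk_word_pow[OF pV] by blast
    also have "\<dots> \<longleftrightarrow> (\<exists>m. q = p \<bullet> word_pow (side_word (fst h) True) m)"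
      using walk_closed[OF pV] by blast
    finally show ?thesis .
  qed
  show ?thesis
  proof (cases e)
    case True
    then have e: "e = True" by simp
    show ?thesis using assms(2) unfolding e by (rule R)
  next
    case False
    let ?c = "[(fst h, True)]"
    have pV: "p \<in> V" and pb: "p \<bullet> ?c \<in> border h True"
      using assms False by (auto simp: border_left)
    have flip: "p \<bullet> ?c \<bullet> word_pow (side_word (fst h) True) m
        = p \<bullet> word_pow (side_word (fst h) False) m \<bullet> ?c" for m
      using walk_flip_word_pow[of p "fst h" True m] pV assms(1) by simp
    have cancel: "q \<bullet> ?c = q' \<bullet> ?c \<longleftrightarrow> q = q'" if "q \<in> V" "q' \<in> V" for q q'
    proof
      assume "q \<bullet> ?c = q' \<bullet> ?c"
      then have "q \<bullet> ?c \<bullet> [letter_inv (fst h, True)] = q' \<bullet> ?c \<bullet> [letter_inv (fst h, True)]" by simp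
      then show "q = q'" unfolding walk_letter_inv[OF that(1)] walk_letter_inv[OF that(2)] .
    qed simp
    have "q \<in> border h False \<longleftrightarrow> q \<in> V \<and> (\<exists>m. q \<bullet> ?c = p \<bullet> word_pow (side_word (fst h) False) m \<bullet> ?c)"
      unfolding border_left mem_Collect_eq R[OF pb] flip ..
    also have "\<dots> \<longleftrightarrow> (\<exists>m. q = p \<bullet> word_pow (side_word (fst h) False) m)"
      using cancel walk_closed[OF pV] by blast
    finally show ?thesis using False by (simp only: simp_thms)
  qed
qed

section \<open>Signed crossings and half-spaces\<close>

lemma crossings_append: "crossings h p (v @ w) = crossings h p v + crossings h (p \<bullet> v) w"
  by (induction v arbitrary: p) (simp_all add: walk_Cons[of _ _ "_ # _"] flip: walk_append)

lemma crossings_sum: "crossings h p w = (\<Sum>k<length w.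
    if wall_of (p \<bullet> take k w) (w ! k) = h then if snd (w ! k) then 1 else - 1 else 0)"
proof (induction w rule: rev_induct)
  case (snoc x w)
  let ?f = "\<lambda>w k. if wall_of (p \<bullet> take k w) (w ! k) = h then if snd (w ! k) then 1 else - 1 else (0::int)"
  have "(\<Sum>k<length w. ?f (w @ [x]) k) = (\<Sum>k<length w. ?f w k)"
    by (rule sum.cong) (simp_all add: nth_append)
  then show ?case using snoc by (simp add: crossings_append)
qed simp

text \<open>The letters at positions \<open>k\<close> and \<open>2 * g + k\<close> of the relator
  label opposite edges of a cell, so they cross the same wall with opposite signs.\<close>

lemma crossings_relator:
  assumes p: "p \<in> V"
  shows "crossings h p relr = 0"
proof -
  let ?n = "2 * g"
  define f where "f k = (if wall_of (p \<bullet> take k relr) (relr ! k) = h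
    then if snd (relr ! k) then 1 else - 1 else (0::int))" for k
  have len: "length relr = ?n + ?n" by (simp add: surface_relator_def)
  have opp: "f (?n + k) = - f k" if k: "k < ?n" for k
  proof -
    have nth: "relr ! k = (Suc k, True)" "relr ! (?n + k) = (Suc k, False)"
      using k by (simp_all add: surface_relator_def nth_append del: upt_Suc)
    define A where "A = map (\<lambda>j. (j, True)) [1..<Suc k]"
    define B where "B = map (\<lambda>j. (j, False)) [Suc (Suc k)..<?n + 1]"
    define C where "C = A @ [(Suc k, True)] @ right_word (Suc k)"
    have "relr = A @ [(Suc k, True)] @ right_word (Suc k) @ [(Suc k, False)] @ B"
      unfolding A_def B_def using k by (intro relator_split) (simp add: X_def)
    then have r: "relr = C @ [(Suc k, False)] @ B" "relr = A @ drop k relr"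
      unfolding C_def A_def by simp_all
    have "length A = k" and C: "?n + k = length C"
      using k by (simp_all add: A_def C_def right_word_def del: upt_Suc)
    have "take (?n + k) relr = C" unfolding C r(1) by simp
    moreover have "take k relr = A" using \<open>length A = k\<close> r(2) by (metis append_eq_conv_conj)
    ultimately have "take (?n + k) relr = take k relr @ [(Suc k, True)] @ side_word (Suc k) True"
      by (simp add: C_def side_word_def)
    then have "p \<bullet> take (?n + k) relr
        = p \<bullet> take k relr \<bullet> [(Suc k, True)] \<bullet> word_pow (side_word (Suc k) True) 1"
      by (simp add: walk_append walk_Cons[of _ _ "side_word _ _"])
    \<comment> \<open>The heads of the two opposite edges differ by exactly one factor
      \<open>side_elt\<close>, so they lie in the same coset.\<close>
    then have "p \<bullet> take (?n + k) relr = (p \<bullet> take k relr \<bullet> [(Suc k, True)]) \<otimes>\<^bsub>G\<^esub> side_elt (Suc k) [^]\<^bsub>G\<^esub> (1::int)"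
      using p by (simp only: walk_word_pow walk_closed)
    then have "coset (Suc k) (p \<bullet> take (?n + k) relr) = coset (Suc k) (p \<bullet> take k relr \<bullet> [(Suc k, True)])"
      using p by (subst coset_eq) (auto simp del: int_pow_1)
    then show ?thesis by (simp add: f_def nth wall_of_def)
  qed
  have "crossings h p relr = (\<Sum>k<?n + ?n. f k)" by (simp add: crossings_sum f_def len)
  also have "\<dots> = (\<Sum>k<?n. f k) + (\<Sum>k<?n. f (?n + k))"
    using sum.nat_group[of f ?n 2] sum.atLeastLessThan_concat[of 0 ?n "?n + ?n" f] sum.shift_bounds_nat_ivl[of f 0 ?n ?n]
    by (simp add: atLeast0LessThan add.commute)
  also have "\<dots> = 0" by (simp add: opp sum_negf)
  finally show ?thesis .
qed

text \<open>Both moves keep the crossing number: an inverse pair crosses one wall forth and back,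
  and a relator contributes zero.\<close>

lemma crossings_eqv: "eqv v w \<Longrightarrow> p \<in> V \<Longrightarrow> crossings h p v = crossings h p w"
proof (induction arbitrary: p rule: pres_eq.induct)
  case (cancel v w a)
  let ?q = "p \<bullet> v"
  have 1: "?q \<bullet> [a] \<bullet> [letter_inv a] = ?q" using cancel by (simp add: walk_letter_inv)
  have "crossings h ?q [a, letter_inv a] = 0"
    using 1 by (auto simp: wall_of_def)
  moreover have "p \<bullet> (v @ [a, letter_inv a]) = ?q" using 1 by (simp add: walk_append walk_Cons[of _ a "[_]"])
  ultimately show ?case using crossings_append[of h p "v @ [a, letter_inv a]" w] crossings_append[of h p v]
    by simp
next
  case (relator v w r)
  then have "crossings h (p \<bullet> v) r = 0" "p \<bullet> (v @ r) = p \<bullet> v" by (simp_all add: crossings_relator walk_append walk_relator)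
  then show ?case using crossings_append[of h p "v @ r" w] crossings_append[of h p v] by simp
qed auto

lemma crossings_walk:
  "p \<in> V \<Longrightarrow> v \<in> words X \<Longrightarrow> w \<in> words X \<Longrightarrow> p \<bullet> v = p \<bullet> w \<Longrightarrow> crossings h p v = crossings h p w"
  by (simp add: walk_eq_iff crossings_eqv)

lemma crossings_other_types: "fst h \<notin> fst ` set w \<Longrightarrow> crossings h p w = 0"
proof (induction w arbitrary: p)
  case (Cons x w)
  then have "wall_of p x \<noteq> h" by (metis fst_wall_of imageI list.set_intros(1))
  with Cons show ?case by auto
qed simp

lemma set_word_pow: "set (word_pow w m) \<subseteq> (if 0 \<le> m then set w else letter_inv ` set w)"
  by (auto simp: word_pow_def)

lemma types_side_word: "i \<in> X \<Longrightarrow> fst ` set (side_word i e) = X - {i}"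
  unfolding set_side_word X_def image_Un fst_image_times by auto

lemma types_word_pow: "fst ` set (word_pow w m) \<subseteq> fst ` set w"
proof -
  have "fst ` letter_inv ` set w = fst ` set w" by (simp add: image_image)
  then show ?thesis
    using image_mono[OF set_word_pow[of w m], of fst] by (auto split: if_splits)
qed

text \<open>Two heads are joined along the border, whose letters avoid the type of \<open>h\<close>;
  by path independence every other path has crossing number zero too.\<close>

lemma right_border_level:
  assumes "h \<in> walls" "q \<in> border h True" "q \<bullet> w \<in> border h True" "w \<in> words X"
  shows "crossings h q w = 0"
proof -
  obtain m where m: "q \<bullet> w = q \<bullet> word_pow (side_word (fst h) True) m"
    using border_iff[OF assms(1,2)] assms(3) by auto
  have "crossings h q w = crossings h q (word_pow (side_word (fst h) True) m)"
    using m assms by (intro crossings_walk) (auto simp: border_closed)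
  also have "\<dots> = 0"
    using types_word_pow[of "side_word (fst h) True" m] types_side_word[of "fst h"] assms(1)
    by (intro crossings_other_types) auto
  finally show ?thesis .
qed

text \<open>A crossing of \<open>h\<close> starts or ends at a head, where the level is zero by
  \<open>right_border_level\<close>, so no third level can be reached.\<close>

lemma crossings_levels:
  assumes "h \<in> walls" "q \<in> border h True"
  shows "w \<in> words X \<Longrightarrow> crossings h q w \<in> {0, - 1}"
proof (induction w rule: rev_induct)
  case (snoc x w)
  let ?p = "q \<bullet> w"
  have w: "w \<in> words X" "fst x \<in> X" "?p \<in> V" using snoc assms by (auto simp: border_closed)
  consider "wall_of ?p x = h" "snd x" | "wall_of ?p x = h" "\<not> snd x" | "wall_of ?p x \<noteq> h" by blast
  then show ?case
  proof cases
    case 1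
    then have "q \<bullet> (w @ [x]) \<in> border h True"
      using w by (auto simp: border_right wall_of_def walk_append)
    then have "crossings h q (w @ [x]) = 0" using assms snoc by (intro right_border_level) auto
    then show ?thesis by simp
  next
    case 2
    then have "?p \<in> border h True" using w by (auto simp: border_right wall_of_def)
    then have "crossings h q w = 0" using assms w by (intro right_border_level) auto
    then show ?thesis using 2 by (simp add: crossings_append)
  next
    case 3
    then show ?thesis using snoc w by (simp add: crossings_append)
  qed
qed simp

lemma walk_in_halfspace:
  assumes "h \<in> walls" "q \<in> border h True" "w \<in> words X"
  shows "q \<bullet> w \<in> halfspace h \<longleftrightarrow> crossings h q w = 0"
proof
  assume "q \<bullet> w \<in> halfspace h"
  then obtain q' w' where w': "q' \<in> border h True" "w' \<in> words X" "q \<bullet> w = q' \<bullet> w'" "crossings h q' w' = 0"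
    by (auto simp: halfspace_def)
  obtain u where u: "u \<in> words X" "q' = q \<bullet> u" using walk_ex[of q q'] assms w' border_closed by blast
  have "crossings h q w = crossings h q (u @ w')"
    using assms w' u by (intro crossings_walk) (auto simp: border_closed walk_append)
  also have "\<dots> = 0" using right_border_level[of h q u] assms w' u by (simp add: crossings_append)
  finally show "crossings h q w = 0" .
qed (use assms border_closed in \<open>auto simp: halfspace_def\<close>)

text \<open>A letter changes the level exactly when its wall is \<open>k\<close>; as there are only
  two levels, a positive crossing must enter the half-space and a negative one leave it.\<close>

lemma halfspace_crossing:
  assumes "k \<in> walls" "p \<in> V" "fst x \<in> X"
  shows "(p \<bullet> [x] \<in> halfspace k \<longleftrightarrow> p \<in> halfspace k) \<longleftrightarrow> wall_of p x \<noteq> k"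
    and "wall_of p x = k \<Longrightarrow> p \<bullet> [x] \<in> halfspace k \<longleftrightarrow> snd x"
proof -
  obtain q where q: "q \<in> border k True" using border_nonempty[OF assms(1)] by blast
  obtain w where w: "w \<in> words X" "p = q \<bullet> w" using walk_ex[of q p] q assms border_closed by blast
  have wx: "w @ [x] \<in> words X" using w assms by (cases x) auto
  have "p \<in> halfspace k \<longleftrightarrow> crossings k q w = 0"
    using walk_in_halfspace[OF assms(1) q w(1)] w by simp
  moreover have "p \<bullet> [x] \<in> halfspace k \<longleftrightarrow> crossings k q (w @ [x]) = 0"
    using walk_in_halfspace[OF assms(1) q wx] w by (simp add: walk_append)
  moreover have "crossings k q w \<in> {0, - 1}" "crossings k q (w @ [x]) \<in> {0, - 1}"
    using crossings_levels[OF assms(1) q] w wx by auto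
  moreover have "crossings k q (w @ [x]) = crossings k q w
      + (if wall_of p x = k then if snd x then 1 else - 1 else 0)"
    using w by (simp add: crossings_append)
  ultimately show "(p \<bullet> [x] \<in> halfspace k \<longleftrightarrow> p \<in> halfspace k) \<longleftrightarrow> wall_of p x \<noteq> k"
    and "wall_of p x = k \<Longrightarrow> p \<bullet> [x] \<in> halfspace k \<longleftrightarrow> snd x"
    by (auto split: if_splits)
qed

section \<open>Geodesics and crossing walls\<close>

definition separators :: "nat word set \<Rightarrow> nat word set \<Rightarrow> (nat \<times> nat word set set) set" where
  "separators p q = {k \<in> walls. \<not> (p \<in> halfspace k \<longleftrightarrow> q \<in> halfspace k)}"

fun wall_list :: "nat word set \<Rightarrow> nat word \<Rightarrow> (nat \<times> nat word set set) list" where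
  "wall_list p [] = []"
| "wall_list p (x # w) = wall_of p x # wall_list (p \<bullet> [x]) w"

definition crosses :: "nat \<times> nat word set set \<Rightarrow> nat \<times> nat word set set \<Rightarrow> bool" where
  "crosses h k \<longleftrightarrow> (\<forall>a b. \<exists>p\<in>V. (p \<in> halfspace h \<longleftrightarrow> a) \<and> (p \<in> halfspace k \<longleftrightarrow> b))"

lemma crosses_sym: "crosses h k \<Longrightarrow> crosses k h"
  unfolding crosses_def by blast

lemma wall_list_append: "wall_list p (v @ w) = wall_list p v @ wall_list (p \<bullet> v) w"
  by (induction v arbitrary: p) (simp_all add: walk_Cons[of _ _ "_ # _"] flip: walk_append)

lemma length_wall_list [simp]: "length (wall_list p w) = length w"
  by (induction w arbitrary: p) simp_all

lemma types_wall_list: "map fst (wall_list p w) = map fst w"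
  by (induction w arbitrary: p) simp_all

lemma separators_self [simp]: "separators p p = {}"
  by (simp add: separators_def)

lemma separators_trans:
  "separators p q = separators p r - separators r q \<union> (separators r q - separators p r)"
  by (auto simp: separators_def)

lemma separators_step: "p \<in> V \<Longrightarrow> fst x \<in> X \<Longrightarrow> separators p (p \<bullet> [x]) = {wall_of p x}"
  using halfspace_crossing(1)[of _ p x] wall_of_walls[of p x] unfolding separators_def by blast

lemma separators_walk: "p \<in> V \<Longrightarrow> w \<in> words X \<Longrightarrow> separators p (p \<bullet> w) \<subseteq> set (wall_list p w)"
proof (induction w arbitrary: p)
  case (Cons x w)
  then have x: "fst x \<in> X" and w: "w \<in> words X" by (auto simp: words_iff)
  have "separators p (p \<bullet> (x # w)) \<subseteq> separators p (p \<bullet> [x]) \<union> separators (p \<bullet> [x]) (p \<bullet> [x] \<bullet> w)"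
    unfolding walk_Cons[of p x w] using separators_trans by blast
  also have "\<dots> \<subseteq> set (wall_list p (x # w))"
    using Cons.IH[OF _ w, of "p \<bullet> [x]"] Cons.prems x by (auto simp: separators_step)
  finally show ?case .
qed simp

lemma separators_walk_distinct:
  "p \<in> V \<Longrightarrow> w \<in> words X \<Longrightarrow> distinct (wall_list p w) \<Longrightarrow> separators p (p \<bullet> w) = set (wall_list p w)"
proof (induction w arbitrary: p)
  case (Cons x w)
  then have x: "fst x \<in> X" and w: "w \<in> words X" by (auto simp: words_iff)
  show ?case
    using Cons.IH[OF _ w, of "p \<bullet> [x]"] Cons.prems x
      separators_trans[of p "p \<bullet> (x # w)" "p \<bullet> [x]"]
    unfolding walk_Cons[of p x w] by (auto simp: separators_step)
qed simp

lemma finite_separators: "p \<in> V \<Longrightarrow> q \<in> V \<Longrightarrow> finite (separators p q)"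
  by (metis walk_ex separators_walk finite_subset List.finite_set)

lemma same_side: "p \<in> V \<Longrightarrow> w \<in> words X \<Longrightarrow> k \<in> walls \<Longrightarrow> k \<notin> set (wall_list p w) \<Longrightarrow>
    p \<bullet> w \<in> halfspace k \<longleftrightarrow> p \<in> halfspace k"
  using separators_walk[of p w] by (auto simp: separators_def)

lemma card_separators_le: "p \<in> V \<Longrightarrow> w \<in> words X \<Longrightarrow> card (separators p (p \<bullet> w)) \<le> length w"
  using card_mono[OF _ separators_walk] card_length[of "wall_list p w"] by fastforce

lemma card_separators_distinct:
  "p \<in> V \<Longrightarrow> w \<in> words X \<Longrightarrow> distinct (wall_list p w) \<Longrightarrow> card (separators p (p \<bullet> w)) = length w"
  by (simp add: separators_walk_distinct distinct_card)

lemma border_side: "h \<in> walls \<Longrightarrow> p \<in> border h e \<Longrightarrow> p \<in> halfspace h \<longleftrightarrow> e"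
  using halfspace_crossing[of h p "(fst h, \<not> e)"] by (auto simp: border_def)

lemma wall_of_border:
  assumes "p \<in> V" "wall_of p x = h"
  shows "p \<in> border h (\<not> snd x)" "p \<bullet> [x] \<in> border h (snd x)"
proof -
  have "fst h = fst x" using assms(2) by auto
  then show "p \<in> border h (\<not> snd x)" using assms by (simp add: border_def)
  from border_flip[OF this] show "p \<bullet> [x] \<in> border h (snd x)" using \<open>fst h = fst x\<close> by simp
qed

text \<open>The first crossing of \<open>k\<close> has to leave the side of \<open>p\<close>, and
  only one sign of the letter of type \<open>fst k\<close> does so.\<close>

lemma not_crossing:
  "p \<in> V \<Longrightarrow> w \<in> words X \<Longrightarrow> k \<in> walls \<Longrightarrow> (fst k, p \<notin> halfspace k) \<notin> set w \<Longrightarrow> k \<notin> set (wall_list p w)"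
proof (induction w arbitrary: p)
  case (Cons x w)
  then have x: "fst x \<in> X" and w: "w \<in> words X" by (auto simp: words_iff)
  have "wall_of p x \<noteq> k"
  proof
    assume k: "wall_of p x = k"
    then have "p \<in> halfspace k \<longleftrightarrow> \<not> snd x"
      using wall_of_border(1)[OF _ k] border_side[of k p] Cons.prems by blast
    moreover have "fst k = fst x" using k by auto
    ultimately have "(fst k, p \<notin> halfspace k) = x" by (cases x) simp
    with Cons.prems show False by simp
  qed
  moreover from this have "p \<bullet> [x] \<in> halfspace k \<longleftrightarrow> p \<in> halfspace k"
    using halfspace_crossing(1)[of k p x] Cons.prems x by blast
  ultimately show ?case using Cons.IH[OF _ w, of "p \<bullet> [x]"] Cons.prems by auto
qed simp

text \<open>After a letter has crossed a wall, only the inverse letter can cross that wall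
  next.\<close>

lemma distinct_wall_list:
  "p \<in> V \<Longrightarrow> w \<in> words X \<Longrightarrow> \<forall>x\<in>set w. letter_inv x \<notin> set w \<Longrightarrow> distinct (wall_list p w)"
proof (induction w arbitrary: p)
  case (Cons x w)
  then have x: "fst x \<in> X" and w: "w \<in> words X" by (auto simp: words_iff)
  have "p \<bullet> [x] \<in> halfspace (wall_of p x) \<longleftrightarrow> snd x"
    using halfspace_crossing(2)[of "wall_of p x" p x] Cons.prems x by simp
  then have "wall_of p x \<notin> set (wall_list (p \<bullet> [x]) w)"
    using Cons.prems x w by (intro not_crossing) (auto simp: letter_inv_def)
  then show ?case using Cons by auto
qed simp

text \<open>Each type occurs along a border with one sign only, so no wall is met twice and borders
  are geodesic lines.\<close>

lemma distinct_side_pow: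
  assumes "p \<in> V" "i \<in> X"
  shows "distinct (wall_list p (word_pow (side_word i e) m))"
proof (rule distinct_wall_list)
  show "\<forall>x\<in>set (word_pow (side_word i e) m). letter_inv x \<notin> set (word_pow (side_word i e) m)"
  proof -
    have S: "letter_inv x \<notin> set (side_word i e)" if "x \<in> set (side_word i e)" for x
      using that unfolding set_side_word by (auto simp: letter_inv_def)
    then have "letter_inv x \<notin> letter_inv ` set (side_word i e)" if "x \<in> letter_inv ` set (side_word i e)" for x
      using that by (metis imageE letter_inv_letter_inv)
    moreover have "set (word_pow (side_word i e) m) \<subseteq> set (side_word i e)
        \<or> set (word_pow (side_word i e) m) \<subseteq> letter_inv ` set (side_word i e)"
      using set_word_pow[of "side_word i e" m] by (cases "0 \<le> m") simp_all
    ultimately show ?thesis using S by blast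
  qed
qed (use assms in auto)

lemma length_side_word: "i \<in> X \<Longrightarrow> length (side_word i e) = 2 * g - 1"
  by (auto simp: side_word_def right_word_def X_def simp del: upt_Suc)

lemma border_card_separators:
  assumes "h \<in> walls" "p \<in> border h e" "q = p \<bullet> word_pow (side_word (fst h) e) m"
  shows "card (separators p q) = nat \<bar>m\<bar> * (2 * g - 1)"
  using assms border_closed distinct_side_pow[of p "fst h" e m]
  by (simp add: card_separators_distinct length_word_pow length_side_word)

lemma wall_list_eq_append:
  assumes "wall_list p w = as @ bs"
  obtains w1 w2 where "w = w1 @ w2" "as = wall_list p w1" "bs = wall_list (p \<bullet> w1) w2"
proof
  let ?w1 = "take (length as) w" and ?w2 = "drop (length as) w"
  show "w = ?w1 @ ?w2" by simp
  have "length as \<le> length w" using arg_cong[OF assms, of length] by simp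
  then have "as @ bs = wall_list p ?w1 @ wall_list (p \<bullet> ?w1) ?w2" "length as = length (wall_list p ?w1)"
    using assms wall_list_append[of p ?w1 ?w2] by simp_all
  then show "as = wall_list p ?w1" "bs = wall_list (p \<bullet> ?w1) ?w2" by simp_all
qed

lemma wall_list_eq_Cons:
  assumes "wall_list p w = h # bs"
  obtains x w2 where "w = x # w2" "h = wall_of p x" "bs = wall_list (p \<bullet> [x]) w2"
  using assms by (cases w) auto

text \<open>A word that crosses a wall twice contains a pinch \<open>x z x\<^sup>-\<^sup>1\<close> with \<open>z\<close> running along
  one side of the wall; pushing \<open>z\<close> to the other side saves two letters.\<close>

lemma shortest_distinct:
  assumes p: "p \<in> V" and w: "w \<in> words X"
    and least: "\<And>w'. w' \<in> words X \<Longrightarrow> p \<bullet> w' = p \<bullet> w \<Longrightarrow> length w \<le> length w'"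
  shows "distinct (wall_list p w)"
proof (rule ccontr)
  assume "\<not> distinct (wall_list p w)"
  then obtain xs ys zs h where "wall_list p w = xs @ [h] @ ys @ [h] @ zs"
    using not_distinct_decomp by blast
  then obtain ys zs where "wall_list p w = xs @ h # ys @ h # zs" "h \<notin> set ys"
    using split_list_first[of h "ys @ [h] @ zs"] by auto
  from this(1) obtain w1 x z y w2 where
    w_eq: "w = w1 @ x # z @ y # w2" and h: "h = wall_of (p \<bullet> w1) x"
    and ys: "ys = wall_list (p \<bullet> w1 \<bullet> [x]) z" and h': "h = wall_of (p \<bullet> w1 \<bullet> [x] \<bullet> z) y"
    by (metis wall_list_eq_append wall_list_eq_Cons)
  define q where "q = p \<bullet> w1"
  define e where "e = snd x"
  have V: "q \<in> V" using p by (simp add: q_def)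
  have letters: "fst x \<in> X" "fst y \<in> X" "z \<in> words X" "w1 \<in> words X" "w2 \<in> words X"
    using w by (auto simp: w_eq words_iff)
  have hw: "h \<in> walls" using letters p by (simp add: h)
  have x: "x = (fst h, e)" using h by (cases x) (simp add: e_def)
  have b1: "q \<bullet> [x] \<in> border h e"
    using wall_of_border(2)[OF V h[folded q_def, symmetric]] by (simp add: e_def)
  have b2: "q \<bullet> [x] \<bullet> z \<in> border h (\<not> snd y)"
    using wall_of_border(1)[OF _ h'[folded q_def, symmetric]] V by simp
  have "q \<bullet> [x] \<bullet> z \<in> halfspace h \<longleftrightarrow> q \<bullet> [x] \<in> halfspace h"
    using \<open>h \<notin> set ys\<close> letters V hw by (intro same_side) (auto simp: ys q_def)
  then have e: "e \<longleftrightarrow> \<not> snd y" using border_side[OF hw b1] border_side[OF hw b2] by simp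
  then have y: "y = letter_inv x"
    using arg_cong[OF h', of fst] unfolding x by (simp add: letter_inv_def prod_eq_iff)
  obtain m where m: "q \<bullet> [x] \<bullet> z = q \<bullet> [x] \<bullet> word_pow (side_word (fst h) e) m"
    using border_iff[OF hw b1] b2 e by auto
  \<comment> \<open>The border path is geodesic, so it is no longer than \<open>z\<close>; its
    parallel copy on the other side does without the letters \<open>x\<close> and
    \<open>y\<close>.\<close>
  have len: "nat \<bar>m\<bar> * (2 * g - 1) \<le> length z"
    using border_card_separators[OF hw b1 m] card_separators_le[of "q \<bullet> [x]" z] V letters by simp
  let ?w = "w1 @ word_pow (side_word (fst h) (\<not> e)) m @ w2"
  have "q \<bullet> [x] \<bullet> z \<bullet> [y] = q \<bullet> word_pow (side_word (fst h) (\<not> e)) m \<bullet> [x] \<bullet> [letter_inv x]"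
    using walk_flip_word_pow[OF V fst_wall[OF hw], of e m] unfolding m y by (simp add: x)
  also have "\<dots> = q \<bullet> word_pow (side_word (fst h) (\<not> e)) m"
    using V by (simp add: walk_letter_inv)
  finally have "p \<bullet> ?w = p \<bullet> w"
    by (simp add: w_eq walk_append walk_Cons[of _ _ "_ @ _"] walk_Cons[of _ y w2] q_def)
  moreover have "?w \<in> words X" using letters hw by simp
  ultimately have "length w \<le> length ?w" by (intro least)
  then show False using len hw by (simp add: w_eq length_word_pow length_side_word)
qed

lemma geodesic_ex:
  assumes "p \<in> V" "q \<in> V"
  obtains w where "w \<in> words X" "q = p \<bullet> w" "distinct (wall_list p w)"
proof -
  have "\<exists>n. \<exists>w\<in>words X. q = p \<bullet> w \<and> length w = n" using walk_ex[OF assms] by blast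
  from LeastI_ex[OF this] obtain w where w: "w \<in> words X" "q = p \<bullet> w"
    "length w = (LEAST n. \<exists>w\<in>words X. q = p \<bullet> w \<and> length w = n)" by blast
  have "distinct (wall_list p w)"
    using assms w by (intro shortest_distinct) (auto intro!: Least_le)
  with w that show ?thesis by blast
qed

text \<open>Follow a geodesic from \<open>p\<close> until it reaches \<open>h\<close>; the walls
  crossed on the way are among those separating \<open>p\<close> and \<open>q\<close>.\<close>

lemma separator_border:
  assumes "p \<in> V" "q \<in> V" "h \<in> separators p q"
  obtains s e where "s \<in> border h e" "separators p s \<subseteq> separators p q"
proof -
  obtain w where w: "w \<in> words X" "q = p \<bullet> w" "distinct (wall_list p w)" using geodesic_ex assms by blast
  have sep: "separators p q = set (wall_list p w)"
    using w assms by (simp add: separators_walk_distinct)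
  then obtain as bs where "wall_list p w = as @ h # bs" using assms split_list by metis
  then obtain w1 x w2 where w1: "w = w1 @ x # w2" "h = wall_of (p \<bullet> w1) x"
    by (metis wall_list_eq_append wall_list_eq_Cons)
  have "p \<bullet> w1 \<in> border h (\<not> snd x)" using wall_of_border(1) w1(2) assms(1) by simp
  moreover have "separators p (p \<bullet> w1) \<subseteq> separators p q"
    using separators_walk[of p w1] assms w unfolding sep by (auto simp: w1(1) wall_list_append)
  ultimately show ?thesis using that by blast
qed

section \<open>Crossing walls seen along a border\<close>

lemma border_flip_side:
  assumes "h \<in> walls" "k \<in> walls" "h \<noteq> k" "p \<in> border h e"
  shows "p \<bullet> [(fst h, \<not> e)] \<in> halfspace k \<longleftrightarrow> p \<in> halfspace k"
  using halfspace_crossing(1)[of k p "(fst h, \<not> e)"] assms by (auto simp: border_def)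

text \<open>If one border of \<open>h\<close> lay on a single side of \<open>k\<close>, so would the
  other border, since edges of \<open>h\<close> do not cross \<open>k\<close>. But a geodesic
  joining the two sides of \<open>h\<close> within the opposite side of \<open>k\<close> has to meet
  a border of \<open>h\<close>.\<close>

lemma crosses_border:
  assumes h: "h \<in> walls" and k: "k \<in> walls" and cr: "crosses h k"
  obtains p q where "p \<in> border h e" "q \<in> border h e" "p \<in> halfspace k" "q \<notin> halfspace k"
proof -
  have ne: "h \<noteq> k" using cr[unfolded crosses_def, rule_format, of True False] by auto
  have "\<exists>p\<in>border h e. p \<in> halfspace k \<longleftrightarrow> c" for c
  proof (rule ccontr)
    assume "\<not> ?thesis"
    then have 1: "\<And>p. p \<in> border h e \<Longrightarrow> \<not> (p \<in> halfspace k \<longleftrightarrow> c)" by blast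
    have 2: "\<not> (p \<in> halfspace k \<longleftrightarrow> c)" if "p \<in> border h e'" for p e'
    proof (cases "e' = e")
      case False
      then have "p \<bullet> [(fst h, e)] \<in> border h e" using that border_flip by (cases e; cases e'; simp)
      moreover have "p \<bullet> [(fst h, e)] \<in> halfspace k \<longleftrightarrow> p \<in> halfspace k"
        using border_flip_side[OF h k ne that] False by (cases e; cases e'; simp)
      ultimately show ?thesis using 1 by blast
    qed (use that 1 in blast)
    obtain s s' where s: "s \<in> V" "s' \<in> V" "s \<in> halfspace h" "s' \<notin> halfspace h"
      "s \<in> halfspace k \<longleftrightarrow> c" "s' \<in> halfspace k \<longleftrightarrow> c"
      using cr[unfolded crosses_def, rule_format, of True c] cr[unfolded crosses_def, rule_format, of False c] by auto
    then have "h \<in> separators s s'" using h by (simp add: separators_def)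
    then obtain t e' where "t \<in> border h e'" "separators s t \<subseteq> separators s s'"
      using separator_border s by metis
    moreover have "k \<notin> separators s s'" using s by (simp add: separators_def)
    ultimately show False using 2[of t e'] s k by (auto simp: separators_def)
  qed
  from this[of True] this[of False] that show ?thesis by blast
qed

text \<open>A border of \<open>h\<close> contains no letter of type \<open>fst h\<close>, so no wall
  of that type separates two of its vertices.\<close>

lemma crosses_types:
  assumes h: "h \<in> walls" and k: "k \<in> walls" and cr: "crosses h k"
  shows "fst h \<noteq> fst k"
proof
  assume eq: "fst h = fst k"
  obtain p q where pq: "p \<in> border h True" "q \<in> border h True" "p \<in> halfspace k" "q \<notin> halfspace k"
    using crosses_border[OF assms] by blast
  then obtain m where m: "q = p \<bullet> word_pow (side_word (fst h) True) m" using border_iff[OF h] by blast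
  have "k \<notin> set (wall_list p (word_pow (side_word (fst h) True) m))"
  proof
    assume "k \<in> set (wall_list p (word_pow (side_word (fst h) True) m))"
    then have "fst k \<in> set (map fst (wall_list p (word_pow (side_word (fst h) True) m)))" by auto
    then have "fst k \<in> fst ` set (word_pow (side_word (fst h) True) m)" by (simp add: types_wall_list)
    then have "fst k \<in> X - {fst h}"
      using types_word_pow[of "side_word (fst h) True" m] types_side_word[of "fst h" True] h by auto
    with eq show False by simp
  qed
  then have "q \<in> halfspace k \<longleftrightarrow> p \<in> halfspace k"
    unfolding m using pq border_closed h k by (intro same_side) auto
  with pq show False by simp
qed

end

section \<open>Quadrilaterals of walls\<close>

definition cyclic_types :: "nat \<Rightarrow> nat \<Rightarrow> nat list" where
  "cyclic_types n i = [Suc i..<Suc n] @ [1..<i]"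

lemma append_Cons_cancel:
  assumes "as @ x # bs = cs @ x # ds" "x \<notin> set as" "x \<notin> set cs"
  shows "as = cs \<and> bs = ds"
  using assms by (induction as arbitrary: cs) (auto simp: Cons_eq_append_conv append_eq_Cons_conv)

lemma upt_split: "a \<le> k \<Longrightarrow> k < b \<Longrightarrow> [a..<b] = [a..<k] @ k # [Suc k..<b]"
  using upt_add_eq_append[of a k "b - k"] by (simp add: upt_conv_Cons del: upt_Suc)

lemma distinct_cyclic_types: "distinct (cyclic_types n i)"
  by (auto simp: cyclic_types_def simp del: upt_Suc)

text \<open>Both lists are the cyclic order of \<open>1, ..., n\<close>, cut open at
  \<open>i\<close> and at \<open>j\<close>.\<close>

lemma cyclic_types_swap:
  assumes "i \<in> {1..n}" "j \<in> {1..n}" "i \<noteq> j" "cyclic_types n i = as @ j # bs"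
  shows "cyclic_types n j = bs @ i # as"
proof -
  have d: "distinct (as @ j # bs)" using distinct_cyclic_types[of n i] assms(4) by simp
  show ?thesis
  proof (cases "i < j")
    case True
    have "[Suc i..<Suc n] = [Suc i..<j] @ j # [Suc j..<Suc n]" "[1..<j] = [1..<i] @ i # [Suc i..<j]"
      using True assms(1,2) by (intro upt_split; simp)+
    moreover from this assms(4) have "[Suc i..<j] @ j # [Suc j..<Suc n] @ [1..<i] = as @ j # bs"
      by (simp add: cyclic_types_def del: upt_Suc)
    then have "[Suc i..<j] = as \<and> [Suc j..<Suc n] @ [1..<i] = bs"
      using d by (intro append_Cons_cancel) auto
    ultimately show ?thesis by (auto simp: cyclic_types_def simp del: upt_Suc)
  next
    case False
    have "[Suc j..<Suc n] = [Suc j..<i] @ i # [Suc i..<Suc n]" "[1..<i] = [1..<j] @ j # [Suc j..<i]"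
      using False assms(1-3) by (intro upt_split; simp)+
    moreover from this assms(4) have "([Suc i..<Suc n] @ [1..<j]) @ j # [Suc j..<i] = as @ j # bs"
      by (simp add: cyclic_types_def del: upt_Suc)
    then have "[Suc i..<Suc n] @ [1..<j] = as \<and> [Suc j..<i] = bs"
      using d False assms(3) by (intro append_Cons_cancel) auto
    ultimately show ?thesis by (auto simp: cyclic_types_def simp del: upt_Suc)
  qed
qed

text \<open>Seen from \<open>j\<close>, the cyclic order reads \<open>bs, i, as\<close> or the
  reverse of this; the equation between sets decides which.\<close>

lemma cyclic_types_match:
  assumes "i \<in> {1..n}" "j \<in> {1..n}" "i \<noteq> j" "3 \<le> n"
    and S: "as @ j # bs \<in> {cyclic_types n i, rev (cyclic_types n i)}"
    and T: "cs @ i # ds \<in> {cyclic_types n j, rev (cyclic_types n j)}"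
    and eq: "set as = set ds"
  shows "cs = bs \<and> ds = as"
proof -
  have "bs @ i # as \<in> {cyclic_types n j, rev (cyclic_types n j)}"
  proof (cases "as @ j # bs = cyclic_types n i")
    case True
    have "cyclic_types n j = bs @ i # as" by (rule cyclic_types_swap[OF assms(1-3) True[symmetric]])
    then show ?thesis by simp
  next
    case False
    then have "rev (as @ j # bs) = cyclic_types n i" using S by auto
    then have "cyclic_types n i = rev bs @ j # rev as" by simp
    then have "cyclic_types n j = rev as @ i # rev bs" by (rule cyclic_types_swap[OF assms(1-3)])
    then have "rev (cyclic_types n j) = bs @ i # as" by simp
    then show ?thesis by simp
  qed
  then have "cs @ i # ds = bs @ i # as \<or> cs @ i # ds = rev (bs @ i # as)"
    using T by (metis insertE rev_rev_ident singletonD)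
  then have "cs @ i # ds = bs @ i # as \<or> cs @ i # ds = rev as @ i # rev bs" by simp
  moreover have d: "distinct (as @ j # bs)" "distinct (cs @ i # ds)" "length (as @ j # bs) = n - 1"
  proof -
    show "distinct (as @ j # bs)" "distinct (cs @ i # ds)"
      using S T distinct_cyclic_types[of n i] distinct_cyclic_types[of n j]
      by (metis distinct_rev insertE singletonD)+
    have "length (as @ j # bs) = length (cyclic_types n i)"
      using S by (metis length_rev insertE singletonD)
    then show "length (as @ j # bs) = n - 1"
      using assms(1) by (simp add: cyclic_types_def del: upt_Suc)
  qed
  moreover have "distinct (bs @ i # as)"
    using \<open>bs @ i # as \<in> _\<close> distinct_cyclic_types[of n j] by (metis distinct_rev insertE singletonD)
  ultimately consider "cs = bs \<and> ds = as" | "ds = rev bs"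
    using append_Cons_cancel[of cs i ds bs as] append_Cons_cancel[of cs i ds "rev as" "rev bs"] by auto
  then show ?thesis
  proof cases
    \<comment> \<open>In the reversed reading the disjoint lists \<open>as\<close> and
      \<open>bs\<close> would have equal sets, hence both be empty, against
      \<open>3 \<le> n\<close>.\<close>
    case 2
    then have "set as = set bs" using eq by simp
    then have "as = []" "bs = []" using d(1) by auto
    then show ?thesis using d(3) assms(4) by simp
  qed
qed

context surface
begin

section \<open>Oriented walls and translations along borders\<close>

definition ins :: "(nat \<times> nat word set set) \<times> bool \<Rightarrow> nat word set \<Rightarrow> bool" where
  "ins U p \<longleftrightarrow> (p \<in> halfspace (fst U) \<longleftrightarrow> snd U)"

text \<open>The two one-step translation words of a border; admitting both lets a proof choose the
  direction in which to run along it.\<close>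

definition period :: "nat \<Rightarrow> bool \<Rightarrow> nat word \<Rightarrow> bool" where
  "period i e S \<longleftrightarrow> i \<in> X \<and> S \<in> {side_word i e, word_inv (side_word i e)}"

lemma types_period:
  assumes "period i e S"
  shows "map fst S \<in> {cyclic_types (2 * g) i, rev (cyclic_types (2 * g) i)}"
proof -
  have "map fst (word_inv w) = rev (map fst w)" for w :: "nat word"
    by (induction w) (simp_all add: word_inv_def)
  moreover have "map fst (side_word i e) \<in> {cyclic_types (2 * g) i, rev (cyclic_types (2 * g) i)}"
    by (auto simp: side_word_def right_word_def cyclic_types_def rev_map o_def simp del: upt_Suc)
  ultimately show ?thesis using assms by (auto simp: period_def)
qed

lemma period_words [simp]: "period i e S \<Longrightarrow> S \<in> words X"
  by (auto simp: period_def)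

lemma period_types_set: "period i e S \<Longrightarrow> fst ` set S = X - {i}"
proof -
  assume S: "period i e S"
  then have i: "i \<in> X" and "S = side_word i e \<or> S = word_inv (side_word i e)"
    by (simp_all add: period_def)
  then have "fst ` set S = fst ` set (side_word i e)"
    by (elim disjE) (simp_all add: image_image)
  then show ?thesis using types_side_word[OF i] by simp
qed

lemma period_types_distinct: "period i e S \<Longrightarrow> distinct (map fst S)"
  using types_period[of i e S] distinct_cyclic_types[of "2 * g" i]
  by (metis distinct_rev insertE singletonD)

lemma period_word_inv: "period i e S \<Longrightarrow> period i e (word_inv S)"
  by (auto simp: period_def)

lemma distinct_types_unique:
  "distinct (map fst S) \<Longrightarrow> x \<in> set S \<Longrightarrow> y \<in> set S \<Longrightarrow> fst x = fst y \<Longrightarrow> x = y"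
  by (auto simp: distinct_map dest: inj_onD)

lemma walk_word_pow_inv: "p \<in> V \<Longrightarrow> p \<bullet> word_pow (word_inv w) m = p \<bullet> word_pow w (- m)"
  by (cases "m = 0") (simp_all add: word_pow_def)

lemma word_pow_minus_one: "word_pow w (- 1) = word_inv w"
  by (simp add: word_pow_def)

lemma border_period:
  assumes "h \<in> walls" "p \<in> border h e" "period (fst h) e S"
  shows "q \<in> border h e \<longleftrightarrow> (\<exists>m. q = p \<bullet> word_pow S m)"
proof -
  have "S = side_word (fst h) e \<or> S = word_inv (side_word (fst h) e)"
    using assms(3) by (simp add: period_def)
  then show ?thesis
  proof
    assume S: "S = word_inv (side_word (fst h) e)"
    have "p \<bullet> word_pow S m = p \<bullet> word_pow (side_word (fst h) e) (- m)" for m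
      unfolding S by (rule walk_word_pow_inv[OF border_closed[OF assms(2)]])
    moreover from this[of "- _"]
    have "p \<bullet> word_pow (side_word (fst h) e) m = p \<bullet> word_pow S (- m)" for m by simp
    ultimately have "(\<exists>m. q = p \<bullet> word_pow S m) \<longleftrightarrow> (\<exists>m. q = p \<bullet> word_pow (side_word (fst h) e) m)"
      by blast
    then show ?thesis using border_iff[OF assms(1,2)] by simp
  qed (use border_iff[OF assms(1,2)] in simp)
qed

lemma distinct_types_distinct: "distinct (map fst w) \<Longrightarrow> distinct (wall_list p w)"
  using distinct_map[of fst "wall_list p w"] unfolding types_wall_list by blast

text \<open>With distinct types no wall is met twice, so the separating walls correspond to the
  letters.\<close>

lemma separators_types:
  assumes "p \<in> V" "w \<in> words X" "distinct (map fst w)"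
  shows "fst ` separators p (p \<bullet> w) = fst ` set w"
    and "inj_on fst (separators p (p \<bullet> w))"
proof -
  have "separators p (p \<bullet> w) = set (wall_list p w)"
    using assms by (simp add: separators_walk_distinct distinct_types_distinct)
  moreover have "fst ` set (wall_list p w) = fst ` set w"
    unfolding list.set_map[symmetric] types_wall_list ..
  moreover have "inj_on fst (set (wall_list p w))"
    using distinct_map[of fst "wall_list p w"] assms(3) unfolding types_wall_list by blast
  ultimately show "fst ` separators p (p \<bullet> w) = fst ` set w"
    and "inj_on fst (separators p (p \<bullet> w))" by simp_all
qed

lemma separators_letter:
  assumes "p \<in> V" "as @ x # bs \<in> words X" "distinct (map fst (as @ x # bs))"
    and "k \<in> separators p (p \<bullet> (as @ x # bs))" "fst k = fst x"
  shows "wall_of (p \<bullet> as) x = k"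
proof -
  have sep: "separators p (p \<bullet> (as @ x # bs)) = set (wall_list p (as @ x # bs))"
    using assms by (intro separators_walk_distinct distinct_types_distinct) auto
  then have "wall_of (p \<bullet> as) x \<in> separators p (p \<bullet> (as @ x # bs))"
    by (simp add: wall_list_append)
  with assms(4,5) show ?thesis
    by (intro inj_onD[OF separators_types(2)[OF assms(1-3)]]) auto
qed

lemma same_side_types:
  "p \<in> V \<Longrightarrow> w \<in> words X \<Longrightarrow> k \<in> walls \<Longrightarrow> fst k \<notin> fst ` set w \<Longrightarrow>
    p \<bullet> w \<in> halfspace k \<longleftrightarrow> p \<in> halfspace k"
proof (intro same_side)
  assume "fst k \<notin> fst ` set w"
  then have "fst k \<notin> fst ` set (wall_list p w)"
    unfolding list.set_map[symmetric] types_wall_list .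
  then show "k \<notin> set (wall_list p w)" by blast
qed

text \<open>Converse of \<open>crosses_border\<close>: the border supplies the two quadrants on its
  own side, and stepping over \<open>h\<close>, which does not cross \<open>k\<close>, supplies the
  other two.\<close>

lemma crosses_if_border:
  assumes h: "h \<in> walls" and k: "k \<in> walls" and ne: "h \<noteq> k"
    and p: "p \<in> border h e" and q: "q \<in> border h e" and sep: "k \<in> separators p q"
  shows "crosses h k"
proof -
  have "\<exists>s\<in>V. (s \<in> halfspace h \<longleftrightarrow> a) \<and> (s \<in> halfspace k \<longleftrightarrow> b)" for a b
  proof -
    obtain t where t: "t \<in> border h e" "t \<in> halfspace k \<longleftrightarrow> b"
      using p q sep by (auto simp: separators_def)
    show ?thesis
    proof (cases "a = e")
      case True
      then show ?thesis using t border_side[OF h t(1)] border_closed by blast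
    next
      case False
      then have "t \<bullet> [(fst h, a)] \<in> border h a" "t \<bullet> [(fst h, a)] \<in> halfspace k \<longleftrightarrow> b"
        using border_flip[of t h a] border_flip_side[OF h k ne t(1)] t by (cases a; cases e; simp)+
      then show ?thesis using border_side[OF h] border_closed by blast
    qed
  qed
  then show ?thesis unfolding crosses_def by blast
qed

text \<open>Along a border the walls of a given type are all crossed in the same direction.\<close>

lemma line_position:
  assumes h: "h \<in> walls" and k: "k \<in> walls" and cr: "crosses h k"
    and p: "p \<in> border h e" and S: "period (fst h) e S"
  shows "\<exists>n. \<forall>m. (p \<bullet> word_pow S m \<in> halfspace k \<longleftrightarrow> (fst k, True) \<in> set S) \<longleftrightarrow> n < m"
proof -
  define c where "c \<longleftrightarrow> (fst k, True) \<in> set S"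
  define A where "A m \<longleftrightarrow> (p \<bullet> word_pow S m \<in> halfspace k \<longleftrightarrow> c)" for m
  have V: "p \<bullet> word_pow S m \<in> V" for m using p border_closed by simp
  have noletter: "(fst k, \<not> c) \<notin> set S"
    using distinct_types_unique[OF period_types_distinct[OF S], of "(fst k, True)" "(fst k, False)"]
    by (cases c) (auto simp: c_def)
  \<comment> \<open>The letter that would undo \<open>A\<close> does not occur in the period, so
    \<open>A\<close> persists for all larger exponents.\<close>
  have up: "A m'" if "A m" "m \<le> m'" for m m'
  proof -
    have "p \<bullet> word_pow S m' = p \<bullet> word_pow S m \<bullet> word_pow S (m' - m)"
      using walk_word_pow_add[of p S m "m' - m"] p border_closed by simp
    moreover have "set (word_pow S (m' - m)) \<subseteq> set S" using set_word_pow[of S "m' - m"] that by simp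
    then have "k \<notin> set (wall_list (p \<bullet> word_pow S m) (word_pow S (m' - m)))"
      using V k noletter S that unfolding A_def by (intro not_crossing) auto
    then have "p \<bullet> word_pow S m \<bullet> word_pow S (m' - m) \<in> halfspace k \<longleftrightarrow> p \<bullet> word_pow S m \<in> halfspace k"
      using V k S by (intro same_side) auto
    ultimately show ?thesis using that by (simp add: A_def)
  qed
  obtain m0 m1 where m: "A m0" "\<not> A m1"
    using crosses_border[OF h k cr, of e] border_period[OF h p S] unfolding A_def by metis
  \<comment> \<open>The threshold is the last exponent at which \<open>A\<close> fails, found by
    counting upwards from \<open>m1\<close>.\<close>
  define n where "n = (LEAST n. A (m1 + int n))"
  have ex: "A (m1 + int (nat (m0 - m1)))" using up[OF m(1)] by auto
  have n: "A (m1 + int n)" unfolding n_def by (rule LeastI[of _ "nat (m0 - m1)"]) (rule ex)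
  then have "n \<noteq> 0" using m(2) by (cases n) auto
  then have n': "\<not> A (m1 + int n - 1)"
    using not_less_Least[of "n - 1" "\<lambda>n. A (m1 + int n)"] by (simp add: n_def[symmetric] of_nat_diff algebra_simps)
  have "A m \<longleftrightarrow> m1 + int n - 1 < m" for m
    using up[of m "m1 + int n - 1"] up[of "m1 + int n" m] n n' by fastforce
  then show ?thesis unfolding A_def c_def by blast
qed

lemma ins_position:
  assumes "h \<in> walls" "fst U \<in> walls" "crosses h (fst U)" "p \<in> border h e" "period (fst h) e S"
  shows "\<exists>n. \<forall>m. ins U (p \<bullet> word_pow S m) \<longleftrightarrow> (n < m \<longleftrightarrow> (snd U \<longleftrightarrow> (fst (fst U), True) \<in> set S))"
  using line_position[OF assms] unfolding ins_def by blast

text \<open>\<open>strip h U W\<close>: the oriented walls \<open>U\<close> and \<open>W\<close> face each other, both cross \<open>h\<close>, and exactly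
  one vertex on each border of \<open>h\<close> lies between them.\<close>

definition strip :: "nat \<times> nat word set set \<Rightarrow> (nat \<times> nat word set set) \<times> bool
    \<Rightarrow> (nat \<times> nat word set set) \<times> bool \<Rightarrow> bool" where
  "strip h U W \<longleftrightarrow> fst U \<in> walls \<and> fst W \<in> walls \<and> fst U \<noteq> fst W \<and> fst (fst U) = fst (fst W)
    \<and> crosses h (fst U) \<and> crosses h (fst W) \<and> (\<forall>s\<in>V. ins U s \<or> ins W s)
    \<and> (\<forall>e. \<exists>p S. p \<in> border h e \<and> period (fst h) e S \<and> ins U p \<and> ins W p
        \<and> \<not> ins U (p \<bullet> word_inv S) \<and> \<not> ins W (p \<bullet> S))"

lemma strip_sym: "strip h U W \<Longrightarrow> strip h W U"
  unfolding strip_def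
proof (elim conjE, intro conjI allI)
  fix e
  assume "\<forall>e. \<exists>p S. p \<in> border h e \<and> period (fst h) e S \<and> ins U p \<and> ins W p
        \<and> \<not> ins U (p \<bullet> word_inv S) \<and> \<not> ins W (p \<bullet> S)"
  then obtain p S where "p \<in> border h e" "period (fst h) e S" "ins U p" "ins W p"
    "\<not> ins U (p \<bullet> word_inv S)" "\<not> ins W (p \<bullet> S)" by blast
  then show "\<exists>p S. p \<in> border h e \<and> period (fst h) e S \<and> ins W p \<and> ins U p
        \<and> \<not> ins W (p \<bullet> word_inv S) \<and> \<not> ins U (p \<bullet> S)"
    by (intro exI[of _ p] exI[of _ "word_inv S"]) (auto simp: period_word_inv)
qed auto

text \<open>\<open>U\<close> and \<open>W\<close> cut the border line in half-lines. The strip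
  condition puts one threshold just before and the other just after a single vertex, so the
  half-lines share only that vertex.\<close>

lemma strip_unique:
  assumes h: "h \<in> walls" and st: "strip h U W"
    and p: "p \<in> border h e" "ins U p" "ins W p" and q: "q \<in> border h e" "ins U q" "ins W q"
  shows "p = q"
proof -
  have *: "r = s" if s: "s \<in> border h e" "period (fst h) e S" "ins U s" "ins W s"
      "\<not> ins U (s \<bullet> word_inv S)" "\<not> ins W (s \<bullet> S)" and r: "r \<in> border h e" "ins U r" "ins W r" for r s S
  proof -
    obtain m where m: "r = s \<bullet> word_pow S m" using border_period[OF h s(1,2)] r(1) by blast
    have UW: "fst U \<in> walls" "fst W \<in> walls" "crosses h (fst U)" "crosses h (fst W)"
      using st by (auto simp: strip_def)
    obtain a where a: "\<And>m. ins U (s \<bullet> word_pow S m) \<longleftrightarrow> (a < m \<longleftrightarrow> (snd U \<longleftrightarrow> (fst (fst U), True) \<in> set S))"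
      using ins_position[OF h UW(1,3) s(1,2)] by blast
    obtain b where b: "\<And>m. ins W (s \<bullet> word_pow S m) \<longleftrightarrow> (b < m \<longleftrightarrow> (snd W \<longleftrightarrow> (fst (fst W), True) \<in> set S))"
      using ins_position[OF h UW(2,4) s(1,2)] by blast
    have sV: "s \<bullet> word_pow S 0 = s" "s \<bullet> word_pow S 1 = s \<bullet> S" "s \<bullet> word_pow S (- 1) = s \<bullet> word_inv S"
      by (simp_all add: word_pow_minus_one)
    define A B where "A \<longleftrightarrow> (snd U \<longleftrightarrow> (fst (fst U), True) \<in> set S)"
      and "B \<longleftrightarrow> (snd W \<longleftrightarrow> (fst (fst W), True) \<in> set S)"
    have "a < 0 \<longleftrightarrow> A" "\<not> (a < - 1 \<longleftrightarrow> A)" "a < m \<longleftrightarrow> A" "b < 0 \<longleftrightarrow> B" "\<not> (b < 1 \<longleftrightarrow> B)" "b < m \<longleftrightarrow> B"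
      using a[of 0] a[of "- 1"] a[of m] b[of 0] b[of 1] b[of m] s r
      unfolding m[symmetric] sV A_def B_def by blast+
    then have "m = 0" by linarith
    then show ?thesis using m by simp
  qed
  obtain s S where "s \<in> border h e" "period (fst h) e S" "ins U s" "ins W s"
    "\<not> ins U (s \<bullet> word_inv S)" "\<not> ins W (s \<bullet> S)" using st unfolding strip_def by blast
  from *[OF this p] *[OF this q] show ?thesis by simp
qed

text \<open>Four oriented walls in cyclic order, \<open>A\<close> facing \<open>C\<close> and
  \<open>B\<close> facing \<open>D\<close>. On each border of each wall its two neighbours leave one
  vertex, so the inner vertex next to each wall is determined.\<close>

definition quad where
  "quad A B C D \<longleftrightarrow> strip (fst A) D B \<and> strip (fst B) A C \<and> strip (fst C) B D \<and> strip (fst D) C A"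

lemma ins_border: "fst A \<in> walls \<Longrightarrow> p \<in> border (fst A) (snd A) \<Longrightarrow> ins A p"
  using border_side unfolding ins_def by blast

lemma ins_same_type:
  assumes "p \<in> V" "w \<in> words X" "fst A \<in> walls" "fst (fst A) \<notin> fst ` set w"
  shows "ins A (p \<bullet> w) \<longleftrightarrow> ins A p"
  using same_side_types[OF assms] by (simp add: ins_def)

lemma strip_separate:
  assumes h: "h \<in> walls" and st: "strip h D B" and p: "p \<in> border h e" "ins D p" "ins B p"
  obtains S where "period (fst h) e S" "\<not> ins D (p \<bullet> word_inv S)" "\<not> ins B (p \<bullet> S)"
proof -
  obtain q S where q: "q \<in> border h e" "period (fst h) e S" "ins D q" "ins B q"
    "\<not> ins D (q \<bullet> word_inv S)" "\<not> ins B (q \<bullet> S)" using st unfolding strip_def by blast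
  have "q = p" by (rule strip_unique[OF h st q(1,3,4) p])
  then show ?thesis using that[of S] q by blast
qed

text \<open>The period of the border of \<open>A\<close> starting at \<open>p\<close> crosses
  \<open>B\<close> at its letter of the type of \<open>B\<close>, and the preceding period crosses
  \<open>D\<close> at the same letter. The part \<open>a\<close> before this letter leads from
  \<open>p\<close> to a vertex on \<open>B\<close>, the part \<open>b\<close> after it from a vertex
  on \<open>D\<close> to \<open>p\<close>; \<open>strip_unique\<close> identifies these vertices
  with \<open>q\<close> and \<open>r\<close>.\<close>

lemma quad_corner:
  assumes quad: "quad A B C D"
    and p: "p \<in> border (fst A) (snd A)" "ins B p" "ins D p"
    and q: "q \<in> border (fst B) (snd B)" "ins A q" "ins C q"
    and r: "r \<in> border (fst D) (snd D)" "ins A r" "ins C r"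
  obtains a b where "a \<in> words X" "b \<in> words X" "q = p \<bullet> a" "p = r \<bullet> b"
    "map fst a @ fst (fst B) # map fst b
      \<in> {cyclic_types (2 * g) (fst (fst A)), rev (cyclic_types (2 * g) (fst (fst A)))}"
proof -
  let ?h = "fst A" and ?e = "snd A"
  have st: "strip ?h D B" "strip (fst B) A C" "strip (fst D) C A"
    using quad by (simp_all add: quad_def)
  have W: "fst A \<in> walls" "fst B \<in> walls" "fst C \<in> walls" "fst D \<in> walls"
    and AC: "fst A \<noteq> fst C" "fst (fst C) = fst ?h" "\<And>s. s \<in> V \<Longrightarrow> ins A s \<or> ins C s"
    and BD: "fst (fst D) = fst (fst B)" "crosses ?h (fst B)"
    using st by (auto simp: strip_def)
  obtain S where S: "period (fst ?h) ?e S" "\<not> ins D (p \<bullet> word_inv S)" "\<not> ins B (p \<bullet> S)"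
    using strip_separate[OF W(1) st(1) p(1,3,2)] .
  let ?j = "fst (fst B)" and ?i = "fst ?h"
  have ij: "?i \<noteq> ?j" using crosses_types W BD by blast
  have jX: "?j \<in> X" "?i \<in> X" using W by simp_all
  have "?j \<in> fst ` set S" using period_types_set[OF S(1)] ij jX by auto
  then obtain x where "x \<in> set S" "fst x = ?j" by auto
  then obtain a b where S_eq: "S = a @ x # b" and x: "fst x = ?j" using split_list by metis
  have d: "distinct (map fst (a @ x # b))" using period_types_distinct[OF S(1)] by (simp add: S_eq)
  have Sw: "a @ x # b \<in> words X" using S(1) S_eq period_words by blast
  then have w: "a \<in> words X" "b \<in> words X" "[x] \<in> words X" "a @ [x] \<in> words X" by auto
  have i_notin: "?i \<notin> fst ` set S" using period_types_set[OF S(1)] by simp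
  have ja: "?j \<notin> fst ` set a" "?j \<notin> fst ` set b" using d x by auto
  have ia: "?i \<notin> fst ` set a" "?i \<notin> fst ` set (a @ [x])" using i_notin by (auto simp: S_eq)
  have pV: "p \<in> V" using p(1) border_closed by blast
  let ?p' = "p \<bullet> word_inv S"
  have p'V: "?p' \<in> V" using pV by simp
  have p'S: "?p' \<bullet> S = p" using walk_word_inv[OF pV, of "word_inv S"] by simp
  have insA: "ins A p" using ins_border W(1) p(1) by blast
  \<comment> \<open>Stepping over \<open>A\<close> leaves side \<open>A\<close>, hence lands in
    \<open>C\<close>, and this step does not cross the wall of \<open>C\<close>.\<close>
  have insC: "ins C p"
  proof -
    let ?t = "p \<bullet> [(?i, \<not> ?e)]"
    have t: "?t \<in> border ?h (\<not> ?e)" using border_flip[of p ?h "\<not> ?e"] p(1) by simp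
    then have "\<not> ins A ?t" using border_side[OF W(1)] by (simp add: ins_def)
    then have "ins C ?t" using AC(3)[of ?t] pV by simp
    then show ?thesis using border_flip_side[OF W(1,3) AC(1) p(1)] by (simp add: ins_def)
  qed
  have "fst B \<in> separators p (p \<bullet> (a @ x # b))"
    using S(3) p(2) W(2) by (auto simp: separators_def ins_def S_eq)
  then have wB: "wall_of (p \<bullet> a) x = fst B"
    using separators_letter[OF pV Sw d] x by simp
  have "ins B (p \<bullet> a)" using ins_same_type[OF pV w(1) W(2) ja(1)] p(2) by simp
  have q0: "p \<bullet> a \<in> border (fst B) (\<not> snd x)" using wall_of_border(1)[OF _ wB] pV by simp
  then have "snd B \<longleftrightarrow> \<not> snd x" using border_side[OF W(2) q0] \<open>ins B (p \<bullet> a)\<close> by (auto simp: ins_def)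
  moreover have "ins A (p \<bullet> a)" using ins_same_type[OF pV w(1) W(1) ia(1)] insA by simp
  moreover have "ins C (p \<bullet> a)" using ins_same_type[OF pV w(1) W(3)] AC(2) ia(1) insC by simp
  ultimately have q_eq: "q = p \<bullet> a"
    using strip_unique[OF W(2) st(2) q] q0 by simp
  have "fst D \<in> separators ?p' (?p' \<bullet> (a @ x # b))"
    using S(2) p(3) W(4) p'S by (auto simp: separators_def ins_def S_eq)
  then have wD: "wall_of (?p' \<bullet> a) x = fst D"
    using separators_letter[OF p'V Sw d] x BD(1) by simp
  let ?r = "?p' \<bullet> (a @ [x])"
  have rV: "?r \<in> V" using p'V by simp
  have rb: "?r \<bullet> b = p" using p'S by (simp add: S_eq flip: walk_append)
  have r0: "?r \<in> border (fst D) (snd x)" using wall_of_border(2)[OF _ wD] p'V by (simp add: walk_append)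
  have "ins D ?r" using ins_same_type[OF rV w(2) W(4)] ja(2) p(3) BD(1) unfolding rb by simp
  then have "snd D \<longleftrightarrow> snd x" using border_side[OF W(4) r0] by (auto simp: ins_def)
  moreover have ib: "?i \<notin> fst ` set b" using i_notin by (auto simp: S_eq)
  have "ins A ?r" using ins_same_type[OF rV w(2) W(1) ib] insA unfolding rb by simp
  moreover have "ins C ?r" using ins_same_type[OF rV w(2) W(3)] ib AC(2) insC unfolding rb by simp
  ultimately have "r = ?r"
    using strip_unique[OF W(4) st(3) r(1,3,2)] r0 by simp
  then have "p = r \<bullet> b" using rb by simp
  moreover have "map fst a @ fst (fst B) # map fst b
      \<in> {cyclic_types (2 * g) (fst (fst A)), rev (cyclic_types (2 * g) (fst (fst A)))}"
    using types_period[OF S(1)] x by (simp add: S_eq)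
  ultimately show ?thesis using that w q_eq by blast
qed

lemma quad_rotate: "quad A B C D \<Longrightarrow> quad B C D A"
  by (simp add: quad_def)

lemma quad_node:
  assumes "quad A B C D"
  obtains p where "p \<in> border (fst A) (snd A)" "ins B p" "ins D p"
  using assms unfolding quad_def strip_def by blast

text \<open>Both words are geodesic, and their types are those of the walls separating the common
  endpoints.\<close>

lemma walk_types:
  assumes "p \<in> V" "v \<in> words X" "w \<in> words X" "p \<bullet> v = p \<bullet> w"
    "distinct (map fst v)" "distinct (map fst w)"
  shows "fst ` set v = fst ` set w"
  using separators_types(1)[of p v] separators_types(1)[of p w] assms by simp

text \<open>Around a quadrilateral of walls the inner boundary would read two copies of a word
  using every type other than \<open>i\<close> and \<open>j\<close> once; the first letter of the first copy and the first
  letter of the second cross the same wall, but the path between them is too short.\<close>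

lemma no_quad: "\<not> quad A B C D"
proof
  assume Q: "quad A B C D"
  note Q2 = quad_rotate[OF Q] note Q3 = quad_rotate[OF Q2] note Q4 = quad_rotate[OF Q3]
  let ?i = "fst (fst A)" and ?j = "fst (fst B)"
  have st: "strip (fst A) D B" "strip (fst B) A C"
    using Q by (simp_all add: quad_def)
  have W: "fst A \<in> walls" "fst B \<in> walls" and cr: "crosses (fst A) (fst B)"
    and ty: "fst (fst C) = ?i" "fst (fst D) = ?j"
    using st by (simp_all add: strip_def)
  have ij: "?i \<noteq> ?j" by (rule crosses_types[OF W cr])
  obtain pa where pa: "pa \<in> border (fst A) (snd A)" "ins B pa" "ins D pa" using quad_node[OF Q] .
  obtain pb where pb: "pb \<in> border (fst B) (snd B)" "ins C pb" "ins A pb" using quad_node[OF Q2] .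
  obtain pc where pc: "pc \<in> border (fst C) (snd C)" "ins D pc" "ins B pc" using quad_node[OF Q3] .
  obtain pd where pd: "pd \<in> border (fst D) (snd D)" "ins A pd" "ins C pd" using quad_node[OF Q4] .
  have V: "pa \<in> V" "pb \<in> V" "pc \<in> V" "pd \<in> V"
    using border_closed[OF pa(1)] border_closed[OF pb(1)] border_closed[OF pc(1)] border_closed[OF pd(1)] by simp_all
  let ?n = "2 * g"
  obtain a0 b0 where 0: "a0 \<in> words X" "b0 \<in> words X" "pb = pa \<bullet> a0" "pa = pd \<bullet> b0"
    "map fst a0 @ ?j # map fst b0 \<in> {cyclic_types ?n ?i, rev (cyclic_types ?n ?i)}"
    using quad_corner[OF Q pa pb(1,3,2) pd] .
  obtain a1 b1 where 1: "a1 \<in> words X" "b1 \<in> words X" "pc = pb \<bullet> a1" "pb = pa \<bullet> b1"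
    "map fst a1 @ ?i # map fst b1 \<in> {cyclic_types ?n ?j, rev (cyclic_types ?n ?j)}"
    using quad_corner[OF Q2 pb pc(1,3,2) pa] unfolding ty .
  obtain a2 b2 where 2: "a2 \<in> words X" "b2 \<in> words X" "pd = pc \<bullet> a2" "pc = pb \<bullet> b2"
    "map fst a2 @ ?j # map fst b2 \<in> {cyclic_types ?n ?i, rev (cyclic_types ?n ?i)}"
    using quad_corner[OF Q3 pc pd(1,3,2) pb] unfolding ty .
  obtain a3 b3 where 3: "a3 \<in> words X" "b3 \<in> words X" "pa = pd \<bullet> a3" "pd = pc \<bullet> b3"
    "map fst a3 @ ?i # map fst b3 \<in> {cyclic_types ?n ?j, rev (cyclic_types ?n ?j)}"
    using quad_corner[OF Q4 pd pa(1,3,2) pc] unfolding ty .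
  have X_ij: "?i \<in> {1..?n}" "?j \<in> {1..?n}" "3 \<le> ?n"
    using fst_wall[OF W(1)] fst_wall[OF W(2)] genus by (simp_all add: X_def)
  have dist: "distinct (as @ k # bs)"
    if "as @ k # bs \<in> {cyclic_types ?n l, rev (cyclic_types ?n l)}" for as bs k l
  proof -
    have "as @ k # bs = cyclic_types ?n l \<or> as @ k # bs = rev (cyclic_types ?n l)"
      using that by (simp only: insert_iff empty_iff simp_thms)
    then show ?thesis by (elim disjE) (simp_all only: distinct_rev distinct_cyclic_types)
  qed
  \<comment> \<open>Each side of the inner quadrilateral is an \<open>a\<close> word at one corner
    and a \<open>b\<close> word at the next, so the cyclic orders at adjacent corners have to
    match.\<close>
  have m01: "map fst a1 = map fst b0 \<and> map fst b1 = map fst a0"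
    using walk_types[OF V(1) 0(1) 1(2)] 0(3) 1(4) dist[OF 0(5)] dist[OF 1(5)]
    by (intro cyclic_types_match[OF X_ij(1,2) ij X_ij(3) 0(5) 1(5)]) simp
  have m12: "map fst a2 = map fst b1 \<and> map fst b2 = map fst a1"
    using walk_types[OF V(2) 1(1) 2(2)] 1(3) 2(4) dist[OF 1(5)] dist[OF 2(5)]
    by (intro cyclic_types_match[OF X_ij(2,1) ij[symmetric] X_ij(3) 1(5) 2(5)]) simp
  have m23: "map fst a3 = map fst b2 \<and> map fst b3 = map fst a2"
    using walk_types[OF V(3) 2(1) 3(2)] 2(3) 3(4) dist[OF 2(5)] dist[OF 3(5)]
    by (intro cyclic_types_match[OF X_ij(1,2) ij X_ij(3) 2(5) 3(5)]) simp
  \<comment> \<open>Opposite sides carry the same types, so both halves of the boundary read the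
    same list, in which each type other than \<open>?i\<close> and \<open>?j\<close> occurs
    once.\<close>
  have types: "map fst (a0 @ a1) = map fst a0 @ map fst b0" "map fst (a2 @ a3) = map fst (a0 @ a1)"
    using m01 m12 m23 by simp_all
  have "distinct (map fst a0 @ ?j # map fst b0)" using dist[OF 0(5)] .
  then have d: "distinct (map fst (a0 @ a1))" unfolding types by auto
  have cset: "set (cyclic_types ?n ?i) = X - {?i}" "length (cyclic_types ?n ?i) = ?n - 1"
    using X_ij by (auto simp: cyclic_types_def X_def simp del: upt_Suc)
  have "set (map fst a0 @ ?j # map fst b0) = X - {?i}" "length (map fst a0 @ ?j # map fst b0) = ?n - 1"
  proof -
    have "map fst a0 @ ?j # map fst b0 = cyclic_types ?n ?i \<or> map fst a0 @ ?j # map fst b0 = rev (cyclic_types ?n ?i)"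
      using 0(5) by (simp only: insert_iff empty_iff simp_thms)
    then show "set (map fst a0 @ ?j # map fst b0) = X - {?i}" "length (map fst a0 @ ?j # map fst b0) = ?n - 1"
      by (elim disjE; simp only: set_rev length_rev cset)+
  qed
  then have ab: "insert ?j (fst ` set a0 \<union> fst ` set b0) = X - {?i}" "Suc (length a0 + length b0) = ?n - 1"
    by simp_all
  have j: "?j \<notin> fst ` set a0 \<union> fst ` set b0"
    using \<open>distinct (map fst a0 @ ?j # map fst b0)\<close> by simp
  have "fst ` set (a0 @ a1) = fst ` set a0 \<union> fst ` set b0"
    using arg_cong[OF types(1), of set] by (simp add: image_Un)
  moreover have sub: "T \<subseteq> X - {?i, ?j}" if "insert ?j T = X - {?i}" "?j \<notin> T" for T
    using that by auto
  ultimately have tset: "fst ` set (a0 @ a1) \<subseteq> X - {?i, ?j}" using sub[OF ab(1) j] by (simp only:)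
  have tlen: "length (a0 @ a1) = ?n - 2"
    using arg_cong[OF types(1), of length] ab(2) by simp
  have "2 \<le> length c \<Longrightarrow> \<exists>x y. c = x # y \<and> y \<noteq> []" for c :: "nat word"
    by (cases c) auto
  moreover have "2 \<le> length (a0 @ a1)" unfolding tlen using genus by simp
  ultimately obtain x y where xy: "a0 @ a1 = x # y" "y \<noteq> []" by blast
  have "\<exists>x' y'. c = x' # y' \<and> fst x' = fst x \<and> map fst y' = map fst y"
    if "map fst c = map fst (x # y)" for c :: "nat word"
    using that by (cases c) auto
  from this[OF types(2)[unfolded xy(1)]]
  obtain x' y' where xy': "a2 @ a3 = x' # y'" "fst x' = fst x" "map fst y' = map fst y" by blast
  have w: "x # y \<in> words X" "x' # y' \<in> words X"
    unfolding xy(1)[symmetric] xy'(1)[symmetric] using 0(1) 1(1) 2(1) 3(1) by simp_all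
  then have w': "y \<in> words X" "y' \<in> words X" "fst x \<in> X" by (auto simp: words_iff)
  have pc_eq: "pc = pa \<bullet> [x] \<bullet> y" and pa_eq: "pa = pc \<bullet> [x'] \<bullet> y'"
    using 0(3) 1(3) 2(3) 3(3) walk_append[of pa a0 a1] walk_append[of pc a2 a3]
    unfolding xy(1) xy'(1) by (simp_all add: walk_Cons[of _ x y] walk_Cons[of _ x' y'])
  define z where "z = wall_of pa x"
  have z: "z \<in> walls" "fst z = fst x" using V w' by (simp_all add: z_def)
  have x_y: "fst x \<notin> fst ` set y" using d unfolding xy(1) by auto
  then have x_y': "fst x \<notin> fst ` set y'" using arg_cong[OF xy'(3), of set] by simp
  let ?q = "pa \<bullet> [x]"
  have qV: "?q \<in> V" using V by simp
  have sep1: "?q \<in> halfspace z \<longleftrightarrow> \<not> pa \<in> halfspace z"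
    using halfspace_crossing(1)[OF z(1) V(1) w'(3)] by (simp add: z_def)
  have side1: "pc \<in> halfspace z \<longleftrightarrow> ?q \<in> halfspace z"
    unfolding pc_eq using same_side_types[OF qV w'(1) z(1)] z(2) x_y by simp
  have "pa \<in> halfspace z \<longleftrightarrow> pc \<bullet> [x'] \<in> halfspace z"
    using same_side_types[OF _ w'(2) z(1), of "pc \<bullet> [x']"] z(2) x_y' V pa_eq by simp
  then have "\<not> (pc \<bullet> [x'] \<in> halfspace z \<longleftrightarrow> pc \<in> halfspace z)" using sep1 side1 by simp
  \<comment> \<open>The boundary closes up, and \<open>y\<close> and \<open>y'\<close> contain no
    letter of the type of \<open>z\<close>; so it is \<open>x'\<close> that crosses \<open>z\<close>
    back.\<close>
  then have zc: "wall_of pc x' = z"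
    using halfspace_crossing(1)[OF z(1) V(3), of x'] xy'(2) w'(3) by simp
  have bq: "?q \<in> border z (snd x)" using wall_of_border(2)[OF V(1)] z_def by simp
  have bc: "pc \<in> border z (\<not> snd x')" using wall_of_border(1)[OF V(3) zc] .
  have "snd x \<longleftrightarrow> \<not> snd x'" using border_side[OF z(1) bq] border_side[OF z(1) bc] side1 by simp
  then obtain m where m: "pc = ?q \<bullet> word_pow (side_word (fst z) (snd x)) m"
    using border_iff[OF z(1) bq] bc by auto
  have sepy: "fst ` separators ?q pc = fst ` set y"
    unfolding pc_eq using d w' xy(1) qV by (intro separators_types) auto
  have "m \<noteq> 0"
  proof
    assume "m = 0"
    then have "pc = ?q" using m by simp
    then show False using sepy xy(2) by simp
  qed
  have "separators ?q pc = set (wall_list ?q (word_pow (side_word (fst z) (snd x)) m))"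
    unfolding m using qV w'(3) distinct_side_pow by (intro separators_walk_distinct) (simp_all add: z(2))
  then have "fst ` set y = fst ` set (word_pow (side_word (fst z) (snd x)) m)"
    unfolding sepy[symmetric] by (simp only: list.set_map[symmetric] types_wall_list)
  also have "\<dots> = X - {fst z}"
  proof -
    have "fst ` set (side_word (fst z) (snd x)) = X - {fst z}"
      by (rule types_side_word[OF fst_wall[OF z(1)]])
    then show ?thesis using \<open>m \<noteq> 0\<close> by (simp add: word_pow_def image_image)
  qed
  \<comment> \<open>A nontrivial piece of the border of \<open>z\<close> uses every type but that of
    \<open>z\<close>, whereas neither \<open>x\<close> nor \<open>y\<close> has type
    \<open>?i\<close>.\<close>
  finally have "?i \<in> fst ` set y \<or> fst z = ?i" using fst_wall[OF W(1)] by auto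
  then have "?i \<in> fst ` set (a0 @ a1)" unfolding xy(1) z(2) by auto
  with tset show False by auto
qed

section \<open>From a grid of walls to a quadrilateral\<close>

lemma period_sign:
  assumes "period i e S" "j \<in> X" "j \<noteq> i"
  shows "(j, True) \<in> set (word_inv S) \<longleftrightarrow> (j, True) \<notin> set S"
proof -
  have "(j, True) \<in> letter_inv ` A \<longleftrightarrow> (j, False) \<in> A" for A
  proof
    assume "(j, True) \<in> letter_inv ` A"
    then obtain y where "y \<in> A" "(j, True) = letter_inv y" by blast
    moreover from this(2) have "y = (j, False)" by (simp add: letter_inv_def prod_eq_iff)
    ultimately show "(j, False) \<in> A" by simp
  next
    assume "(j, False) \<in> A"
    moreover have "(j, True) = letter_inv (j, False)" by (simp add: letter_inv_def)
    ultimately show "(j, True) \<in> letter_inv ` A" by (rule rev_image_eqI)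
  qed
  then have "(j, True) \<in> set (word_inv S) \<longleftrightarrow> (j, False) \<in> set S" by simp
  moreover have "j \<in> fst ` set S" using period_types_set[OF assms(1)] assms by simp
  then obtain b where "(j, b) \<in> set S" by auto
  then have "(j, True) \<in> set S \<or> (j, False) \<in> set S" by (cases b) simp_all
  moreover have "\<not> ((j, True) \<in> set S \<and> (j, False) \<in> set S)"
    using distinct_types_unique[OF period_types_distinct[OF assms(1)], of "(j, True)" "(j, False)"] by auto
  ultimately show ?thesis by blast
qed

lemma walk_word_pow_Suc: "p \<in> V \<Longrightarrow> p \<bullet> word_pow S (m + 1) = p \<bullet> word_pow S m \<bullet> S"
  using walk_word_pow_add[of p S m 1] by simp

text \<open>Stepping over \<open>h\<close> moves the line to the parallel border without crossing
  any other wall, so positions relative to the other walls persist.\<close>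

lemma period_flip:
  assumes h: "h \<in> walls" and p: "p \<in> border h e" and S: "period (fst h) e S"
  obtains p' S' where "p' \<in> border h (\<not> e)" "period (fst h) (\<not> e) S'"
    "\<And>U. fst U \<in> walls \<Longrightarrow> fst U \<noteq> h \<Longrightarrow> (ins U p' \<longleftrightarrow> ins U p)
      \<and> (ins U (p' \<bullet> S') \<longleftrightarrow> ins U (p \<bullet> S)) \<and> (ins U (p' \<bullet> word_inv S') \<longleftrightarrow> ins U (p \<bullet> word_inv S))"
proof -
  let ?c = "[(fst h, \<not> e)]"
  have pV: "p \<in> V" using p border_closed by blast
  obtain n :: int where n: "S = word_pow (side_word (fst h) e) n" "word_inv S = word_pow (side_word (fst h) e) (- n)"
    and n': "n = 1 \<or> n = - 1"
  proof -
    have "S = side_word (fst h) e \<or> S = word_inv (side_word (fst h) e)"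
      using S unfolding period_def by simp
    then show ?thesis using that[of 1] that[of "- 1"] by (auto simp: word_pow_minus_one)
  qed
  define S' where "S' = word_pow (side_word (fst h) (\<not> e)) n"
  have inv: "word_inv S' = word_pow (side_word (fst h) (\<not> e)) (- n)"
    using n' unfolding S'_def by (auto simp: word_pow_minus_one)
  have S': "period (fst h) (\<not> e) S'"
    using n' h unfolding S'_def period_def by (auto simp: word_pow_minus_one)
  have flip: "p \<bullet> ?c \<bullet> word_pow (side_word (fst h) (\<not> e)) m = p \<bullet> word_pow (side_word (fst h) e) m \<bullet> ?c" for m
    using walk_flip_word_pow[OF pV, of "fst h" "\<not> e" m] h by simp
  have sides: "ins U (q \<bullet> ?c) \<longleftrightarrow> ins U q" if "fst U \<in> walls" "fst U \<noteq> h" "q \<in> border h e" for U q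
    using border_flip_side[OF h that(1) that(2)[symmetric] that(3)] by (simp add: ins_def)
  have b: "p \<bullet> word_pow (side_word (fst h) e) m \<in> border h e" for m
    using border_iff[OF h p] by blast
  have "p \<bullet> ?c \<in> border h (\<not> e)" using border_flip[of p h "\<not> e"] p by simp
  moreover have "(ins U (p \<bullet> ?c) \<longleftrightarrow> ins U p) \<and> (ins U (p \<bullet> ?c \<bullet> S') \<longleftrightarrow> ins U (p \<bullet> S))
    \<and> (ins U (p \<bullet> ?c \<bullet> word_inv S') \<longleftrightarrow> ins U (p \<bullet> word_inv S))" if "fst U \<in> walls" "fst U \<noteq> h" for U
    unfolding inv n(2) unfolding n(1) S'_def flip using p b by (simp add: sides[OF that])
  ultimately show ?thesis using that S' by blast
qed

lemma wall_between:
  assumes h: "h \<in> walls" and p: "p \<in> border h e" and S: "period (fst h) e S"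
    and j: "j \<in> X" "j \<noteq> fst h"
  obtains k where "k \<in> walls" "fst k = j" "k \<in> separators p (p \<bullet> S)" "crosses h k"
proof -
  have "j \<in> fst ` separators p (p \<bullet> S)"
    using separators_types(1)[OF border_closed[OF p] period_words[OF S] period_types_distinct[OF S]]
      period_types_set[OF S] j by simp
  then obtain k where k: "k \<in> separators p (p \<bullet> S)" "fst k = j" by auto
  have "k \<in> walls" using k by (simp add: separators_def)
  moreover have "p \<bullet> S \<in> border h e"
    using border_period[OF h p S, of "p \<bullet> S"] exI[of "\<lambda>m. p \<bullet> S = p \<bullet> word_pow S m" 1] by simp
  ultimately have "crosses h k" using crosses_if_border[OF h _ _ p _ k(1)] k(2) j(2) by blast
  with that k \<open>k \<in> walls\<close> show ?thesis by blast
qed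

lemma period_separators_unique:
  assumes "p \<in> V" "period i e S" "k \<in> separators p (p \<bullet> S)" "k' \<in> separators p (p \<bullet> S)" "fst k = fst k'"
  shows "k = k'"
  using separators_types(2)[OF assms(1) period_words[OF assms(2)] period_types_distinct[OF assms(2)]] assms(3-5)
  by (auto dest: inj_onD)

text \<open>Walls of one type do not cross, so three nonempty quadrants leave the fourth
  empty.\<close>

lemma facing:
  assumes "k \<in> walls" "k' \<in> walls" "fst k = fst k'" "s \<in> V"
    and "\<exists>t\<in>V. ins (k, \<not> a) t \<and> ins (k', b) t" "\<exists>t\<in>V. ins (k, a) t \<and> ins (k', b) t"
    "\<exists>t\<in>V. ins (k, a) t \<and> ins (k', \<not> b) t"
  shows "ins (k, a) s \<or> ins (k', b) s"
proof (rule ccontr)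
  assume "\<not> ?thesis"
  then have "\<exists>t\<in>V. ins (k, \<not> a) t \<and> ins (k', \<not> b) t" using assms(4) by (auto simp: ins_def)
  with assms(5-7) have "crosses k k'"
    unfolding crosses_def ins_def fst_conv snd_conv by (cases a; cases b) (auto simp: all_bool_eq)
  with crosses_types assms(1-3) show False by blast
qed

lemma line_steps:
  assumes "h \<in> walls" "p \<in> border h e" "period (fst h) e S"
  shows "p \<bullet> word_pow S m \<in> V" "p \<bullet> word_pow S m \<in> border h e"
    "p \<bullet> word_pow S (m + 1) = p \<bullet> word_pow S m \<bullet> S"
    "p \<bullet> word_pow S m \<bullet> word_inv S = p \<bullet> word_pow S (m - 1)"
proof -
  have pV: "p \<in> V" by (rule border_closed[OF assms(2)])
  then show "p \<bullet> word_pow S m \<in> V" by simp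
  show "p \<bullet> word_pow S m \<in> border h e" using border_period[OF assms] by blast
  show "p \<bullet> word_pow S (m + 1) = p \<bullet> word_pow S m \<bullet> S" by (rule walk_word_pow_Suc[OF pV])
  have "p \<bullet> word_pow S m = p \<bullet> word_pow S (m - 1) \<bullet> S"
    using walk_word_pow_Suc[OF pV, of S "m - 1"] by simp
  then show "p \<bullet> word_pow S m \<bullet> word_inv S = p \<bullet> word_pow S (m - 1)" using pV by simp
qed

lemma separators_ins: "fst U \<in> walls \<Longrightarrow> fst U \<in> separators p q \<longleftrightarrow> (ins U p \<longleftrightarrow> \<not> ins U q)"
  unfolding separators_def ins_def by blast

text \<open>Being neighbours does not depend on the wall along which it is observed. On a border of
  \<open>h'\<close> the thresholds of \<open>U\<close> and \<open>W\<close> differ by one: equal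
  thresholds would put two walls of one type into a single period, and a wider gap would contain a
  third wall of this type, for which there is no room on \<open>h\<close>.\<close>

lemma strip_transfer:
  assumes h: "h \<in> walls" and h': "h' \<in> walls" and st: "strip h U W"
    and cr: "crosses h' (fst U)" "crosses h' (fst W)"
  shows "strip h' U W"
proof -
  have UW: "fst U \<in> walls" "fst W \<in> walls" "fst U \<noteq> fst W" "fst (fst U) = fst (fst W)"
    "\<And>s. s \<in> V \<Longrightarrow> ins U s \<or> ins W s"
    using st by (auto simp: strip_def)
  have "\<exists>p S. p \<in> border h' e \<and> period (fst h') e S \<and> ins U p \<and> ins W p
        \<and> \<not> ins U (p \<bullet> word_inv S) \<and> \<not> ins W (p \<bullet> S)" for e
  proof -
    let ?t = "fst (fst U)"
    have t: "?t \<in> X" "?t \<noteq> fst h'" using UW cr crosses_types[OF h' UW(1)] by auto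
    obtain p where p: "p \<in> border h' e" using border_nonempty[OF h'] by blast
    have pV: "p \<in> V" using p border_closed by blast
    define S0 where "S0 = side_word (fst h') e"
    have S0: "period (fst h') e S0" using h' by (simp add: period_def S0_def)
    \<comment> \<open>The direction along the border is chosen so that it enters \<open>U\<close>;
      since every vertex lies in \<open>U\<close> or \<open>W\<close>, it must leave
      \<open>W\<close>.\<close>
    obtain S where S: "period (fst h') e S" "snd U \<longleftrightarrow> (?t, True) \<in> set S"
      using S0 period_word_inv[OF S0] period_sign[OF S0 t] by blast
    define L where "L m = p \<bullet> word_pow S m" for m
    have LV: "L m \<in> V" and Lb: "L m \<in> border h' e" and Suc: "L (m + 1) = L m \<bullet> S"
      and Pred: "L m \<bullet> word_inv S = L (m - 1)" for m
      unfolding L_def by (rule line_steps[OF h' p S(1)])+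
    obtain n1 where n1: "\<And>m. ins U (L m) \<longleftrightarrow> n1 < m"
      using ins_position[OF h' UW(1) cr(1) p S(1)] S(2) unfolding L_def by auto
    obtain n2 where "\<And>m. ins W (L m) \<longleftrightarrow> (n2 < m \<longleftrightarrow> (snd W \<longleftrightarrow> (?t, True) \<in> set S))"
      using ins_position[OF h' UW(2) cr(2) p S(1)] unfolding L_def UW(4) by blast
    moreover from this[of "min n1 n2"] have "\<not> (snd W \<longleftrightarrow> (?t, True) \<in> set S)"
      using UW(5)[OF LV, of "min n1 n2"] n1 by simp
    ultimately have n2: "\<And>m. ins W (L m) \<longleftrightarrow> m \<le> n2" unfolding not_less[symmetric] by blast
    have "n1 \<le> n2" using UW(5)[OF LV, of n1] n1 n2 by simp
    moreover have "n1 \<noteq> n2"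
    proof
      assume "n1 = n2"
      then have "fst U \<in> separators (L n1) (L n1 \<bullet> S)" "fst W \<in> separators (L n1) (L n1 \<bullet> S)"
        unfolding Suc[symmetric] separators_ins[OF UW(1)] separators_ins[OF UW(2)] n1 n2 by simp_all
      then show False using period_separators_unique[OF LV S(1)] UW(3,4) by blast
    qed
    moreover have "\<not> n1 + 2 \<le> n2"
    proof
      assume n12: "n1 + 2 \<le> n2"
      \<comment> \<open>\<open>k\<close> is the wall of the same type crossed in the period just
        after the one that enters \<open>U\<close>; it lies strictly between the two walls.\<close>
      obtain k where k: "k \<in> walls" "fst k = ?t" "k \<in> separators (L (n1 + 1)) (L (n1 + 1) \<bullet> S)" "crosses h' k"
        using wall_between[OF h' Lb S(1) t, of "n1 + 1"] .
      define c where "c \<longleftrightarrow> (?t, True) \<in> set S"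
      obtain n where n: "\<And>m. ins (k, c) (L m) \<longleftrightarrow> n < m"
        using ins_position[of h' "(k, c)", OF h' _ _ p S(1)] k unfolding L_def c_def by auto
      have "n1 + 1 \<le> n" "n < n1 + 2"
        using k(3) separators_ins[of "(k, c)" "L (n1 + 1)" "L (n1 + 1 + 1)"] k(1)
        unfolding Suc[symmetric] n fst_conv by auto
      then have n_eq: "n = n1 + 1" by simp
      have cU: "U = (fst U, c)" using S(2) by (simp add: c_def prod_eq_iff)
      have cW: "W = (fst W, \<not> c)"
        using \<open>\<not> (snd W \<longleftrightarrow> (?t, True) \<in> set S)\<close> by (auto simp: c_def prod_eq_iff)
      have iU: "ins (fst U, c) s \<longleftrightarrow> ins U s" "ins (fst U, \<not> c) s \<longleftrightarrow> \<not> ins U s" for s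
        using arg_cong[OF cU, of snd] by (auto simp: ins_def)
      have iW: "ins (fst W, \<not> c) s \<longleftrightarrow> ins W s" "ins (fst W, c) s \<longleftrightarrow> \<not> ins W s" for s
        using arg_cong[OF cW, of snd] by (auto simp: ins_def)
      have nn: "ins (k, \<not> c) s \<longleftrightarrow> \<not> ins (k, c) s" for s by (auto simp: ins_def)
      have f1: "ins (fst U, c) s \<or> ins (k, \<not> c) s" if "s \<in> V" for s
      proof (rule facing[OF UW(1) k(1) _ that])
        show "\<exists>t\<in>V. ins (fst U, \<not> c) t \<and> ins (k, \<not> c) t"
          by (intro bexI[OF _ LV[of n1]]) (simp only: iU nn n1 n n_eq, simp)
        show "\<exists>t\<in>V. ins (fst U, c) t \<and> ins (k, \<not> c) t"
          by (intro bexI[OF _ LV[of "n1 + 1"]]) (simp only: iU nn n1 n n_eq, simp)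
        show "\<exists>t\<in>V. ins (fst U, c) t \<and> ins (k, \<not> \<not> c) t"
          by (intro bexI[OF _ LV[of "n1 + 2"]]) (simp only: iU nn n1 n n_eq not_not, simp)
      qed (simp add: k)
      have f2: "ins (k, c) s \<or> ins (fst W, \<not> c) s" if "s \<in> V" for s
      proof (rule facing[OF k(1) UW(2) _ that])
        show "\<exists>t\<in>V. ins (k, \<not> c) t \<and> ins (fst W, \<not> c) t"
          by (intro bexI[OF _ LV[of "n1 + 1"]]) (simp only: iW nn n2 n n_eq, insert n12, simp)
        show "\<exists>t\<in>V. ins (k, c) t \<and> ins (fst W, \<not> c) t"
          by (intro bexI[OF _ LV[of "n1 + 2"]]) (simp only: iW nn n2 n n_eq, insert n12, simp)
        show "\<exists>t\<in>V. ins (k, c) t \<and> ins (fst W, \<not> \<not> c) t"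
          by (intro bexI[OF _ LV[of "n2 + 1"]]) (simp only: iW nn n2 n n_eq not_not, insert n12, simp)
      qed (simp add: k UW)
      \<comment> \<open>Back on \<open>h\<close>, the wall \<open>k\<close> has to be crossed in one
        of the two periods meeting at \<open>q\<close>. These already cross \<open>U\<close> and
        \<open>W\<close>, and a period crosses only one wall of each type.\<close>
      obtain q T where q: "q \<in> border h True" "period (fst h) True T" "ins U q" "ins W q"
        "\<not> ins U (q \<bullet> word_inv T)" "\<not> ins W (q \<bullet> T)" using st unfolding strip_def by blast
      have qV: "q \<in> V" by (rule border_closed[OF q(1)])
      let ?q = "q \<bullet> word_inv T"
      have qT: "?q \<bullet> T = q" using walk_word_inv[OF qV, of "word_inv T"] by simp
      have 1: "\<not> ins (k, c) ?q" using f1[of ?q] q(5) qV unfolding iU nn by simp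
      have 2: "ins (k, c) (q \<bullet> T)" using f2[of "q \<bullet> T"] q(6) qV unfolding iW by simp
      show False
      proof (cases "ins (k, c) q")
        case True
        then have "k \<in> separators ?q (?q \<bullet> T)" "fst U \<in> separators ?q (?q \<bullet> T)"
          unfolding qT using 1 q(3,5) separators_ins[OF UW(1), of ?q q] separators_ins[of "(k, c)" ?q q] k(1) by simp_all
        then have "k = fst U" using period_separators_unique[of ?q "fst h" True T] q qV k(2) by simp
        then have "(k, c) = U" by (metis cU)
        then show False using n[of "n1 + 1"] n1[of "n1 + 1"] n_eq by simp
      next
        case False
        then have "k \<in> separators q (q \<bullet> T)" "fst W \<in> separators q (q \<bullet> T)"
          using 2 q(4,6) separators_ins[OF UW(2), of q "q \<bullet> T"] separators_ins[of "(k, c)" q "q \<bullet> T"] k(1) by simp_all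
        then have "k = fst W" using period_separators_unique[of q "fst h" True T] q qV k(2) UW(4) by simp
        then have "(k, \<not> c) = W" by (metis cW)
        then have "\<not> ins (k, c) (L (n1 + 2))" using n2[of "n1 + 2"] n12 nn[of "L (n1 + 2)"] by simp
        then show False using n[of "n1 + 2"] n_eq by simp
      qed
    qed
    ultimately have "n2 = n1 + 1" by linarith
    then show ?thesis
      using Lb S(1) by (intro exI[of _ "L (n1 + 1)"] exI[of _ S]) (simp add: Pred n1 n2 flip: Suc)
  qed
  with UW cr show ?thesis unfolding strip_def by blast
qed

lemma ins_not: "ins (k, \<not> a) s \<longleftrightarrow> \<not> ins (k, a) s"
  by (auto simp: ins_def)

text \<open>\<open>W\<close> is the wall next to \<open>u1\<close> in the direction of
  \<open>u2\<close> along a border of \<open>h\<close>. If it differs from \<open>u2\<close> it lies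
  between the two, and so it crosses \<open>h'\<close> as they do.\<close>

lemma strip_exists:
  assumes h: "h \<in> walls" "h' \<in> walls" and u: "u1 \<in> walls" "u2 \<in> walls" "u1 \<noteq> u2" "fst u1 = fst u2"
    and cr: "crosses h u1" "crosses h u2" "crosses h' u1" "crosses h' u2"
  obtains U W where "fst U = u1" "strip h U W" "crosses h' (fst W)"
proof -
  let ?t = "fst u1"
  have t: "?t \<in> X" "?t \<noteq> fst h" "?t \<noteq> fst h'"
    using u fst_wall crosses_types[OF h(1) u(1) cr(1)] crosses_types[OF h(2) u(1) cr(3)] by auto
  obtain p where p: "p \<in> border h True" using border_nonempty[OF h(1)] by blast
  have pV: "p \<in> V" by (rule border_closed[OF p])
  define S0 where "S0 = side_word (fst h) True"
  have S0: "period (fst h) True S0" using h by (simp add: period_def S0_def)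
  define c0 where "c0 \<longleftrightarrow> (?t, True) \<in> set S0"
  obtain m1 where m1: "\<And>m. ins (u1, c0) (p \<bullet> word_pow S0 m) \<longleftrightarrow> m1 < m"
    using ins_position[of h "(u1, c0)", OF h(1) _ _ p S0] u cr unfolding c0_def by auto
  obtain m2 where m2: "\<And>m. ins (u2, c0) (p \<bullet> word_pow S0 m) \<longleftrightarrow> m2 < m"
    using ins_position[of h "(u2, c0)", OF h(1) _ _ p S0] u cr unfolding c0_def by auto
  have sep_ne: "m1 \<noteq> m2"
  proof
    assume "m1 = m2"
    then have "u1 \<in> separators (p \<bullet> word_pow S0 m1) (p \<bullet> word_pow S0 m1 \<bullet> S0)"
      "u2 \<in> separators (p \<bullet> word_pow S0 m1) (p \<bullet> word_pow S0 m1 \<bullet> S0)"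
      using separators_ins[of "(u1, c0)"] separators_ins[of "(u2, c0)"] u m1 m2
      unfolding line_steps(3)[OF h(1) p S0, symmetric] fst_conv by simp_all
    then show False using period_separators_unique[OF line_steps(1)[OF h(1) p S0] S0] u by blast
  qed
  obtain S c n1 n2 where S: "period (fst h) True S" and c: "c \<longleftrightarrow> (?t, True) \<in> set S"
    and n1: "\<And>m. ins (u1, c) (p \<bullet> word_pow S m) \<longleftrightarrow> n1 < m"
    and n2: "\<And>m. ins (u2, c) (p \<bullet> word_pow S m) \<longleftrightarrow> n2 < m" and n12: "n1 < n2"
  proof (cases "m1 < m2")
    case True
    then show ?thesis using that[OF S0 c0_def m1 m2] by blast
  next
    case False
    have "(\<not> c0) \<longleftrightarrow> (?t, True) \<in> set (word_inv S0)"
      using period_sign[OF S0 t(1,2)] c0_def by blast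
    \<comment> \<open>Reversing both the direction and the side replaces \<open>m1 < m\<close> by
      the negation of \<open>m1 < - m\<close>, whose threshold is \<open>- m1 - 1\<close>.\<close>
    moreover have "ins (u1, \<not> c0) (p \<bullet> word_pow (word_inv S0) m) \<longleftrightarrow> - m1 - 1 < m"
      "ins (u2, \<not> c0) (p \<bullet> word_pow (word_inv S0) m) \<longleftrightarrow> - m2 - 1 < m" for m
      unfolding ins_not walk_word_pow_inv[OF pV] m1 m2 by linarith+
    ultimately show ?thesis
      using that[OF period_word_inv[OF S0], of "\<not> c0" "- m1 - 1" "- m2 - 1"] False sep_ne by simp
  qed
  define L where "L m = p \<bullet> word_pow S m" for m
  have LV: "L m \<in> V" and Lb: "L m \<in> border h True" and Suc: "L (m + 1) = L m \<bullet> S"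
    and Pred: "L m \<bullet> word_inv S = L (m - 1)" for m
    unfolding L_def by (rule line_steps[OF h(1) p S(1)])+
  note n1 = n1[folded L_def] and n2 = n2[folded L_def]
  obtain k where k: "k \<in> walls" "fst k = ?t" "k \<in> separators (L (n1 + 1)) (L (n1 + 1) \<bullet> S)" "crosses h k"
    using wall_between[OF h(1) Lb S(1) t(1,2), of "n1 + 1"] .
  obtain n where n: "\<And>m. ins (k, c) (L m) \<longleftrightarrow> n < m"
    using ins_position[of h "(k, c)", OF h(1) _ _ p S(1)] k c unfolding L_def by auto
  have "n1 + 1 \<le> n" "n < n1 + 2"
    using k(3) separators_ins[of "(k, c)" "L (n1 + 1)" "L (n1 + 1 + 1)"] k(1)
    unfolding Suc[symmetric] n fst_conv by auto
  then have n_eq: "n = n1 + 1" by simp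
  have "\<not> ins (u1, c) (L (n1 + 0)) \<and> \<not> ins (k, c) (L (n1 + 0))" "ins (u1, c) (L (n1 + 1)) \<and> \<not> ins (k, c) (L (n1 + 1))"
    "ins (u1, c) (L (n1 + 2)) \<and> ins (k, c) (L (n1 + 2))"
    unfolding n1 n n_eq by simp_all
  then have f1: "ins (u1, c) s \<or> ins (k, \<not> c) s" if "s \<in> V" for s
    using LV by (intro facing[OF u(1) k(1) k(2)[symmetric] that]) (auto simp: ins_not)
  have crk: "crosses h' k"
  proof (cases "k = u2")
    case False
    have "n1 + 2 \<le> n2"
    proof (rule ccontr)
      assume "\<not> n1 + 2 \<le> n2"
      then have "n2 = n1 + 1" using n12 by simp
      then have "u2 \<in> separators (L (n1 + 1)) (L (n1 + 1) \<bullet> S)"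
        unfolding Suc[symmetric] separators_ins[of "(u2, c)", unfolded fst_conv, OF u(2)] n2 by simp
      then show False using period_separators_unique[OF LV S(1) k(3)] k(2) u(4) False by simp
    qed
    then have "\<not> ins (k, c) (L (n1 + 1)) \<and> \<not> ins (u2, c) (L (n1 + 1))" "ins (k, c) (L (n1 + 2)) \<and> \<not> ins (u2, c) (L (n1 + 2))"
      "ins (k, c) (L (n2 + 1)) \<and> ins (u2, c) (L (n2 + 1))"
      unfolding n2 n n_eq by simp_all
    then have f2: "ins (k, c) s \<or> ins (u2, \<not> c) s" if "s \<in> V" for s
      using LV k(2) u(4) by (intro facing[OF k(1) u(2) _ that]) (auto simp: ins_not)
    \<comment> \<open>By nestedness \<open>k\<close> separates a border vertex of \<open>h'\<close>
      outside \<open>u1\<close> from one inside \<open>u2\<close>.\<close>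
    obtain t1 where t1: "t1 \<in> border h' True" "\<not> ins (u1, c) t1"
      using crosses_border[OF h(2) u(1) cr(3), of True] unfolding ins_def by (metis fst_conv snd_conv)
    obtain t2 where t2: "t2 \<in> border h' True" "ins (u2, c) t2"
      using crosses_border[OF h(2) u(2) cr(4), of True] unfolding ins_def by (metis fst_conv snd_conv)
    have "\<not> ins (k, c) t1" "ins (k, c) t2"
      using f1[OF border_closed[OF t1(1)]] f2[OF border_closed[OF t2(1)]] t1 t2 by (simp_all add: ins_not)
    then have "k \<in> separators t1 t2" using separators_ins[of "(k, c)" t1 t2] k(1) by simp
    moreover have "h' \<noteq> k" using t(3) k(2) by auto
    ultimately show ?thesis using crosses_if_border[OF h(2) k(1) _ t1(1) t2(1)] by blast
  qed (use cr in simp)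
  have ne: "u1 \<noteq> k" using n1[of n] n[of n] n_eq by auto
  let ?P = "\<lambda>e p S. p \<in> border h e \<and> period (fst h) e S \<and> ins (u1, c) p \<and> ins (k, \<not> c) p
        \<and> \<not> ins (u1, c) (p \<bullet> word_inv S) \<and> \<not> ins (k, \<not> c) (p \<bullet> S)"
  have T: "?P True (L (n1 + 1)) S"
    using Lb S unfolding ins_not Pred Suc[symmetric] n1 n n_eq by simp
  have "\<exists>p S. ?P e p S" for e
  proof (cases e)
    case True
    then have "e = True" by simp
    then show ?thesis using T by blast
  next
    case False
    then have e: "e = (\<not> True)" by simp
    obtain p' S' where F: "p' \<in> border h (\<not> True)" "period (fst h) (\<not> True) S'"
      "\<And>U. fst U \<in> walls \<Longrightarrow> fst U \<noteq> h \<Longrightarrow> (ins U p' \<longleftrightarrow> ins U (L (n1 + 1)))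
      \<and> (ins U (p' \<bullet> S') \<longleftrightarrow> ins U (L (n1 + 1) \<bullet> S)) \<and> (ins U (p' \<bullet> word_inv S') \<longleftrightarrow> ins U (L (n1 + 1) \<bullet> word_inv S))"
      using period_flip[OF h(1) Lb S(1)] by blast
    have "u1 \<noteq> h" "k \<noteq> h" using t(2) k(2) by auto
    then have "?P (\<not> True) p' S'"
      using T F(1,2) F(3)[of "(u1, c)"] F(3)[of "(k, \<not> c)"] u(1) k(1) by simp
    then show ?thesis unfolding e by blast
  qed
  then have "strip h (u1, c) (k, \<not> c)"
    unfolding strip_def fst_conv using u k cr ne f1 by simp
  then show ?thesis using that[of "(u1, c)" "(k, \<not> c)"] crk by simp
qed

text \<open>False for the torus \<open>g = 1\<close>.\<close>

lemma no_grid: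
  assumes u: "u1 \<in> walls" "u2 \<in> walls" "u1 \<noteq> u2" "fst u1 = fst u2"
    and v: "v1 \<in> walls" "v2 \<in> walls" "v1 \<noteq> v2" "fst v1 = fst v2"
    and cr: "crosses u1 v1" "crosses u1 v2" "crosses u2 v1" "crosses u2 v2"
  shows False
proof -
  note cr' = cr[THEN crosses_sym]
  \<comment> \<open>First \<open>u2\<close> is replaced by a neighbour of \<open>u1\<close>, then
    \<open>v2\<close> by a neighbour of \<open>v1\<close>. Each strip transfers to the opposite wall
    of the other pair, and the four walls form a quadrilateral.\<close>
  obtain U W where UW: "fst U = u1" "strip v1 U W" "crosses v2 (fst W)"
    using strip_exists[OF v(1,2) u cr'(1,3,2,4)] .
  have W: "fst W \<in> walls" "fst W \<noteq> u1" "crosses v1 (fst W)" using UW by (auto simp: strip_def)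
  obtain A B where AB: "fst A = v1" "strip u1 A B" "crosses (fst W) (fst B)"
    using strip_exists[OF u(1) W(1) v cr(1,2) crosses_sym[OF W(3)] crosses_sym[OF UW(3)]] .
  have B: "fst B \<in> walls" "crosses u1 (fst B)" using AB by (auto simp: strip_def)
  have "strip (fst B) U W"
    using strip_transfer[OF v(1) B(1) UW(2)] crosses_sym[OF B(2)] crosses_sym[OF AB(3)] UW(1) by simp
  moreover have "strip (fst W) A B"
    using strip_transfer[OF u(1) W(1) AB(2)] AB(1,3) crosses_sym[OF W(3)] by simp
  ultimately have "quad U B W A"
    using UW AB strip_sym unfolding quad_def by simp
  then show False using no_quad by blast
qed

end

section \<open>The action on walls\<close>

definition card_diff :: "'a set \<Rightarrow> 'a set \<Rightarrow> int" where
  "card_diff A B = int (card (A - B)) - int (card (B - A))"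

text \<open>\<open>card_diff\<close> replaces the difference of cardinalities for possibly infinite
  sets with finite differences; additivity follows by splitting each difference by the third
  set.\<close>

lemma card_diff_trans:
  assumes "finite (A - B)" "finite (B - A)" "finite (B - C)" "finite (C - B)"
  shows "card_diff A C = card_diff A B + card_diff B C"
proof -
  have split: "card (S - T) = card (S - T - R) + card (S \<inter> R - T)" if "finite (S - T)" for S T R :: "'a set"
  proof -
    have "S - T = (S - T - R) \<union> (S \<inter> R - T)" by blast
    moreover have "finite (S - T - R)" "finite (S \<inter> R - T)"
      using that by (auto intro: finite_subset[OF _ that])
    moreover have "(S - T - R) \<inter> (S \<inter> R - T) = {}" by blast
    ultimately show ?thesis by (metis card_Un_disjoint)
  qed
  have fin: "finite (A - C)" "finite (C - A)"
    by (rule finite_subset[of _ "(A - B) \<union> (B - C)"], use assms in auto)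
      (rule finite_subset[of _ "(C - B) \<union> (B - A)"], use assms in auto)
  have eqs: "A - C - B = A - B - C" "B - A - C = B - C - A" "C - A - B = C - B - A"
    "C \<inter> A - B = A \<inter> C - B" "C \<inter> B - A = B \<inter> C - A" "B \<inter> A - C = A \<inter> B - C" by blast+
  show ?thesis
    unfolding card_diff_def
    using split[OF assms(1), of C] split[OF assms(2), of C] split[OF assms(3), of A] split[OF assms(4), of A]
      split[OF fin(1), of B] split[OF fin(2), of B] unfolding eqs by linarith
qed

lemma card_diff_self [simp]: "card_diff A A = 0"
  by (simp add: card_diff_def)

lemma card_diff_image: "inj_on f (A \<union> B) \<Longrightarrow> card_diff (f ` A) (f ` B) = card_diff A B"
proof -
  assume inj: "inj_on f (A \<union> B)"
  have "f ` A - f ` B = f ` (A - B)" "f ` B - f ` A = f ` (B - A)"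
    by (rule inj_on_image_set_diff[OF inj, symmetric]; blast)+
  moreover have "card (f ` (A - B)) = card (A - B)" "card (f ` (B - A)) = card (B - A)"
    by (rule card_image[OF inj_on_subset[OF inj]]; blast)+
  ultimately show ?thesis by (simp add: card_diff_def)
qed

section \<open>Left multiplication on walls\<close>

context surface
begin

definition act :: "nat word set \<Rightarrow> nat \<times> nat word set set \<Rightarrow> nat \<times> nat word set set" where
  "act v h = (fst h, (\<lambda>q. v \<otimes>\<^bsub>G\<^esub> q) ` snd h)"

lemma fst_act [simp]: "fst (act v h) = fst h"
  by (simp add: act_def)

lemma coset_mult: "v \<in> V \<Longrightarrow> q \<in> V \<Longrightarrow> coset i (v \<otimes>\<^bsub>G\<^esub> q) = (\<lambda>q. v \<otimes>\<^bsub>G\<^esub> q) ` coset i q"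
proof -
  assume vq: "v \<in> V" "q \<in> V"
  have "v \<otimes>\<^bsub>G\<^esub> q \<otimes>\<^bsub>G\<^esub> side_elt i [^]\<^bsub>G\<^esub> m = v \<otimes>\<^bsub>G\<^esub> (q \<otimes>\<^bsub>G\<^esub> side_elt i [^]\<^bsub>G\<^esub> m)" for m :: int
    using vq by (simp add: m_assoc)
  then show ?thesis unfolding coset_def by (auto simp: image_iff)
qed

lemma wall_of_act: "v \<in> V \<Longrightarrow> p \<in> V \<Longrightarrow> wall_of (v \<otimes>\<^bsub>G\<^esub> p) x = act v (wall_of p x)"
  by (simp add: wall_of_def act_def walk_mult coset_mult)

lemma act_walls [simp]: "v \<in> V \<Longrightarrow> h \<in> walls \<Longrightarrow> act v h \<in> walls"
proof -
  assume v: "v \<in> V" and "h \<in> walls"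
  then obtain i q where h: "h = (i, coset i q)" "i \<in> X" "q \<in> V" by (auto simp: walls_def)
  then have "act v h = (i, coset i (v \<otimes>\<^bsub>G\<^esub> q))" using v by (simp add: act_def coset_mult)
  then show ?thesis using h v unfolding walls_def by blast
qed

lemma act_one: "h \<in> walls \<Longrightarrow> act \<one>\<^bsub>G\<^esub> h = h"
proof -
  assume "h \<in> walls"
  then obtain i q where h: "h = (i, coset i q)" "i \<in> X" "q \<in> V" by (auto simp: walls_def)
  then show ?thesis using coset_mult[of "\<one>\<^bsub>G\<^esub>" q i] by (simp add: act_def)
qed

lemma act_mult: "u \<in> V \<Longrightarrow> v \<in> V \<Longrightarrow> h \<in> walls \<Longrightarrow> act (u \<otimes>\<^bsub>G\<^esub> v) h = act u (act v h)"
proof -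
  assume uv: "u \<in> V" "v \<in> V" and "h \<in> walls"
  then obtain i q where h: "h = (i, coset i q)" "i \<in> X" "q \<in> V" by (auto simp: walls_def)
  then show ?thesis
    using coset_mult[of "u \<otimes>\<^bsub>G\<^esub> v" q i] coset_mult[of u "v \<otimes>\<^bsub>G\<^esub> q" i] coset_mult[of v q i] uv
    by (simp add: act_def m_assoc)
qed

lemma act_inv: "v \<in> V \<Longrightarrow> h \<in> walls \<Longrightarrow> act v (act (inv\<^bsub>G\<^esub> v) h) = h"
  and act_inv': "v \<in> V \<Longrightarrow> h \<in> walls \<Longrightarrow> act (inv\<^bsub>G\<^esub> v) (act v h) = h"
  by (simp_all add: act_one flip: act_mult)

lemma act_inj: "v \<in> V \<Longrightarrow> h \<in> walls \<Longrightarrow> k \<in> walls \<Longrightarrow> act v h = act v k \<longleftrightarrow> h = k"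
  using act_inv' by metis

lemma crossings_act:
  "v \<in> V \<Longrightarrow> p \<in> V \<Longrightarrow> h \<in> walls \<Longrightarrow> w \<in> words X \<Longrightarrow>
    crossings (act v h) (v \<otimes>\<^bsub>G\<^esub> p) w = crossings h p w"
proof (induction w arbitrary: p)
  case (Cons x w)
  then have "fst x \<in> X" "w \<in> words X" by (auto simp: words_iff)
  with Cons show ?case by (simp add: walk_mult wall_of_act act_inj)
qed simp

lemma halfspace_act:
  assumes "v \<in> V" "p \<in> V" "h \<in> walls"
  shows "v \<otimes>\<^bsub>G\<^esub> p \<in> halfspace (act v h) \<longleftrightarrow> p \<in> halfspace h"
proof -
  obtain q where q: "q \<in> border h True" using border_nonempty[OF assms(3)] by blast
  then have qV: "q \<in> V" by (rule border_closed)
  obtain w where w: "w \<in> words X" "p = q \<bullet> w" using walk_ex[OF qV assms(2)] by blast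
  have "v \<otimes>\<^bsub>G\<^esub> q \<in> border (act v h) True"
    using q assms qV by (simp add: border_def wall_of_act)
  then show ?thesis
    using walk_in_halfspace[OF assms(3) q w(1)] walk_in_halfspace[of "act v h" "v \<otimes>\<^bsub>G\<^esub> q" w]
      w assms qV by (simp add: crossings_act walk_mult)
qed

lemma separators_act:
  assumes "v \<in> V" "p \<in> V" "q \<in> V"
  shows "separators (v \<otimes>\<^bsub>G\<^esub> p) (v \<otimes>\<^bsub>G\<^esub> q) = act v ` separators p q"
proof (intro equalityI subsetI)
  fix k assume k: "k \<in> separators (v \<otimes>\<^bsub>G\<^esub> p) (v \<otimes>\<^bsub>G\<^esub> q)"
  let ?h = "act (inv\<^bsub>G\<^esub> v) k"
  have kw: "k \<in> walls" using k by (simp add: separators_def)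
  then have "k = act v ?h" "?h \<in> walls" using assms by (simp_all add: act_inv)
  moreover from this have "?h \<in> separators p q"
    using k halfspace_act[of v p ?h] halfspace_act[of v q ?h] assms by (simp add: separators_def)
  ultimately show "k \<in> act v ` separators p q" by blast
next
  fix k assume "k \<in> act v ` separators p q"
  then obtain h where h: "k = act v h" "h \<in> separators p q" by blast
  then have "h \<in> walls" by (simp add: separators_def)
  then show "k \<in> separators (v \<otimes>\<^bsub>G\<^esub> p) (v \<otimes>\<^bsub>G\<^esub> q)"
    using h assms halfspace_act[of v p h] halfspace_act[of v q h] by (simp add: separators_def)
qed

lemma card_separators_act:
  assumes "v \<in> V" "p \<in> V" "q \<in> V"
  shows "card (separators (v \<otimes>\<^bsub>G\<^esub> p) (v \<otimes>\<^bsub>G\<^esub> q)) = card (separators p q)"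
proof -
  have "inj_on (act v) (separators p q)"
    using assms act_inj by (auto simp: separators_def intro!: inj_onI)
  then show ?thesis by (simp add: separators_act[OF assms] card_image)
qed

text \<open>An edge of \<open>h\<close> changes sides at \<open>h\<close> and at no other
  wall.\<close>

lemma halfspace_inj: "h \<in> walls \<Longrightarrow> k \<in> walls \<Longrightarrow> halfspace h = halfspace k \<Longrightarrow> h = k"
proof (rule ccontr)
  assume hk: "h \<in> walls" "k \<in> walls" "halfspace h = halfspace k" "h \<noteq> k"
  obtain p where p: "p \<in> border h True" using border_nonempty[OF hk(1)] by blast
  have "p \<bullet> [(fst h, False)] \<in> border h False" using border_flip[of p h False] p by simp
  then have "\<not> p \<bullet> [(fst h, \<not> True)] \<in> halfspace h" using border_side[OF hk(1)] by simp
  then show False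
    using border_flip_side[OF hk(1,2,4) p] border_side[OF hk(1) p] hk(3) by simp
qed

lemma ins_act:
  "v \<in> V \<Longrightarrow> p \<in> V \<Longrightarrow> h \<in> walls \<Longrightarrow> ins (act v h, e) (v \<otimes>\<^bsub>G\<^esub> p) \<longleftrightarrow> ins (h, e) p"
  by (simp add: ins_def halfspace_act)

lemma ins_act': 
  "v \<in> V \<Longrightarrow> p \<in> V \<Longrightarrow> h \<in> walls \<Longrightarrow> ins (act v h, e) p \<longleftrightarrow> ins (h, e) (inv\<^bsub>G\<^esub> v \<otimes>\<^bsub>G\<^esub> p)"
  using ins_act[of v "inv\<^bsub>G\<^esub> v \<otimes>\<^bsub>G\<^esub> p" h e] by (simp add: m_assoc[symmetric])

section \<open>Stabilised, peripheral and axial walls\<close>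

definition repelled :: "nat word set \<Rightarrow> nat \<times> nat word set set \<Rightarrow> bool \<Rightarrow> bool" where
  "repelled v h e \<longleftrightarrow> (\<forall>p\<in>V. \<not> (ins (h, e) p \<and> ins (act v h, e) p))"

definition shrunk :: "nat word set \<Rightarrow> nat \<times> nat word set set \<Rightarrow> bool \<Rightarrow> bool" where
  "shrunk v h e \<longleftrightarrow> (\<forall>p\<in>V. ins (act v h, e) p \<longrightarrow> ins (h, e) p)"

definition fixed :: "nat word set \<Rightarrow> (nat \<times> nat word set set) set" where
  "fixed v = {h \<in> walls. act v h = h}"

definition peripheral :: "nat word set \<Rightarrow> (nat \<times> nat word set set) set" where
  "peripheral v = {h \<in> walls. act v h \<noteq> h \<and> (\<exists>e. repelled v h e)}"

definition axial :: "nat word set \<Rightarrow> (nat \<times> nat word set set) set" where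
  "axial v = {h \<in> walls. act v h \<noteq> h \<and> (\<forall>e. \<not> repelled v h e)}"

text \<open>The Boolean \<open>repelled v h True\<close> chooses a repelled side:
  \<open>True\<close> if that side is repelled, otherwise \<open>False\<close>, as justified by
  \<open>repelled_choice\<close>. In \<open>ahead\<close>, \<open>shrunk v h True\<close> likewise
  chooses a shrinking side.\<close>

definition beyond :: "nat word set \<Rightarrow> nat word set \<Rightarrow> (nat \<times> nat word set set) set" where
  "beyond v x = {h \<in> peripheral v. ins (h, repelled v h True) x}"

definition ahead :: "nat word set \<Rightarrow> nat word set \<Rightarrow> (nat \<times> nat word set set) set" where
  "ahead v x = {h \<in> axial v. ins (h, shrunk v h True) x}"

lemma act_commute:
  assumes "u \<in> V" "v \<in> V" "u \<otimes>\<^bsub>G\<^esub> v = v \<otimes>\<^bsub>G\<^esub> u" "h \<in> walls"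
  shows "act v (act u h) = act u (act v h)"
  using act_mult[of u v h] act_mult[of v u h] assms by simp

text \<open>An element commuting with \<open>v\<close> carries the pair \<open>h\<close>,
  \<open>act v h\<close> to the corresponding pair for \<open>act u h\<close>.\<close>

lemma repelled_act:
  assumes uv: "u \<in> V" "v \<in> V" "u \<otimes>\<^bsub>G\<^esub> v = v \<otimes>\<^bsub>G\<^esub> u" "h \<in> walls"
  shows "repelled v (act u h) e \<longleftrightarrow> repelled v h e" and "shrunk v (act u h) e \<longleftrightarrow> shrunk v h e"
proof -
  have all: "(\<forall>p\<in>V. P (inv\<^bsub>G\<^esub> u \<otimes>\<^bsub>G\<^esub> p)) \<longleftrightarrow> (\<forall>p\<in>V. P p)" for P
  proof (intro iffI ballI)
    fix p assume *: "\<forall>p\<in>V. P (inv\<^bsub>G\<^esub> u \<otimes>\<^bsub>G\<^esub> p)" and p: "p \<in> V"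
    have "inv\<^bsub>G\<^esub> u \<otimes>\<^bsub>G\<^esub> (u \<otimes>\<^bsub>G\<^esub> p) = p" using uv p m_assoc[of "inv\<^bsub>G\<^esub> u" u p] by simp
    then show "P p" using bspec[OF *, of "u \<otimes>\<^bsub>G\<^esub> p"] uv p by simp
  qed (use uv in auto)
  have i: "ins (act u k, e) p \<longleftrightarrow> ins (k, e) (inv\<^bsub>G\<^esub> u \<otimes>\<^bsub>G\<^esub> p)" if "k \<in> walls" "p \<in> V" for k p
    using ins_act' uv that by simp
  show "repelled v (act u h) e \<longleftrightarrow> repelled v h e"
    unfolding repelled_def act_commute[OF assms]
    using all[of "\<lambda>p. \<not> (ins (h, e) p \<and> ins (act v h, e) p)"] i uv by simp
  show "shrunk v (act u h) e \<longleftrightarrow> shrunk v h e"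
    unfolding shrunk_def act_commute[OF assms]
    using all[of "\<lambda>p. ins (act v h, e) p \<longrightarrow> ins (h, e) p"] i uv by simp
qed

lemma classes_act:
  assumes "u \<in> V" "v \<in> V" "u \<otimes>\<^bsub>G\<^esub> v = v \<otimes>\<^bsub>G\<^esub> u" "h \<in> walls"
  shows "act u h \<in> peripheral v \<longleftrightarrow> h \<in> peripheral v" "act u h \<in> axial v \<longleftrightarrow> h \<in> axial v"
proof -
  have "repelled v (act u h) = repelled v h" using repelled_act(1)[OF assms] by blast
  then show "act u h \<in> peripheral v \<longleftrightarrow> h \<in> peripheral v" "act u h \<in> axial v \<longleftrightarrow> h \<in> axial v"
    unfolding peripheral_def axial_def
    using assms act_inj[of u "act v h" h] by (simp_all add: act_commute[OF assms])
qed

lemma act_image_iff: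
  assumes "u \<in> V" "A \<subseteq> walls" "B \<subseteq> walls" "\<And>h. h \<in> walls \<Longrightarrow> act u h \<in> B \<longleftrightarrow> h \<in> A"
  shows "B = act u ` A"
proof (intro equalityI subsetI)
  fix k assume k: "k \<in> B"
  let ?h = "act (inv\<^bsub>G\<^esub> u) k"
  have kw: "k \<in> walls" using k assms by blast
  have "k = act u ?h" using act_inv[OF assms(1) kw] by simp
  moreover have "?h \<in> walls" using kw assms(1) by simp
  ultimately show "k \<in> act u ` A" using assms(4)[of ?h] k by (metis imageI)
qed (use assms in auto)

lemma ahead_act:
  assumes "u \<in> V" "v \<in> V" "u \<otimes>\<^bsub>G\<^esub> v = v \<otimes>\<^bsub>G\<^esub> u" "x \<in> V"
  shows "ahead v (u \<otimes>\<^bsub>G\<^esub> x) = act u ` ahead v x"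
proof (rule act_image_iff[OF assms(1)])
  show "act u h \<in> ahead v (u \<otimes>\<^bsub>G\<^esub> x) \<longleftrightarrow> h \<in> ahead v x" if "h \<in> walls" for h
    using assms that unfolding ahead_def
    by (simp add: classes_act(2) repelled_act(2) ins_act)
qed (auto simp: ahead_def axial_def)

lemma repelled_choice:
  "h \<in> peripheral v \<Longrightarrow> repelled v h (repelled v h True)"
  unfolding peripheral_def by (cases "repelled v h True") (auto, metis (full_types))

text \<open>\<open>h\<close> and its image have the same type, so some quadrant is empty; as no side
  is repelled, the empty quadrant mixes opposite sides, which is nesting.\<close>

lemma axial_shrunk:
  assumes v: "v \<in> V" and h: "h \<in> axial v"
  shows "shrunk v h (shrunk v h True)"
proof (cases "shrunk v h True")
  case False
  have hw: "h \<in> walls" using h by (simp add: axial_def)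
  have "\<not> crosses h (act v h)" using crosses_types[OF hw, of "act v h"] v hw by auto
  then obtain a b where ab: "\<And>p. p \<in> V \<Longrightarrow> \<not> (ins (h, a) p \<and> ins (act v h, b) p)"
    unfolding crosses_def ins_def by auto
  have nr: "\<not> repelled v h a" using h by (simp add: axial_def)
  have "a \<noteq> b" using ab nr unfolding repelled_def by blast
  then have b: "b = (\<not> a)" by simp
  have "shrunk v h (\<not> a)" using ab unfolding shrunk_def b ins_not by blast
  then have "\<not> a \<noteq> True" using False by metis
  then show ?thesis using \<open>shrunk v h (\<not> a)\<close> False by simp
qed simp

lemma separators_axial: "separators x y \<inter> axial v = (ahead v x - ahead v y) \<union> (ahead v y - ahead v x)"
  unfolding separators_def ahead_def axial_def ins_def by auto

lemma finite_ahead_diff: "x \<in> V \<Longrightarrow> y \<in> V \<Longrightarrow> finite (ahead v x - ahead v y)"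
  using finite_subset[OF _ finite_separators[of x y]] separators_axial[of x y v] by blast

lemma card_separators_axial:
  assumes "x \<in> V" "y \<in> V"
  shows "card (separators x y \<inter> axial v) = card (ahead v x - ahead v y) + card (ahead v y - ahead v x)"
  unfolding separators_axial
  by (rule card_Un_disjoint) (use finite_ahead_diff assms in auto)

lemma ahead_mono:
  assumes "v \<in> V" "x \<in> V"
  shows "ahead v x \<subseteq> ahead v (v \<otimes>\<^bsub>G\<^esub> x)"
proof
  fix h assume h: "h \<in> ahead v x"
  then have ax: "h \<in> axial v" and hw: "h \<in> walls" and i: "ins (h, shrunk v h True) x"
    by (auto simp: ahead_def axial_def)
  have "ins (act v h, shrunk v h True) (v \<otimes>\<^bsub>G\<^esub> x)" using i ins_act assms hw by simp
  then have "ins (h, shrunk v h True) (v \<otimes>\<^bsub>G\<^esub> x)"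
    using axial_shrunk[OF assms(1) ax] assms unfolding shrunk_def by blast
  then show "h \<in> ahead v (v \<otimes>\<^bsub>G\<^esub> x)" using ax by (simp add: ahead_def)
qed

text \<open>For \<open>h\<close> in \<open>beyond v x\<close> the repelled side contains
  \<open>x\<close>, and its image, disjoint from it, contains the translate of \<open>x\<close>. So
  \<open>h\<close> and \<open>act v h\<close> both separate the two points; the second wall is not
  in \<open>beyond v x\<close>, whence the factor 2.\<close>

lemma card_beyond:
  assumes v: "v \<in> V" and x: "x \<in> V"
  shows "2 * card (beyond v x) \<le> card (separators x (v \<otimes>\<^bsub>G\<^esub> x) \<inter> peripheral v)"
    and "finite (beyond v x)"
proof -
  let ?S = "separators x (v \<otimes>\<^bsub>G\<^esub> x) \<inter> peripheral v"
  have fin: "finite ?S" using finite_separators[of x "v \<otimes>\<^bsub>G\<^esub> x"] v x by simp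
  have rep: "\<not> (ins (h, repelled v h True) p \<and> ins (act v h, repelled v h True) p)"
    if "h \<in> peripheral v" "p \<in> V" for h p
    using repelled_choice[OF that(1)] that(2) unfolding repelled_def by blast
  have sub: "h \<in> ?S \<and> act v h \<in> ?S" if "h \<in> beyond v x" for h
  proof -
    have h: "h \<in> peripheral v" "h \<in> walls" "ins (h, repelled v h True) x"
      using that by (auto simp: beyond_def peripheral_def)
    have 1: "ins (act v h, repelled v h True) (v \<otimes>\<^bsub>G\<^esub> x)" using h v x ins_act by simp
    have 2: "\<not> ins (act v h, repelled v h True) x" using rep[OF h(1) x] h(3) by blast
    have 3: "\<not> ins (h, repelled v h True) (v \<otimes>\<^bsub>G\<^esub> x)" using rep[OF h(1), of "v \<otimes>\<^bsub>G\<^esub> x"] 1 v x by simp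
    show ?thesis
      using 1 2 3 h v classes_act(1)[OF v v _ h(2)]
        separators_ins[of "(h, repelled v h True)"] separators_ins[of "(act v h, repelled v h True)"]
      by simp
  qed
  then have "beyond v x \<union> act v ` beyond v x \<subseteq> ?S" by blast
  moreover have "beyond v x \<inter> act v ` beyond v x = {}"
  proof -
    have "act v h \<notin> beyond v x" if "h \<in> beyond v x" for h
      using that rep[of h x] x repelled_act(1)[OF v v _, of h] by (auto simp: beyond_def peripheral_def)
    then show ?thesis by blast
  qed
  moreover show fb: "finite (beyond v x)" using sub by (intro finite_subset[OF _ fin]) blast
  moreover have "card (act v ` beyond v x) = card (beyond v x)"
    using act_inj[OF v] by (intro card_image inj_onI) (auto simp: beyond_def peripheral_def)
  ultimately show "2 * card (beyond v x) \<le> card ?S"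
    using card_mono[OF fin, of "beyond v x \<union> act v ` beyond v x"] card_Un_disjoint[of "beyond v x" "act v ` beyond v x"]
    by simp
qed

lemma separators_peripheral: "separators x y \<inter> peripheral v \<subseteq> beyond v x \<union> beyond v y"
  unfolding separators_def beyond_def ins_def by auto

section \<open>Orbits of axial walls\<close>

abbreviation vpow :: "nat word set \<Rightarrow> int \<Rightarrow> nat word set" where
  "vpow v n \<equiv> v [^]\<^bsub>G\<^esub> n"

lemma vpow_commute: "v \<in> V \<Longrightarrow> vpow v n \<otimes>\<^bsub>G\<^esub> v = v \<otimes>\<^bsub>G\<^esub> vpow v n"
  using int_pow_mult[of v n 1] int_pow_mult[of v 1 n] by (simp add: add.commute)

lemma vpow_Suc_walk: "v \<in> V \<Longrightarrow> z \<in> V \<Longrightarrow> vpow v (n + 1) \<otimes>\<^bsub>G\<^esub> z = v \<otimes>\<^bsub>G\<^esub> (vpow v n \<otimes>\<^bsub>G\<^esub> z)"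
  using vpow_commute[of v n] int_pow_mult[of v n 1] by (simp add: m_assoc[symmetric])

lemma act_vpow_cancel:
  assumes "v \<in> V" "h \<in> walls"
  shows "act (vpow v (- a)) (act (vpow v a) h) = h"
proof -
  have "vpow v (- a) \<otimes>\<^bsub>G\<^esub> vpow v a = \<one>\<^bsub>G\<^esub>"
    using int_pow_mult[OF assms(1), of "- a" a] by simp
  then show ?thesis using act_mult[of "vpow v (- a)" "vpow v a" h] assms act_one[OF assms(2)] by simp
qed

lemma ahead_pow_mono:
  assumes v: "v \<in> V" and z: "z \<in> V"
  shows "m \<le> n \<Longrightarrow> ahead v (vpow v m \<otimes>\<^bsub>G\<^esub> z) \<subseteq> ahead v (vpow v n \<otimes>\<^bsub>G\<^esub> z)"
proof (induction n rule: int_ge_induct)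
  case (step n)
  have "ahead v (vpow v n \<otimes>\<^bsub>G\<^esub> z) \<subseteq> ahead v (vpow v (n + 1) \<otimes>\<^bsub>G\<^esub> z)"
    unfolding vpow_Suc_walk[OF v z] using v z by (intro ahead_mono) auto
  with step show ?case by blast
qed simp

text \<open>Sides shrink along the orbit, so a return to \<open>h\<close> would force
  \<open>h\<close> and \<open>act v h\<close> to have the same half-space.\<close>

lemma axial_orbit_inj:
  assumes v: "v \<in> V" and h: "h \<in> axial v"
  shows "inj (\<lambda>n. act (vpow v n) h)"
proof -
  have hw: "h \<in> walls" and ne: "act v h \<noteq> h" using h by (simp_all add: axial_def)
  define s where "s = shrunk v h True"
  have sh: "shrunk v h s" unfolding s_def by (rule axial_shrunk[OF v h])
  have orb: "act (vpow v (n + 1)) h = act v (act (vpow v n) h)" for n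
    using int_pow_mult[of v n 1] vpow_commute[OF v, of n] act_mult[of v "vpow v n" h] v hw by simp
  have step: "ins (act (vpow v n) h, s) p" if "ins (act (vpow v (n + 1)) h, s) p" "p \<in> V" for n p
  proof -
    have "shrunk v (act (vpow v n) h) s"
      using repelled_act(2)[of "vpow v n" v h s] vpow_commute[OF v] v hw sh by simp
    then show ?thesis using that unfolding shrunk_def orb by blast
  qed
  have chain: "ins (act (vpow v (int n + 1)) h, s) p \<Longrightarrow> p \<in> V \<Longrightarrow> ins (act (vpow v 1) h, s) p" for n p
  proof (induction n)
    case (Suc n)
    then show ?case using step[of "int n + 1" p] by (simp add: algebra_simps)
  qed simp
  have no_return: "act (vpow v (int n + 1)) h \<noteq> h" for n
  proof
    assume eq: "act (vpow v (int n + 1)) h = h"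
    have "ins (h, s) p \<longleftrightarrow> ins (act v h, s) p" if "p \<in> V" for p
      using chain[of n p] that sh eq v unfolding shrunk_def by auto
    then have "p \<in> halfspace h \<longleftrightarrow> p \<in> halfspace (act v h)" if "p \<in> V" for p
      using that unfolding ins_def by auto
    moreover have "halfspace h \<subseteq> V" "halfspace (act v h) \<subseteq> V" by (auto simp: halfspace_def)
    ultimately have "halfspace h = halfspace (act v h)" by blast
    then show False using halfspace_inj[OF hw act_walls[OF v hw]] ne by simp
  qed
  have lt: "act (vpow v a) h \<noteq> act (vpow v b) h" if "a < b" for a b
  proof
    assume eq: "act (vpow v a) h = act (vpow v b) h"
    have "act (vpow v (b - a)) h = act (vpow v (- a)) (act (vpow v b) h)"
      using act_mult[of "vpow v (- a)" "vpow v b" h] int_pow_mult[of v "- a" b] v hw by simp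
    also have "\<dots> = h"
      unfolding eq[symmetric] by (rule act_vpow_cancel[OF v hw])
    finally show False using no_return[of "nat (b - a - 1)"] that by simp
  qed
  show ?thesis
  proof (rule injI)
    fix a b assume "act (vpow v a) h = act (vpow v b) h"
    then show "a = b" using lt[of a b] lt[of b a] by (cases a b rule: linorder_cases) auto
  qed
qed

text \<open>Translating back by the powers would produce infinitely many distinct walls separating
  \<open>z\<close> and \<open>z'\<close>.\<close>

lemma axial_finitely_separated:
  assumes v: "v \<in> V" and h: "h \<in> axial v" and z: "z \<in> V" "z' \<in> V"
    and f: "inj f" and sep: "\<And>n::nat. h \<in> separators (vpow v (f n) \<otimes>\<^bsub>G\<^esub> z) (vpow v (f n) \<otimes>\<^bsub>G\<^esub> z')"
  shows False
proof -
  have hw: "h \<in> walls" using h by (simp add: axial_def)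
  have "act (vpow v (- f n)) h \<in> separators z z'" for n
  proof -
    obtain k where k: "h = act (vpow v (f n)) k" "k \<in> separators z z'"
      using sep[of n] separators_act[of "vpow v (f n)" z z'] v z by auto
    then have "k \<in> walls" by (simp add: separators_def)
    then have "act (vpow v (- f n)) h = k"
      unfolding k(1) by (rule act_vpow_cancel[OF v])
    then show ?thesis using k(2) by simp
  qed
  then have "range (\<lambda>n. act (vpow v (- f n)) h) \<subseteq> separators z z'" by blast
  moreover have "inj (\<lambda>n. act (vpow v (- f n)) h)"
  proof (rule injI)
    fix a b assume "act (vpow v (- f a)) h = act (vpow v (- f b)) h"
    then have "- f a = - f b" using injD[OF axial_orbit_inj[OF v h]] by blast
    then show "a = b" using injD[OF f] by simp
  qed
  ultimately have "finite (UNIV :: nat set)"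
    by (intro finite_imageD[OF finite_subset[OF _ finite_separators[OF z]]])
  then show False by simp
qed

text \<open>A border vertex on the desired side remains there under all powers in the given
  direction. If the orbit of \<open>z\<close> never came to that side, \<open>h\<close> would
  separate infinitely many pairs of corresponding points.\<close>

lemma axial_limits:
  assumes v: "v \<in> V" and h: "h \<in> axial v" and z: "z \<in> V"
  shows "\<exists>n. h \<in> ahead v (vpow v (int n) \<otimes>\<^bsub>G\<^esub> z)"
    and "\<exists>m. h \<notin> ahead v (vpow v (- int m) \<otimes>\<^bsub>G\<^esub> z)"
proof -
  have hw: "h \<in> walls" using h by (simp add: axial_def)
  define s where "s = shrunk v h True"
  have ah: "h \<in> ahead v p \<longleftrightarrow> ins (h, s) p" for p using h by (simp add: ahead_def s_def)
  have sep: "h \<in> separators p q" if "h \<in> ahead v p \<longleftrightarrow> h \<notin> ahead v q" for p q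
    using that separators_ins[of "(h, s)" p q] hw unfolding ah by simp
  obtain z1 where z1: "z1 \<in> border h s" using border_nonempty[OF hw] by blast
  obtain z0 where z0: "z0 \<in> border h (\<not> s)" using border_nonempty[OF hw] by blast
  have V: "z1 \<in> V" "z0 \<in> V" using border_closed z1 z0 by blast+
  have a: "h \<in> ahead v z1" "h \<notin> ahead v z0"
    unfolding ah using border_side[OF hw z1] border_side[OF hw z0] by (simp_all add: ins_def)
  show "\<exists>n. h \<in> ahead v (vpow v (int n) \<otimes>\<^bsub>G\<^esub> z)"
  proof (rule ccontr)
    assume c: "\<not> ?thesis"
    have "h \<in> ahead v (vpow v (int n) \<otimes>\<^bsub>G\<^esub> z1)" for n
      using ahead_pow_mono[OF v V(1), of 0 "int n"] a V by auto
    then have "h \<in> separators (vpow v (int n) \<otimes>\<^bsub>G\<^esub> z) (vpow v (int n) \<otimes>\<^bsub>G\<^esub> z1)" for n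
      using c by (intro sep) blast
    then show False using axial_finitely_separated[OF v h z V(1), of int] by (simp add: inj_on_def)
  qed
  show "\<exists>m. h \<notin> ahead v (vpow v (- int m) \<otimes>\<^bsub>G\<^esub> z)"
  proof (rule ccontr)
    assume c: "\<not> ?thesis"
    have "h \<notin> ahead v (vpow v (- int n) \<otimes>\<^bsub>G\<^esub> z0)" for n
      using ahead_pow_mono[OF v V(2), of "- int n" 0] a V by auto
    then have "h \<in> separators (vpow v (- int n) \<otimes>\<^bsub>G\<^esub> z) (vpow v (- int n) \<otimes>\<^bsub>G\<^esub> z0)" for n
      using c by (intro sep) blast
    then show False using axial_finitely_separated[OF v h z V(2), of "\<lambda>n. - int n"] by (simp add: inj_on_def)
  qed
qed

text \<open>\<open>x\<close> and \<open>y\<close> occupy the two mixed quadrants; far translates of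
  \<open>x\<close>, forwards and backwards, occupy the other two.\<close>

lemma ahead_crosses:
  assumes v: "v \<in> V" and x: "x \<in> V" and y: "y \<in> V"
    and h: "h \<in> ahead v x - ahead v y" and k: "k \<in> ahead v y - ahead v x"
  shows "crosses h k"
proof -
  have ax: "h \<in> axial v" "k \<in> axial v" using h k by (auto simp: ahead_def)
  have iff: "l \<in> ahead v p \<longleftrightarrow> (p \<in> halfspace l \<longleftrightarrow> shrunk v l True)" if "l \<in> axial v" for l p
    using that by (simp add: ahead_def ins_def)
  obtain n1 :: nat and m1 :: nat where 1: "h \<in> ahead v (vpow v (int n1) \<otimes>\<^bsub>G\<^esub> x)" "h \<notin> ahead v (vpow v (- int m1) \<otimes>\<^bsub>G\<^esub> x)"
    using axial_limits[OF v ax(1) x] by blast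
  obtain n2 :: nat and m2 :: nat where 2: "k \<in> ahead v (vpow v (int n2) \<otimes>\<^bsub>G\<^esub> x)" "k \<notin> ahead v (vpow v (- int m2) \<otimes>\<^bsub>G\<^esub> x)"
    using axial_limits[OF v ax(2) x] by blast
  let ?n = "int (max n1 n2)" and ?m = "- int (max m1 m2)"
  have "h \<in> ahead v (vpow v ?n \<otimes>\<^bsub>G\<^esub> x)" "k \<in> ahead v (vpow v ?n \<otimes>\<^bsub>G\<^esub> x)"
    "h \<notin> ahead v (vpow v ?m \<otimes>\<^bsub>G\<^esub> x)" "k \<notin> ahead v (vpow v ?m \<otimes>\<^bsub>G\<^esub> x)"
    using 1 2 ahead_pow_mono[OF v x, of "int n1" ?n] ahead_pow_mono[OF v x, of "int n2" ?n]
      ahead_pow_mono[OF v x, of ?m "- int m1"] ahead_pow_mono[OF v x, of ?m "- int m2"] by auto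
  moreover have "vpow v ?n \<otimes>\<^bsub>G\<^esub> x \<in> V" "vpow v ?m \<otimes>\<^bsub>G\<^esub> x \<in> V" using v x by simp_all
  ultimately have "\<exists>p\<in>V. (h \<in> ahead v p \<longleftrightarrow> a) \<and> (k \<in> ahead v p \<longleftrightarrow> b)" for a b
    using h k x y by (cases a; cases b) blast+
  note * = this[unfolded iff[OF ax(1)] iff[OF ax(2)]]
  show ?thesis
    unfolding crosses_def
  proof (intro allI)
    fix a b
    show "\<exists>p\<in>V. (p \<in> halfspace h \<longleftrightarrow> a) \<and> (p \<in> halfspace k \<longleftrightarrow> b)"
      using *[of "a \<longleftrightarrow> shrunk v h True" "b \<longleftrightarrow> shrunk v k True"] by blast
  qed
qed

lemma same_type_pair:
  assumes "A \<subseteq> walls" "2 * g < card A"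
  obtains h k where "h \<in> A" "k \<in> A" "h \<noteq> k" "fst h = fst k"
proof -
  have "fst ` A \<subseteq> X" using assms(1) fst_wall by blast
  then have "card (fst ` A) \<le> 2 * g" using card_mono[of X "fst ` A"] by (simp add: X_def)
  then have "\<not> inj_on fst A" using assms(2) by (intro pigeonhole) simp
  then show ?thesis using that by (auto simp: inj_on_def)
qed

text \<open>If both families outnumbered the types, each would contain two walls of one type, and by
  \<open>ahead_crosses\<close> these would form a grid.\<close>

lemma ahead_diff_bound:
  assumes v: "v \<in> V" and x: "x \<in> V" and y: "y \<in> V" and c: "2 * g < card (ahead v x - ahead v y)"
  shows "card (ahead v y - ahead v x) \<le> 2 * g"
proof (rule ccontr)
  assume c': "\<not> ?thesis"
  have w: "ahead v p \<subseteq> walls" for p by (auto simp: ahead_def axial_def)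
  obtain h1 h2 where h: "h1 \<in> ahead v x - ahead v y" "h2 \<in> ahead v x - ahead v y" "h1 \<noteq> h2" "fst h1 = fst h2"
    using same_type_pair[OF _ c] w by blast
  obtain k1 k2 where k: "k1 \<in> ahead v y - ahead v x" "k2 \<in> ahead v y - ahead v x" "k1 \<noteq> k2" "fst k1 = fst k2"
  proof -
    have "ahead v y - ahead v x \<subseteq> walls" using w by blast
    moreover have "2 * g < card (ahead v y - ahead v x)" using c' by simp
    ultimately show thesis using same_type_pair that by blast
  qed
  have ww: "h1 \<in> walls" "h2 \<in> walls" "k1 \<in> walls" "k2 \<in> walls" using h k w by blast+
  show False
    by (rule no_grid[OF ww(1,2) h(3,4) ww(3,4) k(3,4)]) (intro ahead_crosses[OF v x y] h k)+
qed

section \<open>The translation number on axial walls\<close>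

definition shift :: "nat word set \<Rightarrow> nat word set \<Rightarrow> nat" where
  "shift v x = card (ahead v (v \<otimes>\<^bsub>G\<^esub> x) - ahead v x)"

text \<open>The height of \<open>x\<close> relative to \<open>y\<close>, measured in axial walls. It
  is additive, and applying \<open>v\<close> to \<open>y\<close> lowers it by
  \<open>shift\<close>.\<close>

abbreviation index :: "nat word set \<Rightarrow> nat word set \<Rightarrow> nat word set \<Rightarrow> int" where
  "index v x y \<equiv> card_diff (ahead v x) (ahead v y)"

lemma index_trans:
  "x \<in> V \<Longrightarrow> y \<in> V \<Longrightarrow> z \<in> V \<Longrightarrow> index v x z = index v x y + index v y z"
  by (intro card_diff_trans finite_ahead_diff)

lemma index_act: "v \<in> V \<Longrightarrow> x \<in> V \<Longrightarrow> y \<in> V \<Longrightarrow> index v (v \<otimes>\<^bsub>G\<^esub> x) (v \<otimes>\<^bsub>G\<^esub> y) = index v x y"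
proof -
  assume vxy: "v \<in> V" "x \<in> V" "y \<in> V"
  have "ahead v x \<union> ahead v y \<subseteq> walls" by (auto simp: ahead_def axial_def)
  then have "inj_on (act v) (ahead v x \<union> ahead v y)"
    by (intro inj_onI) (use act_inj[OF vxy(1)] in blast)
  then show ?thesis
    using card_diff_image ahead_act[OF vxy(1) vxy(1)] vxy by simp
qed

lemma index_shift: "v \<in> V \<Longrightarrow> x \<in> V \<Longrightarrow> index v x (v \<otimes>\<^bsub>G\<^esub> x) = - int (shift v x)"
proof -
  assume "v \<in> V" "x \<in> V"
  then have "ahead v x - ahead v (v \<otimes>\<^bsub>G\<^esub> x) = {}" using ahead_mono by blast
  then have "card (ahead v x - ahead v (v \<otimes>\<^bsub>G\<^esub> x)) = 0" by (simp only: card.empty)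
  then show ?thesis by (simp only: card_diff_def shift_def of_nat_0 diff_0)
qed

lemma shift_const:
  assumes v: "v \<in> V" and x: "x \<in> V" and y: "y \<in> V"
  shows "shift v x = shift v y"
proof -
  have V: "v \<otimes>\<^bsub>G\<^esub> x \<in> V" "v \<otimes>\<^bsub>G\<^esub> y \<in> V" using assms by simp_all
  have "index v x (v \<otimes>\<^bsub>G\<^esub> x) = index v x y + index v y (v \<otimes>\<^bsub>G\<^esub> y) + index v y x"
    using index_trans[OF x y V(1), of v] index_trans[OF y V(2) V(1), of v] index_act[OF v y x] by simp
  moreover have "index v x y + index v y x = 0" using index_trans[OF x y x, of v] by simp
  ultimately show ?thesis using index_shift[OF v x] index_shift[OF v y] by simp
qed

lemma index_vpow:
  assumes v: "v \<in> V" and x: "x \<in> V" and y: "y \<in> V"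
  shows "index v x (vpow v n \<otimes>\<^bsub>G\<^esub> y) = index v x y - n * int (shift v x)"
proof -
  have step: "index v x (vpow v (n + 1) \<otimes>\<^bsub>G\<^esub> y) = index v x (vpow v n \<otimes>\<^bsub>G\<^esub> y) - int (shift v x)" for n
  proof -
    let ?z = "vpow v n \<otimes>\<^bsub>G\<^esub> y"
    have z: "?z \<in> V" "v \<otimes>\<^bsub>G\<^esub> ?z \<in> V" using v y by simp_all
    show ?thesis
      unfolding vpow_Suc_walk[OF v y] index_trans[OF x z] index_shift[OF v z(1)] shift_const[OF v z(1) x]
      by simp
  qed
  show ?thesis
  proof (induction n rule: int_induct[where k = 0])
    case base
    then show ?case using y by simp
  next
    case (step1 i)
    then show ?case using step[of i] by (simp add: algebra_simps)
  next
    case (step2 i)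
    then show ?case using step[of "i - 1"] by (simp add: algebra_simps)
  qed
qed

text \<open>With zero shift the nested sets \<open>ahead\<close> along an orbit would all coincide,
  whereas every axial wall is passed by the orbit.\<close>

lemma axial_empty:
  assumes v: "v \<in> V" and x: "x \<in> V" and "shift v x = 0"
  shows "axial v = {}"
proof (rule ccontr)
  assume "axial v \<noteq> {}"
  then obtain h where h: "h \<in> axial v" by blast
  obtain m where m: "h \<notin> ahead v (vpow v (- int m) \<otimes>\<^bsub>G\<^esub> x)" using axial_limits(2)[OF v h x] by blast
  define z where "z = vpow v (- int m) \<otimes>\<^bsub>G\<^esub> x"
  have z: "z \<in> V" using v x by (simp add: z_def)
  obtain n where n: "h \<in> ahead v (vpow v (int n) \<otimes>\<^bsub>G\<^esub> z)" using axial_limits(1)[OF v h z] by blast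
  let ?y = "vpow v (int n) \<otimes>\<^bsub>G\<^esub> z"
  have "index v z ?y = 0"
    using index_vpow[OF v z z, of "int n"] shift_const[OF v z x] assms(3) by simp
  moreover have "ahead v z - ahead v ?y = {}"
    using ahead_pow_mono[OF v z, of 0 "int n"] z by simp
  then have "card (ahead v z - ahead v ?y) = 0" by (simp only: card.empty)
  ultimately have "card (ahead v ?y - ahead v z) = 0" by (simp add: card_diff_def)
  then have "ahead v ?y - ahead v z = {}" using finite_ahead_diff[of ?y z v] v z by simp
  with n m show False by (auto simp: z_def)
qed

lemma axial_close:
  assumes v: "v \<in> V" and x: "x \<in> V" and y: "y \<in> V"
  shows "\<exists>n. card (separators x (vpow v n \<otimes>\<^bsub>G\<^esub> y) \<inter> axial v) \<le> shift v x + 4 * g"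
proof (cases "shift v x = 0")
  case True
  then show ?thesis using axial_empty[OF v x] by simp
next
  case False
  \<comment> \<open>Division with remainder brings the index into \<open>{0..<shift v x}\<close>, so
    the two families differ in size by less than the shift.\<close>
  define n where "n = index v x y div int (shift v x)"
  let ?z = "vpow v n \<otimes>\<^bsub>G\<^esub> y"
  have z: "?z \<in> V" using v y by simp
  have "index v x ?z = index v x y mod int (shift v x)"
    unfolding index_vpow[OF v x y] n_def by (simp add: minus_div_mult_eq_mod)
  then have "0 \<le> index v x ?z" "index v x ?z < int (shift v x)" using False by simp_all
  then have "card (ahead v ?z - ahead v x) \<le> card (ahead v x - ahead v ?z)"
    "card (ahead v x - ahead v ?z) < shift v x + card (ahead v ?z - ahead v x)"
    unfolding card_diff_def by linarith+
  \<comment> \<open>If the smaller family had more than \<open>2 * g\<close> members, so would the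
    larger one, against \<open>ahead_diff_bound\<close>; the total is then below the shift plus
    twice \<open>2 * g\<close>.\<close>
  moreover from this have "card (ahead v ?z - ahead v x) \<le> 2 * g"
    using ahead_diff_bound[OF v x z] by linarith
  ultimately show ?thesis
    using card_separators_axial[OF x z, of v] by (intro exI[of _ n]) linarith
qed

section \<open>Walls stabilised by an element\<close>

lemma border_act: "v \<in> V \<Longrightarrow> p \<in> border h e \<Longrightarrow> v \<otimes>\<^bsub>G\<^esub> p \<in> border (act v h) e"
  by (auto simp: border_def wall_of_act)

lemma act_vpow_fixed:
  assumes v: "v \<in> V" and h: "h \<in> walls" "act v h = h"
  shows "act (vpow v n) h = h"
proof -
  have nat: "act (vpow v (int k)) h = h" for k
  proof (induction k)
    case (Suc k)
    have "vpow v (int (Suc k)) = vpow v (int k) \<otimes>\<^bsub>G\<^esub> v"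
      using int_pow_mult[OF v, of "int k" 1] v by (simp add: add.commute)
    then show ?case using act_mult[of "vpow v (int k)" v h] v h Suc by simp
  qed (simp add: act_one h)
  show ?thesis
  proof (cases "0 \<le> n")
    case True
    then show ?thesis using nat[of "nat n"] by simp
  next
    case False
    then have "act (vpow v (- n)) h = h" using nat[of "nat (- n)"] by simp
    then show ?thesis using act_vpow_cancel[OF v h(1), of "- n"] by simp
  qed
qed

text \<open>An element stabilising a wall translates along it, so the walls crossing that wall are axial;
  they then cross every other stabilised wall too.\<close>

lemma fixed_inj:
  assumes v: "v \<in> V" "v \<noteq> \<one>\<^bsub>G\<^esub>"
  shows "inj_on fst (fixed v)"
proof (rule inj_onI, rule ccontr)
  fix h h' assume "h \<in> fixed v" "h' \<in> fixed v" and ty: "fst h = fst h'" and ne: "h \<noteq> h'"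
  then have h: "h \<in> walls" "act v h = h" and h': "h' \<in> walls" "act v h' = h'"
    by (simp_all add: fixed_def)
  define S where "S = side_word (fst h) True"
  have S: "period (fst h) True S" using h by (simp add: period_def S_def)
  obtain q where q: "q \<in> border h True" using border_nonempty[OF h(1)] by blast
  have qV: "q \<in> V" by (rule border_closed[OF q])
  have "v \<otimes>\<^bsub>G\<^esub> q \<in> border h True" using border_act[OF v(1) q] h by simp
  then obtain m where m: "v \<otimes>\<^bsub>G\<^esub> q = q \<bullet> word_pow S m" using border_period[OF h(1) q S] by blast
  \<comment> \<open>On the border \<open>v\<close> moves \<open>q\<close> by \<open>m\<close>
    periods, and it does move it because \<open>v\<close> is not the identity.\<close>
  have m0: "m \<noteq> 0"
  proof
    assume "m = 0"
    then have "v \<otimes>\<^bsub>G\<^esub> q = \<one>\<^bsub>G\<^esub> \<otimes>\<^bsub>G\<^esub> q" using m qV by simp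
    then show False using v qV right_cancel[of q v "\<one>\<^bsub>G\<^esub>"] by simp
  qed
  have ax: "k \<in> axial v" if k: "k \<in> walls" "crosses h k" for k
  proof -
    define c where "c \<longleftrightarrow> (fst k, True) \<in> set S"
    obtain n0 where n0: "\<And>t. ins (k, c) (q \<bullet> word_pow S t) \<longleftrightarrow> n0 < t"
      using ins_position[of h "(k, c)", OF h(1) _ _ q S] k unfolding c_def by auto
    have n1: "ins (act v k, c) (q \<bullet> word_pow S t) \<longleftrightarrow> n0 < t - m" for t
    proof -
      have "v \<otimes>\<^bsub>G\<^esub> (q \<bullet> word_pow S (t - m)) = q \<bullet> word_pow S t"
        using walk_mult[OF v(1) qV, of "word_pow S (t - m)"] walk_word_pow_add[OF qV, of S m "t - m"]
        unfolding m by simp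
      then show ?thesis using ins_act[of v "q \<bullet> word_pow S (t - m)" k c] v qV k(1) n0 by simp
    qed
    have "act v k \<noteq> k"
    proof
      assume "act v k = k"
      then have "n0 < t \<longleftrightarrow> n0 < t - m" for t using n0 n1 by simp
      from this[of "n0 + 1"] this[of "n0 + 1 + m"] show False using m0 by linarith
    qed
    moreover have "\<not> repelled v k e" for e
    proof -
      \<comment> \<open>Far enough along the border a vertex lies on side \<open>e\<close> of both
        \<open>k\<close> and its translate.\<close>
      define t where "t = (if e = c then \<bar>n0\<bar> + \<bar>m\<bar> + 1 else - \<bar>n0\<bar> - \<bar>m\<bar>)"
      have "ins (k, e) (q \<bullet> word_pow S t) \<and> ins (act v k, e) (q \<bullet> word_pow S t)"
      proof (cases "e = c")
        case True
        have "n0 < t" "n0 < t - m" unfolding t_def using True by auto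
        then show ?thesis unfolding True n0 n1 by simp
      next
        case False
        then have "e = (\<not> c)" by simp
        moreover have "\<not> n0 < t" "\<not> n0 < t - m" unfolding t_def using False by auto
        ultimately show ?thesis by (simp add: ins_not n0 n1)
      qed
      then show ?thesis unfolding repelled_def using qV by (metis walk_closed)
    qed
    ultimately show ?thesis using k(1) by (simp add: axial_def)
  qed
  obtain q' where q': "q' \<in> border h' True" using border_nonempty[OF h'(1)] by blast
  have q'V: "q' \<in> V" by (rule border_closed[OF q'])
  have orbit: "vpow v n \<otimes>\<^bsub>G\<^esub> q' \<in> border h' True" for n
    using border_act[OF _ q', of "vpow v n"] act_vpow_fixed[OF v(1) h'] v by simp
  have cross: "crosses h' k" if k: "k \<in> walls" "crosses h k" for k
  proof -
    \<comment> \<open>The orbit of \<open>q'\<close> stays on the border of \<open>h'\<close> and,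
      as \<open>k\<close> is axial, passes from one side of \<open>k\<close> to the other.\<close>
    note a = ax[OF k]
    obtain n where n: "k \<in> ahead v (vpow v (int n) \<otimes>\<^bsub>G\<^esub> q')" using axial_limits(1)[OF v(1) a q'V] by blast
    obtain n' where n': "k \<notin> ahead v (vpow v (- int n') \<otimes>\<^bsub>G\<^esub> q')" using axial_limits(2)[OF v(1) a q'V] by blast
    have "k \<in> separators (vpow v (int n) \<otimes>\<^bsub>G\<^esub> q') (vpow v (- int n') \<otimes>\<^bsub>G\<^esub> q')"
      using n n' a k(1) unfolding ahead_def separators_def ins_def by auto
    moreover have "h' \<noteq> k" using crosses_types[OF h(1) k] ty by auto
    ultimately show ?thesis using crosses_if_border[OF h'(1) k(1) _ orbit orbit] by blast
  qed
  \<comment> \<open>Two consecutive periods supply two distinct walls of any one type other than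
    that of \<open>h\<close>; with \<open>h\<close> and \<open>h'\<close> they form the forbidden
    grid.\<close>
  define j where "j = (if fst h = 1 then 2 else (1 :: nat))"
  have j: "j \<in> X" "j \<noteq> fst h" using genus by (auto simp: j_def X_def)
  have qS: "q \<bullet> S \<in> border h True"
    using line_steps(2)[OF h(1) q S, of 1] by simp
  obtain k1 where k1: "k1 \<in> walls" "fst k1 = j" "k1 \<in> separators q (q \<bullet> S)" "crosses h k1"
    using wall_between[OF h(1) q S j] .
  obtain k2 where k2: "k2 \<in> walls" "fst k2 = j" "k2 \<in> separators (q \<bullet> S) (q \<bullet> S \<bullet> S)" "crosses h k2"
    using wall_between[OF h(1) qS S j] .
  have "k1 \<noteq> k2"
  proof
    assume eq: "k1 = k2"
    define c where "c \<longleftrightarrow> (fst k1, True) \<in> set S"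
    obtain n where n: "\<And>t. ins (k1, c) (q \<bullet> word_pow S t) \<longleftrightarrow> n < t"
      using ins_position[of h "(k1, c)", OF h(1) _ _ q S] k1 unfolding c_def by auto
    have two: "q \<bullet> word_pow S 2 = q \<bullet> S \<bullet> S" using walk_word_pow_add[OF qV, of S 1 1] by simp
    have "ins (k1, c) q \<longleftrightarrow> n < 0" "ins (k1, c) (q \<bullet> S) \<longleftrightarrow> n < 1" "ins (k1, c) (q \<bullet> S \<bullet> S) \<longleftrightarrow> n < 2"
      using n[of 0] n[of 1] n[of 2] two by simp_all
    then show False
      using k1(3) k2(3) separators_ins[of "(k1, c)"] k1(1) unfolding eq[symmetric] by auto
  qed
  then show False
    using no_grid[OF h(1) h'(1) ne ty k1(1) k2(1)] k1 k2 cross by simp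
qed

lemma card_fixed_separators:
  assumes "v \<in> V" "v \<noteq> \<one>\<^bsub>G\<^esub>"
  shows "card (separators x y \<inter> fixed v) \<le> 2 * g"
proof -
  have "inj_on fst (separators x y \<inter> fixed v)" using fixed_inj[OF assms] by (rule inj_on_subset) blast
  moreover have "fst ` (separators x y \<inter> fixed v) \<subseteq> X" using fst_wall by (auto simp only: fixed_def)
  ultimately have "card (separators x y \<inter> fixed v) \<le> card X"
    by (intro card_inj_on_le) (auto simp: X_def)
  then show ?thesis by (simp add: X_def)
qed

section \<open>Comparing displacements\<close>

lemma separators_classes:
  assumes "x \<in> V" "y \<in> V"
  shows "card (separators x y) = card (separators x y \<inter> fixed v)
    + card (separators x y \<inter> peripheral v) + card (separators x y \<inter> axial v)"
proof -
  have fin: "finite (separators x y)" using assms by (rule finite_separators)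
  have "separators x y = (separators x y \<inter> fixed v) \<union> (separators x y \<inter> peripheral v) \<union> (separators x y \<inter> axial v)"
    unfolding separators_def fixed_def peripheral_def axial_def by blast
  moreover have "(separators x y \<inter> fixed v) \<inter> (separators x y \<inter> peripheral v) = {}"
    "((separators x y \<inter> fixed v) \<union> (separators x y \<inter> peripheral v)) \<inter> (separators x y \<inter> axial v) = {}"
    unfolding fixed_def peripheral_def axial_def by blast+
  ultimately show ?thesis using fin by (metis card_Un_disjoint finite_Int finite_Un)
qed

text \<open>The displacement at each end is at least the shift plus twice the number of peripheral
  walls beyond that end. Doubling the count of walls between the two points leaves the error
  \<open>2 * (4 * g + 2 * g)\<close> from axial and stabilised walls.\<close>

lemma close_translate:
  assumes v: "v \<in> V" "v \<noteq> \<one>\<^bsub>G\<^esub>" and x: "x \<in> V" and y: "y \<in> V"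
  shows "\<exists>n. 2 * card (separators x (vpow v n \<otimes>\<^bsub>G\<^esub> y))
    \<le> card (separators x (v \<otimes>\<^bsub>G\<^esub> x)) + card (separators y (v \<otimes>\<^bsub>G\<^esub> y)) + 12 * g"
proof -
  obtain n where n: "card (separators x (vpow v n \<otimes>\<^bsub>G\<^esub> y) \<inter> axial v) \<le> shift v x + 4 * g"
    using axial_close[OF v(1) x y] by blast
  let ?z = "vpow v n \<otimes>\<^bsub>G\<^esub> y"
  have z: "?z \<in> V" using v y by simp
  \<comment> \<open>\<open>vpow v n\<close> commutes with \<open>v\<close>, so moving
    \<open>y\<close> along its orbit keeps its displacement.\<close>
  have "v \<otimes>\<^bsub>G\<^esub> ?z = vpow v n \<otimes>\<^bsub>G\<^esub> (v \<otimes>\<^bsub>G\<^esub> y)"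
    using vpow_commute[OF v(1), of n] v y m_assoc[of v "vpow v n" y] m_assoc[of "vpow v n" v y] by simp
  then have sy: "card (separators ?z (v \<otimes>\<^bsub>G\<^esub> ?z)) = card (separators y (v \<otimes>\<^bsub>G\<^esub> y))"
    using card_separators_act[of "vpow v n" y "v \<otimes>\<^bsub>G\<^esub> y"] v y by simp
  have displacement: "2 * card (beyond v p) + shift v x \<le> card (separators p (v \<otimes>\<^bsub>G\<^esub> p))" if p: "p \<in> V" for p
  proof -
    have vp: "v \<otimes>\<^bsub>G\<^esub> p \<in> V" using v p by simp
    have "ahead v p - ahead v (v \<otimes>\<^bsub>G\<^esub> p) = {}" using ahead_mono[OF v(1) p] by blast
    then have "card (ahead v p - ahead v (v \<otimes>\<^bsub>G\<^esub> p)) = 0" by (simp only: card.empty)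
    then have "card (separators p (v \<otimes>\<^bsub>G\<^esub> p) \<inter> axial v) = shift v p"
      using card_separators_axial[OF p vp, of v] by (simp add: shift_def)
    then show ?thesis
      using separators_classes[OF p vp, of v] card_beyond(1)[OF v(1) p] shift_const[OF v(1) p x] by simp
  qed
  have "card (separators x ?z \<inter> peripheral v) \<le> card (beyond v x \<union> beyond v ?z)"
    using card_beyond(2)[OF v(1)] x z by (intro card_mono separators_peripheral) auto
  also have "\<dots> \<le> card (beyond v x) + card (beyond v ?z)" by (rule card_Un_le)
  finally show ?thesis
    using displacement[OF x] displacement[OF z] n card_fixed_separators[OF v, of x ?z]
      separators_classes[OF x z, of v] sy by (intro exI[of _ n]) linarith
qed

end

section \<open>Conjugator length\<close>

text \<open>Sending \<open>c\<^sub>3\<close> to \<open>c\<^sub>2\<^sup>-\<^sup>1\<close>, \<open>c\<^sub>4\<close> to \<open>c\<^sub>1\<^sup>-\<^sup>1\<close> and the later generators to the identity kills each half of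
  the relator, so \<open>c\<^sub>1\<close> and \<open>c\<^sub>2\<close> may act by arbitrary maps.\<close>

definition affine_letter :: "nat \<times> bool \<Rightarrow> real \<Rightarrow> real" where
  "affine_letter x t =
    (if fst x = 1 then if snd x then t + 1 else t - 1
     else if fst x = 2 then if snd x then 2 * t else t / 2
     else if fst x = 3 then if snd x then t / 2 else 2 * t
     else if fst x = 4 then if snd x then t - 1 else t + 1
     else t)"

definition affine_word :: "nat word \<Rightarrow> real \<Rightarrow> real" where
  "affine_word w = foldr affine_letter w"

lemma affine_word_simps [simp]:
  "affine_word [] t = t" "affine_word (x # w) t = affine_letter x (affine_word w t)"
  "affine_word (v @ w) t = affine_word v (affine_word w t)"
  by (simp_all add: affine_word_def)

lemma affine_word_trivial: "\<forall>x\<in>set w. 4 < fst x \<Longrightarrow> affine_word w t = t"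
  by (induction w) (auto simp: affine_letter_def)

lemma affine_relator: "2 \<le> g \<Longrightarrow> affine_word (surface_relator g) t = t"
proof -
  assume g: "2 \<le> g"
  have "[1..<2 * g + 1] = [1..<5] @ [5..<2 * g + 1]"
    using g upt_add_eq_append[of 1 5 "2 * g + 1 - 5"] by simp
  moreover have "[1..<5] = [1, 2, 3, 4::nat]" by (simp add: upt_conv_Cons)
  ultimately have e: "[1..<2 * g + 1] = [1, 2, 3, 4] @ [5..<2 * g + 1]" by simp
  have "affine_word (map (\<lambda>i. (i, b)) [5..<2 * g + 1]) t = t" for t b
    by (intro affine_word_trivial) auto
  then show ?thesis
    unfolding surface_relator_def e by (simp add: affine_letter_def field_simps del: upt_Suc)
qed

lemma affine_pres_eq:
  assumes "2 \<le> g"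
  shows "pres_eq X {surface_relator g} v w \<Longrightarrow> affine_word v t = affine_word w t"
proof (induction arbitrary: t rule: pres_eq.induct)
  case (cancel v w a)
  have "affine_letter a (affine_letter (letter_inv a) t) = t" for t
    by (simp add: affine_letter_def letter_inv_def)
  then show ?case by simp
qed (use affine_relator[OF assms] in auto)

text \<open>Each letter multiplies the slope by 1, 2 or 1/2, so scaling by \<open>2 ^ k\<close>
  takes at least \<open>k\<close> letters.\<close>

lemma affine_slope: "\<exists>m b. 0 < m \<and> m \<le> 2 ^ length w \<and> (\<forall>t. affine_word w t = m * t + b)"
proof (induction w)
  case (Cons x w)
  then obtain m b where m: "0 < m" "m \<le> 2 ^ length w" "\<And>t. affine_word w t = m * t + b" by blast
  define c :: real where "c = (if fst x = 1 then if snd x then 1 else - 1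
    else if fst x = 4 then if snd x then - 1 else 1 else 0)"
  have "(\<forall>t. affine_letter x t = t + c) \<or> (\<forall>t. affine_letter x t = 2 * t) \<or> (\<forall>t. affine_letter x t = t / 2)"
    by (cases "fst x = 2 \<or> fst x = 3"; cases "snd x") (auto simp: affine_letter_def c_def)
  then consider "\<And>t. affine_letter x t = t + c"
    | "\<And>t. affine_letter x t = 2 * t" | "\<And>t. affine_letter x t = t / 2" by blast
  then show ?case
  proof cases
    case 1
    then show ?thesis using m by (intro exI[of _ m] exI[of _ "b + c"]) auto
  next
    case 2
    then show ?thesis using m by (intro exI[of _ "2 * m"] exI[of _ "2 * b"]) (auto simp: algebra_simps)
  next
    case 3
    have "m / 2 \<le> 2 * 2 ^ length w" using m(1,2) by linarith
    with 3 show ?thesis using m by (intro exI[of _ "m / 2"] exI[of _ "b / 2"]) (auto simp: field_simps)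
  qed
qed (intro exI[of _ 1] exI[of _ 0], simp)

lemma affine_doubling:
  "affine_word (replicate k (2, True)) t = 2 ^ k * t" "affine_word (replicate k (2, False)) t = t / 2 ^ k"
  by (induction k) (simp_all add: affine_letter_def)

text \<open>Each move changes the length by an even number, so parity is an invariant of the group
  element.\<close>

lemma pres_eq_even_length:
  assumes "\<And>r. r \<in> R \<Longrightarrow> even (length r)"
  shows "pres_eq X R v w \<Longrightarrow> even (length v) = even (length w)"
  by (induction rule: pres_eq.induct) (use assms in auto)

section \<open>Word length as the number of separating walls\<close>

context surface
begin

lemma inv_cls: "w \<in> words X \<Longrightarrow> inv\<^bsub>G\<^esub> (cls w) = cls (word_inv w)"
  using one_walk_word_inv[of w] walk_cls[of "[]" w] walk_cls[of "[]" "word_inv w"]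
  by (simp add: one_eq)

lemma one_walk: "w \<in> words X \<Longrightarrow> \<one>\<^bsub>G\<^esub> \<bullet> w = cls w"
  using walk_cls[of "[]" w] by (simp add: one_eq)

lemma surface_gens_letters:
  "surface_gens g \<union> (\<lambda>s. inv\<^bsub>G\<^esub> s) ` surface_gens g = (\<lambda>x. cls [x]) ` (X \<times> UNIV)"
proof -
  have 1: "surface_gens g = (\<lambda>i. cls [(i, True)]) ` X"
    by (simp add: surface_gens_def cls_def X_def)
  have "inv\<^bsub>G\<^esub> (cls [(i, True)]) = cls [(i, False)]" if "i \<in> X" for i
    using inv_cls[of "[(i, True)]"] that by (simp add: word_inv_def letter_inv_def)
  then have 2: "(\<lambda>s. inv\<^bsub>G\<^esub> s) ` surface_gens g = (\<lambda>i. cls [(i, False)]) ` X"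
    unfolding 1 image_image by (intro image_cong) auto
  have 3: "X \<times> (UNIV :: bool set) = (\<lambda>i. (i, True)) ` X \<union> (\<lambda>i. (i, False)) ` X"
    by (auto simp: image_iff)
  show ?thesis unfolding 1[symmetric] unfolding 2 unfolding 1 3 by (simp add: image_Un image_image)
qed

lemma foldr_letters:
  "w \<in> words X \<Longrightarrow> foldr (\<lambda>x y. x \<otimes>\<^bsub>G\<^esub> y) (map (\<lambda>x. cls [x]) w) \<one>\<^bsub>G\<^esub> = cls w"
proof (induction w)
  case (Cons x w)
  then have "[x] \<in> words X" "w \<in> words X" by auto
  then show ?case using Cons.IH cls_mult[of "[x]" w] by simp
qed (simp add: one_eq)

abbreviation len :: "nat word set \<Rightarrow> nat" where
  "len \<equiv> word_length G (surface_gens g)"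

lemma len_eq_Least: "len u = (LEAST n. \<exists>w\<in>words X. length w = n \<and> u = cls w)"
proof -
  define T where "T = surface_gens g \<union> (\<lambda>s. inv\<^bsub>G\<^esub> s) ` surface_gens g"
  define f where "f xs = foldr (\<lambda>x y. x \<otimes>\<^bsub>G\<^esub> y) xs \<one>\<^bsub>G\<^esub>" for xs
  let ?m = "map (\<lambda>x. cls [x])"
  have f: "f (?m w) = cls w" if "w \<in> words X" for w
    unfolding f_def by (rule foldr_letters[OF that])
  have T: "lists T = ?m ` words X"
    unfolding T_def surface_gens_letters words_def by (rule lists_image)
  have "(\<exists>xs. length xs = n \<and> set xs \<subseteq> T \<and> u = f xs) \<longleftrightarrow> (\<exists>w\<in>words X. length w = n \<and> u = cls w)" for n
  proof
    assume "\<exists>xs. length xs = n \<and> set xs \<subseteq> T \<and> u = f xs"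
    then obtain xs where xs: "length xs = n" "set xs \<subseteq> T" "u = f xs" by blast
    then have "xs \<in> lists T" by (simp add: lists_eq_set)
    then obtain w where w: "w \<in> words X" "xs = ?m w" unfolding T by blast
    then show "\<exists>w\<in>words X. length w = n \<and> u = cls w"
      using xs(1,3) f[OF w(1)] by (intro bexI[OF _ w(1)]) simp
  next
    assume "\<exists>w\<in>words X. length w = n \<and> u = cls w"
    then obtain w where w: "w \<in> words X" "length w = n" "u = cls w" by blast
    then have "?m w \<in> lists T" unfolding T by blast
    then have "set (?m w) \<subseteq> T" unfolding lists_eq_set by blast
    then show "\<exists>xs. length xs = n \<and> set xs \<subseteq> T \<and> u = f xs"
      using w f[OF w(1)] by (intro exI[of _ "?m w"]) simp
  qed
  then show ?thesis unfolding word_length_def T_def[symmetric] f_def[symmetric] by simp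
qed

text \<open>Every word for \<open>u\<close> crosses each separating wall at least once, and a
  geodesic crosses each exactly once.\<close>

lemma len_separators: "u \<in> V \<Longrightarrow> len u = card (separators \<one>\<^bsub>G\<^esub> u)"
  unfolding len_eq_Least
proof (rule Least_equality)
  assume "u \<in> V"
  then obtain w where w: "w \<in> words X" "u = \<one>\<^bsub>G\<^esub> \<bullet> w" "distinct (wall_list \<one>\<^bsub>G\<^esub> w)"
    using geodesic_ex[OF one_closed] by blast
  then show "\<exists>w\<in>words X. length w = card (separators \<one>\<^bsub>G\<^esub> u) \<and> u = cls w"
    using card_separators_distinct[OF one_closed w(1,3)] one_walk by auto
next
  fix n assume "\<exists>w\<in>words X. length w = n \<and> u = cls w"
  then show "card (separators \<one>\<^bsub>G\<^esub> u) \<le> n"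
    using card_separators_le[OF one_closed] by (auto simp flip: one_walk)
qed

lemma len_word:
  assumes "u \<in> V"
  obtains w where "w \<in> words X" "u = cls w" "length w = len u"
proof -
  have "u \<in> cls ` words X" using assms unfolding V_eq .
  then have "\<exists>n. \<exists>w\<in>words X. length w = n \<and> u = cls w" by blast
  from LeastI_ex[OF this] show ?thesis unfolding len_eq_Least[symmetric] using that by blast
qed

lemma len_le: "w \<in> words X \<Longrightarrow> len (cls w) \<le> length w"
  unfolding len_eq_Least by (rule Least_le) blast

lemma card_separators_len:
  assumes "p \<in> V" "q \<in> V"
  shows "card (separators p q) = len (inv\<^bsub>G\<^esub> p \<otimes>\<^bsub>G\<^esub> q)"
  using card_separators_act[of "inv\<^bsub>G\<^esub> p" p q] assms len_separators[of "inv\<^bsub>G\<^esub> p \<otimes>\<^bsub>G\<^esub> q"] by simp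

section \<open>Bounds for the conjugator length function\<close>

lemma conjugator_length_bound:
  assumes "conjugate G u v" "len u + len v \<le> 2 * n + 1"
  shows "conjugator_length G (surface_gens g) u v \<le> n + 6 * g"
proof -
  obtain w where uvw: "u \<in> V" "v \<in> V" "w \<in> V" and u: "u = inv\<^bsub>G\<^esub> w \<otimes>\<^bsub>G\<^esub> v \<otimes>\<^bsub>G\<^esub> w"
    using assms(1) by (auto simp: conjugate_def)
  have bound: "conjugator_length G (surface_gens g) u v \<le> len z"
    if "z \<in> V" "u = inv\<^bsub>G\<^esub> z \<otimes>\<^bsub>G\<^esub> v \<otimes>\<^bsub>G\<^esub> z" for z
    unfolding conjugator_length_def by (rule Least_le) (use that in blast)
  show ?thesis
  proof (cases "v = \<one>\<^bsub>G\<^esub>")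
    \<comment> \<open>\<open>close_translate\<close> excludes the identity; here both elements are
      trivial and the identity conjugates them.\<close>
    case True
    then have "u = \<one>\<^bsub>G\<^esub>" using u uvw by simp
    then have "conjugator_length G (surface_gens g) u v \<le> len \<one>\<^bsub>G\<^esub>"
      using True by (intro bound) simp_all
    then show ?thesis using len_separators[of "\<one>\<^bsub>G\<^esub>"] by simp
  next
    case False
    \<comment> \<open>Multiplying a conjugator on the left by a power of \<open>v\<close> gives
      another conjugator; one close to the identity is chosen.\<close>
    obtain k where k: "2 * card (separators \<one>\<^bsub>G\<^esub> (vpow v k \<otimes>\<^bsub>G\<^esub> w))
      \<le> card (separators \<one>\<^bsub>G\<^esub> (v \<otimes>\<^bsub>G\<^esub> \<one>\<^bsub>G\<^esub>)) + card (separators w (v \<otimes>\<^bsub>G\<^esub> w)) + 12 * g"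
      using close_translate[OF uvw(2) False one_closed uvw(3)] by blast
    let ?z = "vpow v k \<otimes>\<^bsub>G\<^esub> w" and ?c = "vpow v k"
    have z: "?z \<in> V" using uvw by simp
    have "card (separators w (v \<otimes>\<^bsub>G\<^esub> w)) = len u"
      using card_separators_len[of w "v \<otimes>\<^bsub>G\<^esub> w"] uvw u by (simp add: m_assoc)
    then have "2 * len ?z \<le> len v + len u + 12 * g"
      using k len_separators[OF z] len_separators[OF uvw(2)] uvw by simp
    \<comment> \<open>Half of \<open>2 * n + 1 + 12 * g\<close> is rounded down, which absorbs the
      odd unit.\<close>
    then have *: "len ?z \<le> n + 6 * g" using assms(2) by linarith
    have "?z \<otimes>\<^bsub>G\<^esub> u = ?c \<otimes>\<^bsub>G\<^esub> (w \<otimes>\<^bsub>G\<^esub> u)" using uvw by (simp add: m_assoc)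
    also have "w \<otimes>\<^bsub>G\<^esub> u = v \<otimes>\<^bsub>G\<^esub> w"
      unfolding u using uvw by (simp add: m_assoc[symmetric])
    also have "?c \<otimes>\<^bsub>G\<^esub> (v \<otimes>\<^bsub>G\<^esub> w) = v \<otimes>\<^bsub>G\<^esub> ?z"
      using vpow_commute[OF uvw(2), of k] uvw m_assoc[of ?c v w] m_assoc[of v ?c w] by simp
    finally have "?z \<otimes>\<^bsub>G\<^esub> u = v \<otimes>\<^bsub>G\<^esub> ?z" .
    then have "inv\<^bsub>G\<^esub> ?z \<otimes>\<^bsub>G\<^esub> (?z \<otimes>\<^bsub>G\<^esub> u) = inv\<^bsub>G\<^esub> ?z \<otimes>\<^bsub>G\<^esub> (v \<otimes>\<^bsub>G\<^esub> ?z)" by (rule arg_cong)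
    moreover have "inv\<^bsub>G\<^esub> ?z \<otimes>\<^bsub>G\<^esub> (?z \<otimes>\<^bsub>G\<^esub> u) = u"
      using m_assoc[of "inv\<^bsub>G\<^esub> ?z" ?z u] z uvw by simp
    moreover have "inv\<^bsub>G\<^esub> ?z \<otimes>\<^bsub>G\<^esub> (v \<otimes>\<^bsub>G\<^esub> ?z) = inv\<^bsub>G\<^esub> ?z \<otimes>\<^bsub>G\<^esub> v \<otimes>\<^bsub>G\<^esub> ?z"
      using m_assoc[of "inv\<^bsub>G\<^esub> ?z" v ?z] z uvw by simp
    ultimately show ?thesis using bound[OF z] * by simp
  qed
qed

lemma conjugate_words:
  assumes "v \<in> words X" "w \<in> words X"
  shows "inv\<^bsub>G\<^esub> (cls w) \<otimes>\<^bsub>G\<^esub> cls v \<otimes>\<^bsub>G\<^esub> cls w = cls (word_inv w @ v @ w)"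
  using assms by (simp add: inv_cls cls_mult)

lemma conjugate_len_even:
  assumes "conjugate G u v"
  shows "even (len u + len v)"
proof -
  obtain w where uvw: "u \<in> V" "v \<in> V" "w \<in> V" "u = inv\<^bsub>G\<^esub> w \<otimes>\<^bsub>G\<^esub> v \<otimes>\<^bsub>G\<^esub> w"
    using assms by (auto simp: conjugate_def)
  obtain a where a: "a \<in> words X" "u = cls a" "length a = len u" using len_word[OF uvw(1)] .
  obtain b where b: "b \<in> words X" "v = cls b" "length b = len v" using len_word[OF uvw(2)] .
  obtain c where c: "c \<in> words X" "w = cls c" "length c = len w" using len_word[OF uvw(3)] .
  have "eqv a (word_inv c @ b @ c)"
    using uvw(4) a b c conjugate_words[of b c] cls_eq[of a "word_inv c @ b @ c"] by simp
  then have "even (length a) = even (length (word_inv c @ b @ c))"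
    by (rule pres_eq_even_length[rotated]) (simp add: surface_relator_def)
  then show ?thesis using a b by auto
qed

lemma surface_CL_def': "surface_CL g n = (LEAST N. \<forall>u v. conjugate G u v \<and> len u + len v \<le> n
    \<longrightarrow> conjugator_length G (surface_gens g) u v \<le> N)"
  by (simp add: surface_CL_def conjugator_length_fun_def)

text \<open>Conjugate elements have lengths of equal parity, so raising an even bound by one admits
  no new pair.\<close>

lemma surface_CL_even: "surface_CL g (2 * n) = surface_CL g (2 * n + 1)"
proof -
  have "conjugate G u v \<and> len u + len v \<le> 2 * n \<longleftrightarrow> conjugate G u v \<and> len u + len v \<le> 2 * n + 1" for u v
  proof -
    have "a \<le> 2 * n \<longleftrightarrow> a \<le> 2 * n + 1" if "even a" for a
      using that by presburger
    then show ?thesis using conjugate_len_even by blast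
  qed
  then show ?thesis unfolding surface_CL_def' by simp
qed

lemma surface_CL_upper: "surface_CL g (2 * n + 1) \<le> n + 6 * g"
  unfolding surface_CL_def' by (rule Least_le) (use conjugator_length_bound in blast)

lemma conjugator_length_le_CL:
  assumes "conjugate G u v" "len u + len v \<le> n"
  shows "conjugator_length G (surface_gens g) u v \<le> surface_CL g n"
proof -
  have "\<exists>N. \<forall>u v. conjugate G u v \<and> len u + len v \<le> n \<longrightarrow> conjugator_length G (surface_gens g) u v \<le> N"
    by (intro conjugator_length_fun_exists finite_surface_gens surface_gens_generate)
  from LeastI_ex[OF this] show ?thesis unfolding surface_CL_def' using assms by blast
qed

lemma surface_CL_lower: "k \<le> surface_CL g (2 * (k + 1))"
proof -
  \<comment> \<open>\<open>?ab\<close> has \<open>2 * k + 1\<close> letters, so the pair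
    \<open>?ab\<close>, \<open>?a\<close> meets the bound \<open>2 * (k + 1)\<close>.\<close>
  let ?a = "[(1, True)] :: nat word" and ?b = "replicate k (2, True) :: nat word"
  let ?ab = "replicate k (2, False) @ ?a @ ?b"
  have w: "?a \<in> words X" "?b \<in> words X" "?ab \<in> words X" using genus by (auto simp: words_iff X_def)
  have inv_b: "word_inv ?b = replicate k (2, False)" by (simp add: word_inv_def letter_inv_def)
  have V: "cls ?a \<in> V" "cls ?b \<in> V" "cls ?ab \<in> V" using w unfolding V_eq by blast+
  have conj: "conjugate G (cls ?ab) (cls ?a)"
    unfolding conjugate_def using V conjugate_words[OF w(1,2)] unfolding inv_b by metis
  have "\<exists>m. \<exists>z\<in>V. cls ?ab = inv\<^bsub>G\<^esub> z \<otimes>\<^bsub>G\<^esub> cls ?a \<otimes>\<^bsub>G\<^esub> z \<and> len z = m"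
    using conj unfolding conjugate_def by blast
  from LeastI_ex[OF this] obtain z where z: "z \<in> V" "cls ?ab = inv\<^bsub>G\<^esub> z \<otimes>\<^bsub>G\<^esub> cls ?a \<otimes>\<^bsub>G\<^esub> z"
    "len z = conjugator_length G (surface_gens g) (cls ?ab) (cls ?a)"
    unfolding conjugator_length_def by blast
  obtain c where c: "c \<in> words X" "z = cls c" "length c = len z" using len_word[OF z(1)] .
  have "eqv ?ab (word_inv c @ ?a @ c)"
    using z(2) c conjugate_words[OF w(1) c(1)] cls_eq[OF w(3), of "word_inv c @ ?a @ c"] w by simp
  then have "affine_word ?ab t = affine_word (word_inv c @ ?a @ c) t" for t
    using affine_pres_eq[OF genus] by blast
  moreover have "affine_word c (affine_word (word_inv c) t) = t" for t
  proof -
    have "eqv (word_inv (word_inv c) @ word_inv c) []"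
      unfolding word_inv_def[of "word_inv c"] using c(1) by (intro pres_eq_inv) simp
    then show ?thesis using affine_pres_eq[OF genus, of X _ "[]" t] by fastforce
  qed
  \<comment> \<open>\<open>?ab\<close> acts as translation by \<open>1 / 2 ^ k\<close> and
    \<open>?a\<close> as translation by 1. The action of \<open>c\<close> intertwines them, so its
    slope must be \<open>2 ^ k\<close>.\<close>
  ultimately have conj_affine: "affine_word c (t + 1 / 2 ^ k) = affine_word c t + 1" for t
    by (simp add: affine_doubling affine_letter_def add_divide_distrib)
  obtain m b where m: "m \<le> 2 ^ length c" "\<And>t. affine_word c t = m * t + b" using affine_slope by blast
  have "m * (1 / 2 ^ k) + b = b + 1"
    using conj_affine[of 0] unfolding m(2) by (simp only: add_0_left mult_zero_right)
  then have "m * (1 / 2 ^ k) = 1" by linarith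
  moreover have "m = m * (1 / 2 ^ k) * 2 ^ k" by simp
  ultimately have "m = 2 ^ k" by simp
  then have "(2::real) ^ k \<le> 2 ^ length c" using m(1) by simp
  then have "k \<le> length c" by simp
  also have "length c \<le> surface_CL g (2 * (k + 1))"
    unfolding c(3) z(3)
    using len_le[OF w(1)] len_le[OF w(3)] by (intro conjugator_length_le_CL[OF conj]) simp
  finally show ?thesis .
qed

end

theorem theorem1p1:
  fixes g n :: nat
  assumes "g \<ge> 2"
  shows "int n - 1 \<le> int (surface_CL g (2 * n))
    \<and> surface_CL g (2 * n) = surface_CL g (2 * n + 1)
    \<and> int (surface_CL g (2 * n + 1)) \<le> int n + 8 * int g - 1"
proof -
  interpret surface g by unfold_locales (rule assms)
  \<comment> \<open>For \<open>n = 0\<close> the left side is negative; otherwise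
    \<open>surface_CL_lower\<close> applies with \<open>k = n - 1\<close>.\<close>
  have "int n - 1 \<le> int (surface_CL g (2 * n))"
    using surface_CL_lower[of "n - 1"] by (cases n) auto
  \<comment> \<open>The bound \<open>n + 6 * g\<close> lies below the stated one because
    \<open>2 * g\<close> is at least 1.\<close>
  moreover have "int (surface_CL g (2 * n + 1)) \<le> int n + 8 * int g - 1"
    using surface_CL_upper[of n] assms by linarith
  ultimately show ?thesis using surface_CL_even[of n] by blast
qed

end
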